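(* Let $\varepsilon\in\{\pm1\}$ and let $(M,g,J,\omega)$ be an almost $\varepsilon$-Hermitian six-manifold. Then $M$ is a strict nearly $\varepsilon$-Kähler manifold with $\|\nabla J\|^2\ne0$ if and only if there is a reduction $\Psi=\psi^++\mathrm i_\varepsilon\psi^-$ to $\mathrm{SU}^\varepsilon(p,q)$ which satisfies $$d\omega=3\,\psi^+,\qquad d\psi^-=2\,\kappa\,\omega\wedge\omega,$$ where $\kappa=\frac14\|\nabla J\|^2$ is constant and non-zero.
   Context: An almost $\varepsilon$-Hermitian structure on a $2m$-manifold $M$ is a triple $(g,J,\omega)$, where $J$ is an endomorphism field with $J^2=\varepsilon\,\mathrm{id}$ (and, if $\varepsilon=1$, both eigenbundles for $\pm1$ have rank $m$), $g$ is a pseudo-Riemannian metric (of arbitrary signature) with $g(J\cdot,J\cdot)=-\varepsilon g(\cdot,\cdot)$, and $\omega=g(\cdot,J\cdot)$. With $\nabla$ the Levi-Civita connection of $g$, it is nearly $\varepsilon$-Kähler if $(\nabla_XJ)X=0$ for all vector fields $X$, and strict if moreover $\nabla_XJ\neq0$ for all non-trivial vector fields $X$. For a nearly $\varepsilon$-Kähler structure $A(X,Y,Z)=g((\nabla_XJ)Y,Z)$ is a three-form, and $\|\nabla J\|^2=\|A\|^2$ denotes its squared length as a three-form with respect to $g$ (sum over $i<j<k$ in a pseudo-orthonormal frame). The $\varepsilon$-complex numbers are $\mathbb C_\varepsilon=\{x+\mathrm i_\varepsilon y: x,y\in\mathbb R\}$ with $\mathrm i_\varepsilon^2=\varepsilon$.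 $TM\otimes\mathbb C_\varepsilon=TM^{1,0}\oplus TM^{0,1}$ is the decomposition into the $\pm\mathrm i_\varepsilon$-eigenbundles of $J$, and $\Lambda^{r,s}$ denotes the induced bigrading of $\mathbb C_\varepsilon$-valued forms. A reduction of an almost $\varepsilon$-Hermitian six-manifold to $\mathrm{SU}^\varepsilon(p,q)$, $p+q=3$ (isomorphic to $\mathrm{SU}(p,q)$ for $\varepsilon=-1$ and to $\mathrm{SL}(3,\mathbb R)$ for $\varepsilon=1$), is a global $(3,0)$-form $\Psi=\psi^++\mathrm i_\varepsilon\psi^-$ ($\psi^\pm$ real) of constant non-zero length with respect to $g$. Then $\psi^-=J^*\psi^+$, where $J^*\psi^+(X,Y,Z)=\psi^+(JX,JY,JZ)$.
   Formalization: The six-manifold M is assumed connected; without this the claim that κ is constant fails, e.g. on the disjoint union of two nearly Kähler six-spheres of different radii. *)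

theory Defs
  imports "HOL-Analysis.Analysis"
begin

section \<open>Smooth manifolds\<close>

(* Meant for open S and finite-dimensional 'v: C^k is expressed by iterated directional
   derivatives. *)
primrec Ck_on :: "nat \<Rightarrow> 'v::real_normed_vector set \<Rightarrow> ('v \<Rightarrow> 'w::real_normed_vector) \<Rightarrow> bool" where
  "Ck_on 0 S f \<longleftrightarrow> continuous_on S f"
| "Ck_on (Suc k) S f \<longleftrightarrow>
     (\<forall>x\<in>S. f differentiable (at x)) \<and> (\<forall>u. Ck_on k S (\<lambda>x. frechet_derivative f (at x) u))"

definition smooth_on :: "'v::real_normed_vector set \<Rightarrow> ('v \<Rightarrow> 'w::real_normed_vector) \<Rightarrow> bool" where
  "smooth_on S f \<longleftrightarrow> (\<forall>k. Ck_on k S f)"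

(* A chart is a pair (U, phi); the values of phi outside U are irrelevant. *)
type_synonym ('a, 'n) chart = "'a set \<times> ('a \<Rightarrow> real ^ 'n)"

definition is_chart :: "'a topology \<Rightarrow> ('a, 'n::finite) chart \<Rightarrow> bool" where
  "is_chart M c \<longleftrightarrow> openin M (fst c) \<and> open (snd c ` fst c) \<and>
     homeomorphic_map (subtopology M (fst c)) (top_of_set (snd c ` fst c)) (snd c)"

definition chart_inv :: "('a, 'n::finite) chart \<Rightarrow> real ^ 'n \<Rightarrow> 'a" where
  "chart_inv c = inv_into (fst c) (snd c)"

definition transition :: "('a, 'n::finite) chart \<Rightarrow> ('a, 'n) chart \<Rightarrow> real ^ 'n \<Rightarrow> real ^ 'n" where
  "transition c d = snd d \<circ> chart_inv c"

(* The atlas need not be maximal. *)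
definition smooth_manifold :: "'a topology \<Rightarrow> ('a, 'n::finite) chart set \<Rightarrow> bool" where
  "smooth_manifold M \<A> \<longleftrightarrow>
     Hausdorff_space M \<and> second_countable M \<and>
     (\<forall>c\<in>\<A>. is_chart M c) \<and> (\<Union>c\<in>\<A>. fst c) = topspace M \<and>
     (\<forall>c\<in>\<A>. \<forall>d\<in>\<A>. smooth_on (snd c ` (fst c \<inter> fst d)) (transition c d))"

(* The tangent space at p is real ^ 'n, a vector being identified with its coordinates in the
   preferred chart chart_at \<A> p. Tensors at p are thus multilinear maps on real ^ 'n. The choice
   of chart may jump from point to point, so smoothness and derivatives of tensor fields are
   always taken after transport to one fixed chart by the Jacobians tangent_of and coords_of. *)
definition chart_at :: "('a, 'n::finite) chart set \<Rightarrow> 'a \<Rightarrow> ('a, 'n) chart" where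
  "chart_at \<A> p = (SOME c. c \<in> \<A> \<and> p \<in> fst c)"

(* The tangent vector at p whose coordinates in the chart c are u. *)
definition tangent_of ::
    "('a, 'n::finite) chart set \<Rightarrow> ('a, 'n) chart \<Rightarrow> 'a \<Rightarrow> real ^ 'n \<Rightarrow> real ^ 'n" where
  "tangent_of \<A> c p u = frechet_derivative (transition c (chart_at \<A> p)) (at (snd c p)) u"

(* The coordinates in the chart c of the tangent vector w at p. *)
definition coords_of ::
    "('a, 'n::finite) chart set \<Rightarrow> ('a, 'n) chart \<Rightarrow> 'a \<Rightarrow> real ^ 'n \<Rightarrow> real ^ 'n" where
  "coords_of \<A> c p w =
     frechet_derivative (transition (chart_at \<A> p) c) (at (snd (chart_at \<A> p) p)) w"

section \<open>Tensor fields\<close>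

type_synonym ('a, 'n) vfield = "'a \<Rightarrow> real ^ 'n"
type_synonym ('a, 'n) endo = "'a \<Rightarrow> real ^ 'n \<Rightarrow> real ^ 'n"
type_synonym ('a, 'n) cov2 = "'a \<Rightarrow> real ^ 'n \<Rightarrow> real ^ 'n \<Rightarrow> real"
type_synonym ('a, 'n) cov3 = "'a \<Rightarrow> real ^ 'n \<Rightarrow> real ^ 'n \<Rightarrow> real ^ 'n \<Rightarrow> real"

(* Coordinate expressions, at the coordinate point x and on the coordinate vectors u, v, w. *)
definition vfield_in ::
    "('a, 'n::finite) chart set \<Rightarrow> ('a, 'n) chart \<Rightarrow> ('a, 'n) vfield \<Rightarrow> real ^ 'n \<Rightarrow> real ^ 'n" where
  "vfield_in \<A> c Y x = (let p = chart_inv c x in coords_of \<A> c p (Y p))"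

definition endo_in ::
    "('a, 'n::finite) chart set \<Rightarrow> ('a, 'n) chart \<Rightarrow> ('a, 'n) endo \<Rightarrow> real ^ 'n \<Rightarrow> real ^ 'n \<Rightarrow> real ^ 'n"
  where "endo_in \<A> c J x u =
     (let p = chart_inv c x in coords_of \<A> c p (J p (tangent_of \<A> c p u)))"

definition cov2_in ::
    "('a, 'n::finite) chart set \<Rightarrow> ('a, 'n) chart \<Rightarrow> ('a, 'n) cov2 \<Rightarrow>
     real ^ 'n \<Rightarrow> real ^ 'n \<Rightarrow> real ^ 'n \<Rightarrow> real"
  where "cov2_in \<A> c T x u v =
     (let p = chart_inv c x in T p (tangent_of \<A> c p u) (tangent_of \<A> c p v))"

definition cov3_in ::
    "('a, 'n::finite) chart set \<Rightarrow> ('a, 'n) chart \<Rightarrow> ('a, 'n) cov3 \<Rightarrow>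
     real ^ 'n \<Rightarrow> real ^ 'n \<Rightarrow> real ^ 'n \<Rightarrow> real ^ 'n \<Rightarrow> real"
  where "cov3_in \<A> c T x u v w =
     (let p = chart_inv c x
      in T p (tangent_of \<A> c p u) (tangent_of \<A> c p v) (tangent_of \<A> c p w))"

definition smooth_endo :: "'a topology \<Rightarrow> ('a, 'n::finite) chart set \<Rightarrow> ('a, 'n) endo \<Rightarrow> bool" where
  "smooth_endo M \<A> J \<longleftrightarrow> (\<forall>p\<in>topspace M. linear (J p)) \<and>
     (\<forall>c\<in>\<A>. \<forall>u. smooth_on (snd c ` fst c) (\<lambda>x. endo_in \<A> c J x u))"

definition smooth_metric :: "'a topology \<Rightarrow> ('a, 'n::finite) chart set \<Rightarrow> ('a, 'n) cov2 \<Rightarrow> bool" where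
  "smooth_metric M \<A> g \<longleftrightarrow>
     (\<forall>p\<in>topspace M. bilinear (g p) \<and> (\<forall>u v. g p u v = g p v u) \<and>
        (\<forall>u. (\<forall>v. g p u v = 0) \<longrightarrow> u = 0)) \<and>
     (\<forall>c\<in>\<A>. \<forall>u v. smooth_on (snd c ` fst c) (\<lambda>x. cov2_in \<A> c g x u v))"

definition three_form :: "'a topology \<Rightarrow> ('a, 'n::finite) chart set \<Rightarrow> ('a, 'n) cov3 \<Rightarrow> bool" where
  "three_form M \<A> T \<longleftrightarrow>
     (\<forall>p\<in>topspace M. (\<forall>v w. linear (\<lambda>u. T p u v w)) \<and>
        (\<forall>u v w. T p u v w = - T p v u w) \<and> (\<forall>u v w. T p u v w = - T p u w v)) \<and>
     (\<forall>c\<in>\<A>. \<forall>u v w. smooth_on (snd c ` fst c) (\<lambda>x. cov3_in \<A> c T x u v w))"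

section \<open>Exterior calculus\<close>

(* The exterior derivative is computed on vector fields that are constant in the chart
   chart_at \<A> p, so no Lie bracket terms occur. Neither d nor the wedge product carries a
   normalising factor: d(f dx dy) = df \<and> dx \<and> dy and (dx \<and> dy)(X,Y) = dx(X) dy(Y) - dx(Y) dy(X). *)
definition ext_deriv2 :: "('a, 'n::finite) chart set \<Rightarrow> ('a, 'n) cov2 \<Rightarrow> ('a, 'n) cov3" where
  "ext_deriv2 \<A> \<alpha> p u v w =
     (let c = chart_at \<A> p;
          D = (\<lambda>a b e. frechet_derivative (\<lambda>x. cov2_in \<A> c \<alpha> x b e) (at (snd c p)) a)
      in D u v w - D v u w + D w u v)"

definition ext_deriv3 ::
    "('a, 'n::finite) chart set \<Rightarrow> ('a, 'n) cov3 \<Rightarrow>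
     'a \<Rightarrow> real ^ 'n \<Rightarrow> real ^ 'n \<Rightarrow> real ^ 'n \<Rightarrow> real ^ 'n \<Rightarrow> real" where
  "ext_deriv3 \<A> \<beta> p u v w z =
     (let c = chart_at \<A> p;
          D = (\<lambda>a b e f. frechet_derivative (\<lambda>x. cov3_in \<A> c \<beta> x b e f) (at (snd c p)) a)
      in D u v w z - D v u w z + D w u v z - D z u v w)"

definition wedge22 ::
    "('a, 'n::finite) cov2 \<Rightarrow> ('a, 'n) cov2 \<Rightarrow>
     'a \<Rightarrow> real ^ 'n \<Rightarrow> real ^ 'n \<Rightarrow> real ^ 'n \<Rightarrow> real ^ 'n \<Rightarrow> real" where
  "wedge22 \<alpha> \<beta> p u v w z =
     \<alpha> p u v * \<beta> p w z - \<alpha> p u w * \<beta> p v z + \<alpha> p u z * \<beta> p v w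
     + \<alpha> p v w * \<beta> p u z - \<alpha> p v z * \<beta> p u w + \<alpha> p w z * \<beta> p u v"

section \<open>The Levi-Civita connection\<close>

(* \<Gamma> u v is the covariant derivative at p, in direction u, of the field with constant coordinates
   v in the chart chart_at \<A> p. Since such fields commute, symmetry of \<Gamma> says that the torsion
   vanishes; the last condition says that g is parallel. *)
definition christoffel ::
    "('a, 'n::finite) chart set \<Rightarrow> ('a, 'n) cov2 \<Rightarrow> 'a \<Rightarrow> real ^ 'n \<Rightarrow> real ^ 'n \<Rightarrow> real ^ 'n" where
  "christoffel \<A> g p =
     (let c = chart_at \<A> p in
      THE \<Gamma>. bilinear \<Gamma> \<and> (\<forall>u v. \<Gamma> u v = \<Gamma> v u) \<and>
        (\<forall>u v w. frechet_derivative (\<lambda>x. cov2_in \<A> c g x v w) (at (snd c p)) u =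
           g p (\<Gamma> u v) w + g p v (\<Gamma> u w)))"

definition levi_civita ::
    "('a, 'n::finite) chart set \<Rightarrow> ('a, 'n) cov2 \<Rightarrow> 'a \<Rightarrow> real ^ 'n \<Rightarrow> ('a, 'n) vfield \<Rightarrow> real ^ 'n" where
  "levi_civita \<A> g p u Y =
     (let c = chart_at \<A> p in
      frechet_derivative (vfield_in \<A> c Y) (at (snd c p)) u + christoffel \<A> g p u (Y p))"

(* The vector (\<nabla>_u J) v at p, by the Leibniz rule \<nabla>_u (J V) = (\<nabla>_u J) V + J (\<nabla>_u V) for the local
   extension V of v that is constant in the chart chart_at \<A> p. *)
definition nabla_endo ::
    "('a, 'n::finite) chart set \<Rightarrow> ('a, 'n) cov2 \<Rightarrow> ('a, 'n) endo \<Rightarrow>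
     'a \<Rightarrow> real ^ 'n \<Rightarrow> real ^ 'n \<Rightarrow> real ^ 'n" where
  "nabla_endo \<A> g J p u v =
     (let V = (\<lambda>q. tangent_of \<A> (chart_at \<A> p) q v) in
      levi_civita \<A> g p u (\<lambda>q. J q (V q)) - J p (levi_civita \<A> g p u V))"

section \<open>Squared lengths\<close>

definition pseudo_orthonormal ::
    "(real ^ 'n \<Rightarrow> real ^ 'n \<Rightarrow> real) \<Rightarrow> ('n::finite \<Rightarrow> real ^ 'n) \<Rightarrow> bool" where
  "pseudo_orthonormal h e \<longleftrightarrow>
     (\<forall>i. h (e i) (e i) = 1 \<or> h (e i) (e i) = - 1) \<and> (\<forall>i j. i \<noteq> j \<longrightarrow> h (e i) (e j) = 0)"

(* For Q = T^2 with T a three-form this is the sum over i < j < k, the 3! orderings of each index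
   triple contributing equally. Summing over all triples makes the squared length of an arbitrary
   trilinear T independent of the frame; this matters because g((\<nabla>_X J) Y, Z) need not be
   alternating for a general almost \<epsilon>-Hermitian structure. *)
definition frame_sum3 ::
    "(real ^ 'n \<Rightarrow> real ^ 'n \<Rightarrow> real) \<Rightarrow>
     (real ^ 'n \<Rightarrow> real ^ 'n \<Rightarrow> real ^ 'n \<Rightarrow> real) \<Rightarrow> real" where
  "frame_sum3 h Q =
     (let e = (SOME e :: 'n::finite \<Rightarrow> real ^ 'n. pseudo_orthonormal h e) in
      (\<Sum>i\<in>UNIV. \<Sum>j\<in>UNIV. \<Sum>k\<in>UNIV.
         h (e i) (e i) * h (e j) (e j) * h (e k) (e k) * Q (e i) (e j) (e k)) / 6)"

definition sqnorm_nabla ::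
    "('a, 'n::finite) chart set \<Rightarrow> ('a, 'n) cov2 \<Rightarrow> ('a, 'n) endo \<Rightarrow> 'a \<Rightarrow> real" where
  "sqnorm_nabla \<A> g J p =
     frame_sum3 (g p) (\<lambda>u v w. (g p (nabla_endo \<A> g J p u v) w)\<^sup>2)"

section \<open>Almost and nearly \<open>\<epsilon>\<close>-Hermitian structures\<close>

definition almost_eps_hermitian ::
    "real \<Rightarrow> 'a topology \<Rightarrow> ('a, 'n::finite) chart set \<Rightarrow>
     ('a, 'n) cov2 \<Rightarrow> ('a, 'n) endo \<Rightarrow> ('a, 'n) cov2 \<Rightarrow> bool" where
  "almost_eps_hermitian \<epsilon> M \<A> g J \<omega> \<longleftrightarrow>
     smooth_metric M \<A> g \<and> smooth_endo M \<A> J \<and>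
     (\<forall>p\<in>topspace M.
        (\<forall>u. J p (J p u) = \<epsilon> *\<^sub>R u) \<and>
        (\<epsilon> = 1 \<longrightarrow> 2 * dim {u. J p u = u} = CARD('n) \<and> 2 * dim {u. J p u = - u} = CARD('n)) \<and>
        (\<forall>u v. g p (J p u) (J p v) = - \<epsilon> * g p u v) \<and>
        (\<forall>u v. \<omega> p u v = g p u (J p v)))"

definition nearly_kaehler ::
    "'a topology \<Rightarrow> ('a, 'n::finite) chart set \<Rightarrow> ('a, 'n) cov2 \<Rightarrow> ('a, 'n) endo \<Rightarrow> bool" where
  "nearly_kaehler M \<A> g J \<longleftrightarrow> (\<forall>p\<in>topspace M. \<forall>u. nabla_endo \<A> g J p u u = 0)"

definition strict_nearly_kaehler ::
    "'a topology \<Rightarrow> ('a, 'n::finite) chart set \<Rightarrow> ('a, 'n) cov2 \<Rightarrow> ('a, 'n) endo \<Rightarrow> bool" where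
  "strict_nearly_kaehler M \<A> g J \<longleftrightarrow> nearly_kaehler M \<A> g J \<and>
     (\<forall>p\<in>topspace M. \<forall>u. u \<noteq> 0 \<longrightarrow> (\<exists>v. nabla_endo \<A> g J p u v \<noteq> 0))"

section \<open>\<open>\<epsilon>\<close>-complex forms\<close>

(* The pair (x, y) stands for x + i_\<epsilon> y, both for \<epsilon>-complex numbers ('v = real) and for vectors in
   the complexified tangent space ('v = real ^ 'n). *)
definition ieps_times :: "real \<Rightarrow> 'v::real_vector \<times> 'v \<Rightarrow> 'v \<times> 'v" where
  "ieps_times \<epsilon> z = (\<epsilon> *\<^sub>R snd z, fst z)"

(* z times its conjugate. *)
definition eps_sqmod :: "real \<Rightarrow> real \<times> real \<Rightarrow> real" where
  "eps_sqmod \<epsilon> z = (fst z)\<^sup>2 - \<epsilon> * (snd z)\<^sup>2"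

definition eps_extend ::
    "real \<Rightarrow> ('v::real_vector \<Rightarrow> real \<times> real) \<Rightarrow> 'v \<times> 'v \<Rightarrow> real \<times> real" where
  "eps_extend \<epsilon> f Z = f (fst Z) + ieps_times \<epsilon> (f (snd Z))"

definition eps_extend3 ::
    "real \<Rightarrow> ('v::real_vector \<Rightarrow> 'v \<Rightarrow> 'v \<Rightarrow> real \<times> real) \<Rightarrow>
     'v \<times> 'v \<Rightarrow> 'v \<times> 'v \<Rightarrow> 'v \<times> 'v \<Rightarrow> real \<times> real" where
  "eps_extend3 \<epsilon> F Z1 Z2 Z3 =
     eps_extend \<epsilon> (\<lambda>u. eps_extend \<epsilon> (\<lambda>v. eps_extend \<epsilon> (\<lambda>w. F u v w) Z3) Z2) Z1"

definition T01 :: "real \<Rightarrow> ('v::real_vector \<Rightarrow> 'v) \<Rightarrow> ('v \<times> 'v) set" where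
  "T01 \<epsilon> j = {Z. (j (fst Z), j (snd Z)) = - ieps_times \<epsilon> Z}"

definition form30 ::
    "real \<Rightarrow> 'a topology \<Rightarrow> ('a, 'n::finite) chart set \<Rightarrow> ('a, 'n) endo \<Rightarrow>
     ('a \<Rightarrow> real ^ 'n \<Rightarrow> real ^ 'n \<Rightarrow> real ^ 'n \<Rightarrow> real \<times> real) \<Rightarrow> bool" where
  "form30 \<epsilon> M \<A> J \<Psi> \<longleftrightarrow>
     three_form M \<A> (\<lambda>p u v w. fst (\<Psi> p u v w)) \<and>
     three_form M \<A> (\<lambda>p u v w. snd (\<Psi> p u v w)) \<and>
     (\<forall>p\<in>topspace M. \<forall>Z1 Z2 Z3.
        Z1 \<in> T01 \<epsilon> (J p) \<or> Z2 \<in> T01 \<epsilon> (J p) \<or> Z3 \<in> T01 \<epsilon> (J p) \<longrightarrow>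
        eps_extend3 \<epsilon> (\<Psi> p) Z1 Z2 Z3 = 0)"

(* The length of \<Psi> is taken with the Hermitian extension of g, since the \<epsilon>-bilinear extension
   vanishes on (3,0)-forms. The pair (p,q) in SU^\<epsilon>(p,q) is determined by the signature of g. *)
definition su_reduction ::
    "real \<Rightarrow> 'a topology \<Rightarrow> ('a, 'n::finite) chart set \<Rightarrow> ('a, 'n) cov2 \<Rightarrow> ('a, 'n) endo \<Rightarrow>
     ('a \<Rightarrow> real ^ 'n \<Rightarrow> real ^ 'n \<Rightarrow> real ^ 'n \<Rightarrow> real \<times> real) \<Rightarrow> bool" where
  "su_reduction \<epsilon> M \<A> g J \<Psi> \<longleftrightarrow> form30 \<epsilon> M \<A> J \<Psi> \<and>
     (\<exists>l. l \<noteq> 0 \<and> (\<forall>p\<in>topspace M. frame_sum3 (g p) (\<lambda>u v w. eps_sqmod \<epsilon> (\<Psi> p u v w)) = l))"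

end

(* Put psi^+ = nabla omega. For a nearly eps-Kaehler structure this is a three-form of type
   (3,0) + (0,3), so d omega = 3 psi^+ and d psi^+ = 0. The part of nabla psi^+ that is not of type
   (3,0) + (0,3) is quadratic in nabla J, because it comes from differentiating the type condition
   psi^+(Ju,v,w) = psi^+(u,Jv,w). Hence d psi^+ = 0 forces d psi^-, with psi^- = J^* psi^+, to be an
   algebraic expression in psi^+, and in an adapted frame this expression is 2 kappa omega^omega with
   kappa = |nabla J|^2 / 4. Applying d once more gives d kappa ^ omega ^ omega = 0, so kappa is constant.

   Conversely, d omega = 3 psi^+ leaves only the W_2-part S of nabla omega - psi^+ undetermined. The
   (2,2)-parts of d psi^+ = 0 and d psi^- = 2 kappa omega^omega are linear in S and force S = 0. *)
theory Submission
  imports Defs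
begin

section \<open>Smooth functions on open sets\<close>

text \<open>Type is used in the real form psi(Ju,v,w) = psi(u,Jv,w), which treats
  \<open>\<epsilon> = 1\<close> and \<open>\<epsilon> = - 1\<close> alike;
  \<open>\<epsilon>\<close>-complex vectors occur only where the definition of a (3,0)-form is met.
  At a point, both implications are linear algebra over the jet (psi, nabla J, nabla psi). The
  unknown nabla psi is removed by evaluating four-forms on (u, Ju, x, y): such quadruples determine
  a four-form in dimension six, and there the derivative of psi(v,Jv,w) = 0 replaces derivatives by
  products. These products are evaluated by the constant type identity, which holds for every psi of
  this type and brings in kappa; the quarter arises because each of the two real components of psi
  occurs for four of the eight ways to insert J, so that the squared length is four times kappa. The
  main obstacle on the analytic side is that tensors at p are read in a preferred chart which may
  jump with p. Closedness of psi and constancy of kappa differentiate an exterior derivative once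
  more, so exterior derivatives are first identified with coordinate expressions in one fixed
  chart.\<close>

lemma Ck_on_cong:
  assumes "open S" "\<And>x. x \<in> S \<Longrightarrow> f x = g x" "Ck_on k S f"
  shows "Ck_on k S g"
  using assms(2,3)
proof (induction k arbitrary: f g)
  case 0
  then show ?case using continuous_on_cong[of S S f g] by simp
next
  case (Suc k)
  have D: "(g has_derivative frechet_derivative f (at x)) (at x)" if "x \<in> S" for x
  proof -
    have "(f has_derivative frechet_derivative f (at x)) (at x)"
      using Suc.prems(2) that by (auto simp: frechet_derivative_works)
    then show ?thesis
      by (rule has_derivative_transform_within_open[OF _ assms(1) that]) (simp add: Suc.prems(1))
  qed
  have E: "frechet_derivative f (at x) = frechet_derivative g (at x)" if "x \<in> S" for x
    using frechet_derivative_at[OF D[OF that]] .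
  have "Ck_on k S (\<lambda>x. frechet_derivative g (at x) u)" for u
    by (rule Suc.IH[of "\<lambda>x. frechet_derivative f (at x) u"]) (use E Suc.prems(2) in auto)
  then show ?case using D by (auto simp: differentiable_def)
qed

lemma Ck_on_SucD: "Ck_on (Suc k) S f \<Longrightarrow> Ck_on k S f"
proof (induction k arbitrary: f)
  case 0
  then show ?case
    by (simp add: continuous_at_imp_continuous_on differentiable_imp_continuous_within)
next
  case (Suc k)
  show ?case
    using Suc.IH Suc.prems Ck_on.simps(2)[of "Suc k" S f] Ck_on.simps(2)[of k S f] by blast
qed

lemma Ck_on_const: "Ck_on k S (\<lambda>x. a)"
  by (induction k arbitrary: a) auto

lemma Ck_on_add:
  assumes "open S" "Ck_on k S f" "Ck_on k S g"
  shows "Ck_on k S (\<lambda>x. f x + g x)"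
  using assms(2,3)
proof (induction k arbitrary: f g)
  case 0
  then show ?case by (auto intro: continuous_on_add)
next
  case (Suc k)
  have E: "frechet_derivative (\<lambda>x. f x + g x) (at x) =
      (\<lambda>u. frechet_derivative f (at x) u + frechet_derivative g (at x) u)" if "x \<in> S" for x
    by (rule frechet_derivative_at[symmetric])
      (use Suc.prems that in \<open>auto intro!: has_derivative_add simp: frechet_derivative_works\<close>)
  have "Ck_on k S (\<lambda>x. frechet_derivative (\<lambda>x. f x + g x) (at x) u)" for u
    by (rule Ck_on_cong[OF assms(1) _ Suc.IH[of "\<lambda>x. frechet_derivative f (at x) u"
            "\<lambda>x. frechet_derivative g (at x) u"]]) (use Suc.prems E in auto)
  then show ?case using Suc.prems by auto
qed

lemma Ck_on_scaleR:
  fixes f :: "'v::real_normed_vector \<Rightarrow> real" and g :: "'v \<Rightarrow> 'w::real_normed_vector"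
  assumes "open S" "Ck_on k S f" "Ck_on k S g"
  shows "Ck_on k S (\<lambda>x. f x *\<^sub>R g x)"
  using assms(2,3)
proof (induction k arbitrary: f g)
  case 0
  then show ?case by (auto intro: continuous_on_scaleR)
next
  case (Suc k)
  have E: "((\<lambda>x. f x *\<^sub>R g x) has_derivative
      (\<lambda>u. f x *\<^sub>R frechet_derivative g (at x) u + frechet_derivative f (at x) u *\<^sub>R g x)) (at x)"
    if "x \<in> S" for x
    by (rule has_derivative_scaleR) (use Suc.prems that in \<open>auto simp: frechet_derivative_works\<close>)
  have "Ck_on k S (\<lambda>x. frechet_derivative (\<lambda>x. f x *\<^sub>R g x) (at x) u)" for u
    by (rule Ck_on_cong[OF assms(1) _ Ck_on_add[OF assms(1)
          Suc.IH[of "f" "\<lambda>x. frechet_derivative g (at x) u"]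
          Suc.IH[of "\<lambda>x. frechet_derivative f (at x) u" g]]])
      (use Suc.prems Ck_on_SucD[of k S f] Ck_on_SucD[of k S g] frechet_derivative_at[OF E]
        in \<open>auto simp: fun_eq_iff\<close>)
  then show ?case using E by (auto simp: differentiable_def)
qed

lemma smooth_on_cong:
  "\<lbrakk>open S; smooth_on S f; \<And>x. x \<in> S \<Longrightarrow> f x = g x\<rbrakk> \<Longrightarrow> smooth_on S g"
  unfolding smooth_on_def using Ck_on_cong by metis

lemma smooth_on_const: "smooth_on S (\<lambda>x. a)"
  by (simp add: smooth_on_def Ck_on_const)

lemma smooth_on_add:
  "\<lbrakk>open S; smooth_on S f; smooth_on S g\<rbrakk> \<Longrightarrow> smooth_on S (\<lambda>x. f x + g x)"
  by (simp add: smooth_on_def Ck_on_add)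

lemma smooth_on_scaleR:
  "\<lbrakk>open S; smooth_on S f; smooth_on S g\<rbrakk> \<Longrightarrow> smooth_on S (\<lambda>x. f x *\<^sub>R g x)"
  by (simp add: smooth_on_def Ck_on_scaleR)

lemma smooth_on_mult:
  fixes f g :: "'v::real_normed_vector \<Rightarrow> real"
  shows "\<lbrakk>open S; smooth_on S f; smooth_on S g\<rbrakk> \<Longrightarrow> smooth_on S (\<lambda>x. f x * g x)"
  using smooth_on_scaleR[of S f g] by simp

lemma smooth_on_minus: "\<lbrakk>open S; smooth_on S f\<rbrakk> \<Longrightarrow> smooth_on S (\<lambda>x. - f x)"
  using smooth_on_scaleR[of S "\<lambda>x. - 1" f] by (simp add: smooth_on_const)

lemma smooth_on_diff:
  "\<lbrakk>open S; smooth_on S f; smooth_on S g\<rbrakk> \<Longrightarrow> smooth_on S (\<lambda>x. f x - g x)"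
  using smooth_on_add[of S f "\<lambda>x. - g x"] smooth_on_minus[of S g] by simp

lemma smooth_on_sum:
  assumes "open S" "finite I" "\<And>i. i \<in> I \<Longrightarrow> smooth_on S (f i)"
  shows "smooth_on S (\<lambda>x. \<Sum>i\<in>I. f i x)"
  using assms(2,3) by (induction rule: finite_induct)
    (auto intro: smooth_on_const smooth_on_add[OF assms(1)])

lemma smooth_on_derivative:
  "smooth_on S f \<Longrightarrow> smooth_on S (\<lambda>x. frechet_derivative f (at x) u)"
  unfolding smooth_on_def by (metis Ck_on.simps(2))

lemma smooth_on_differentiable: "smooth_on S f \<Longrightarrow> x \<in> S \<Longrightarrow> f differentiable (at x)"
  unfolding smooth_on_def by (metis Ck_on.simps(2))

lemma smooth_on_has_derivative:
  "smooth_on S f \<Longrightarrow> x \<in> S \<Longrightarrow> (f has_derivative frechet_derivative f (at x)) (at x)"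
  using smooth_on_differentiable frechet_derivative_works by blast

lemma smooth_on_continuous: "smooth_on S f \<Longrightarrow> continuous_on S f"
  unfolding smooth_on_def by (metis Ck_on.simps(1))

lemma smooth_on_bounded_linear:
  assumes "open S" "bounded_linear L" "smooth_on S f"
  shows "smooth_on S (\<lambda>x. L (f x))"
proof -
  have "Ck_on k S f \<Longrightarrow> Ck_on k S (\<lambda>x. L (f x))" for k
  proof (induction k arbitrary: f)
    case 0
    then show ?case using assms(2) by (simp add: bounded_linear.continuous_on)
  next
    case (Suc k)
    have E: "((\<lambda>x. L (f x)) has_derivative (\<lambda>u. L (frechet_derivative f (at x) u))) (at x)"
      if "x \<in> S" for x
      by (rule bounded_linear.has_derivative[OF assms(2)])
        (use Suc.prems that in \<open>auto simp: frechet_derivative_works\<close>)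
    have "Ck_on k S (\<lambda>x. frechet_derivative (\<lambda>x. L (f x)) (at x) u)" for u
      by (rule Ck_on_cong[OF assms(1) _ Suc.IH[of "\<lambda>x. frechet_derivative f (at x) u"]])
        (use Suc.prems frechet_derivative_at[OF E] in \<open>auto simp: fun_eq_iff\<close>)
    then show ?case using E by (auto simp: differentiable_def)
  qed
  then show ?thesis using assms(3) by (simp add: smooth_on_def)
qed

lemma linear_basis_expansion:
  fixes F :: "'b::euclidean_space \<Rightarrow> 'w::real_vector"
  assumes "linear F" shows "F v = (\<Sum>i\<in>Basis. (v \<bullet> i) *\<^sub>R F i)"
  by (subst euclidean_representation[symmetric, of v])
    (simp add: linear_sum[OF assms] linear_cmul[OF assms])

text \<open>Tensor fields are known to be smooth only on constant vectors. Expanding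
  \<open>v x\<close> in a basis turns the application to a variable vector into a finite sum of
  products.\<close>

lemma smooth_on_apply_linear:
  fixes F :: "'v::real_normed_vector \<Rightarrow> 'b::euclidean_space \<Rightarrow> 'w::real_normed_vector"
  assumes "open S" "\<And>x. x \<in> S \<Longrightarrow> linear (F x)" "\<And>b. smooth_on S (\<lambda>x. F x b)" "smooth_on S v"
  shows "smooth_on S (\<lambda>x. F x (v x))"
proof (rule smooth_on_cong[OF assms(1)])
  show "smooth_on S (\<lambda>x. \<Sum>i\<in>Basis. (v x \<bullet> i) *\<^sub>R F x i)"
    by (intro smooth_on_sum smooth_on_scaleR assms finite_Basis
        smooth_on_bounded_linear[OF _ bounded_linear_inner_left])
qed (simp add: linear_basis_expansion[OF assms(2), symmetric])

lemma derivative_linear_family: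
  fixes F :: "'v::real_normed_vector \<Rightarrow> 'b::euclidean_space \<Rightarrow> 'w::real_normed_vector"
  assumes "open S" "x \<in> S" "\<And>y. y \<in> S \<Longrightarrow> linear (F y)"
    and "\<And>b. (\<lambda>y. F y b) differentiable (at x)"
  shows "linear (\<lambda>b. frechet_derivative (\<lambda>y. F y b) (at x) h)"
proof -
  have D: "((\<lambda>y. F y b) has_derivative frechet_derivative (\<lambda>y. F y b) (at x)) (at x)" for b
    using assms(4) by (simp add: frechet_derivative_works)
  have "((\<lambda>y. F y (b + b')) has_derivative (\<lambda>h. frechet_derivative (\<lambda>y. F y b) (at x) h +
      frechet_derivative (\<lambda>y. F y b') (at x) h)) (at x)" for b b'
    by (rule has_derivative_transform_within_open[OF has_derivative_add[OF D D] assms(1,2)])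
      (simp add: assms(3) linear_add)
  from frechet_derivative_at[OF this]
  have 1: "frechet_derivative (\<lambda>y. F y (b + b')) (at x) h =
      frechet_derivative (\<lambda>y. F y b) (at x) h + frechet_derivative (\<lambda>y. F y b') (at x) h" for b b'
    by (metis (no_types, lifting))
  have "((\<lambda>y. F y (r *\<^sub>R b)) has_derivative (\<lambda>h. r *\<^sub>R frechet_derivative (\<lambda>y. F y b) (at x) h)) (at x)"
    for r b
    by (rule has_derivative_transform_within_open[OF has_derivative_scaleR_right[OF D] assms(1,2)])
      (simp add: assms(3) linear_cmul)
  from frechet_derivative_at[OF this]
  have 2: "frechet_derivative (\<lambda>y. F y (r *\<^sub>R b)) (at x) h =
      r *\<^sub>R frechet_derivative (\<lambda>y. F y b) (at x) h" for r b
    by (metis (no_types, lifting))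
  show ?thesis by (rule linearI) (simp_all add: 1 2)
qed

lemma has_derivative_apply_linear:
  fixes F :: "'v::real_normed_vector \<Rightarrow> 'b::euclidean_space \<Rightarrow> 'w::real_normed_vector"
  assumes S: "open S" "x \<in> S" and lin: "\<And>y. y \<in> S \<Longrightarrow> linear (F y)"
    and D: "\<And>b. ((\<lambda>y. F y b) has_derivative F' b) (at x)"
    and v: "(v has_derivative v') (at x)"
  shows "((\<lambda>y. F y (v y)) has_derivative (\<lambda>h. F' (v x) h + F x (v' h))) (at x)"
proof -
  have F': "F' b = frechet_derivative (\<lambda>y. F y b) (at x)" for b
    by (rule frechet_derivative_at[OF D])
  have linF': "linear (\<lambda>b. F' b h)" for h
    unfolding F' by (rule derivative_linear_family[OF S lin]) (use D in \<open>auto simp: differentiable_def\<close>)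
  have "((\<lambda>y. \<Sum>i\<in>Basis. (v y \<bullet> i) *\<^sub>R F y i) has_derivative
      (\<lambda>h. \<Sum>i\<in>Basis. (v x \<bullet> i) *\<^sub>R F' i h + (v' h \<bullet> i) *\<^sub>R F x i)) (at x)"
    by (intro has_derivative_sum has_derivative_scaleR has_derivative_inner_left v D)
  moreover have "(\<Sum>i\<in>Basis. (v x \<bullet> i) *\<^sub>R F' i h + (v' h \<bullet> i) *\<^sub>R F x i) = F' (v x) h + F x (v' h)" for h
    unfolding sum.distrib linear_basis_expansion[OF linF', of "v x"]
    by (simp only: linear_basis_expansion[OF lin[OF S(2)], of "v' h"])
  ultimately have "((\<lambda>y. \<Sum>i\<in>Basis. (v y \<bullet> i) *\<^sub>R F y i) has_derivative
      (\<lambda>h. F' (v x) h + F x (v' h))) (at x)" by simp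
  then show ?thesis
    by (rule has_derivative_transform_within_open[OF _ S])
      (simp add: linear_basis_expansion[OF lin, symmetric])
qed

section \<open>Symmetry of second derivatives\<close>

lemma second_difference_mean_value:
  fixes f :: "'v::real_normed_vector \<Rightarrow> real"
  assumes f: "\<And>y. y \<in> ball x r \<Longrightarrow> f differentiable (at y)"
    and fa: "\<And>y. y \<in> ball x r \<Longrightarrow> (\<lambda>y. frechet_derivative f (at y) a) differentiable (at y)"
    and t: "t > 0" "t * (norm a + norm b) < r"
  obtains y where "y \<in> ball x r"
    "f (x + t *\<^sub>R a + t *\<^sub>R b) - f (x + t *\<^sub>R a) - f (x + t *\<^sub>R b) + f x =
      t * t * frechet_derivative (\<lambda>y. frechet_derivative f (at y) a) (at y) b"
proof -
  have inb: "x + s *\<^sub>R a + q *\<^sub>R b \<in> ball x r" if "s \<in> {0..t}" "q \<in> {0..t}" for s q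
  proof -
    have "norm (s *\<^sub>R a + q *\<^sub>R b) \<le> s * norm a + q * norm b"
      using that norm_triangle_ineq[of "s *\<^sub>R a" "q *\<^sub>R b"] by simp
    also have "\<dots> \<le> t * (norm a + norm b)"
      using that by (simp add: distrib_left add_mono mult_right_mono)
    finally have "norm (s *\<^sub>R a + q *\<^sub>R b) < r" using t by simp
    then show ?thesis by (metis add.assoc add_diff_cancel_left' dist_commute dist_norm mem_ball)
  qed
  let ?D = "\<lambda>y. frechet_derivative f (at y) a"
  let ?D2 = "\<lambda>y. frechet_derivative ?D (at y) b"
  have d1: "((\<lambda>s. f (x + s *\<^sub>R a + q *\<^sub>R b)) has_derivative (\<lambda>h. h * ?D (x + s *\<^sub>R a + q *\<^sub>R b))) (at s)"
    if "s \<in> {0..t}" "q \<in> {0..t}" for s q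
  proof -
    let ?y = "x + s *\<^sub>R a + q *\<^sub>R b"
    have F: "(f has_derivative frechet_derivative f (at ?y)) (at ?y)"
      using f[OF inb[OF that]] by (simp add: frechet_derivative_works)
    have "((\<lambda>s. f (x + s *\<^sub>R a + q *\<^sub>R b)) has_derivative (\<lambda>h. frechet_derivative f (at ?y) (h *\<^sub>R a))) (at s)"
      by (rule has_derivative_compose[of "\<lambda>s. x + s *\<^sub>R a + q *\<^sub>R b" "\<lambda>h. h *\<^sub>R a" s UNIV f, OF _ F])
        (auto intro!: derivative_eq_intros)
    then show ?thesis by (simp add: linear_cmul[OF has_derivative_linear[OF F]])
  qed
  \<comment> \<open>The mean value theorem is used twice: along \<open>a\<close> for this
    difference, then along \<open>b\<close> for the derivative in direction \<open>a\<close> at the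
    point found.\<close>
  define \<phi> where "\<phi> s = f (x + s *\<^sub>R a + t *\<^sub>R b) - f (x + s *\<^sub>R a)" for s
  have "(\<phi> has_derivative (\<lambda>h. h * (?D (x + s *\<^sub>R a + t *\<^sub>R b) - ?D (x + s *\<^sub>R a)))) (at s within {0..t})"
    if "s \<in> {0..t}" for s
    using has_derivative_diff[OF d1[of s t] d1[of s 0]] that t
    unfolding \<phi>_def by (auto simp: algebra_simps intro: has_derivative_at_withinI)
  from mvt_very_simple[of 0 t \<phi>, OF _ this] t obtain s where s: "s \<in> {0..t}"
    "\<phi> t - \<phi> 0 = t * (?D (x + s *\<^sub>R a + t *\<^sub>R b) - ?D (x + s *\<^sub>R a))" by auto
  have "((\<lambda>q. ?D (x + s *\<^sub>R a + q *\<^sub>R b)) has_derivative (\<lambda>h. h * ?D2 (x + s *\<^sub>R a + q *\<^sub>R b)))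
      (at q within {0..t})" if "q \<in> {0..t}" for q
  proof -
    let ?y = "x + s *\<^sub>R a + q *\<^sub>R b"
    have F: "(?D has_derivative frechet_derivative ?D (at ?y)) (at ?y)"
      using fa[OF inb[OF s(1) that]] by (simp add: frechet_derivative_works)
    have "((\<lambda>q. ?D (x + s *\<^sub>R a + q *\<^sub>R b)) has_derivative (\<lambda>h. frechet_derivative ?D (at ?y) (h *\<^sub>R b))) (at q)"
      by (rule has_derivative_compose[of "\<lambda>q. x + s *\<^sub>R a + q *\<^sub>R b" "\<lambda>h. h *\<^sub>R b" q UNIV ?D, OF _ F])
        (auto intro!: derivative_eq_intros)
    then show ?thesis
      by (simp add: linear_cmul[OF has_derivative_linear[OF F]] has_derivative_at_withinI)
  qed
  from mvt_very_simple[of 0 t "\<lambda>q. ?D (x + s *\<^sub>R a + q *\<^sub>R b)", OF _ this] t obtain q where q: "q \<in> {0..t}"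
    "?D (x + s *\<^sub>R a + t *\<^sub>R b) - ?D (x + s *\<^sub>R a) = t * ?D2 (x + s *\<^sub>R a + q *\<^sub>R b)" by auto
  show thesis
    by (rule that[OF inb[OF s(1) q(1)]]) (use s(2) q(2) in \<open>simp add: \<phi>_def algebra_simps\<close>)
qed

text \<open>One second difference over a small parallelogram is, up to the same factor, each of the
  mixed derivatives at some nearby point. Continuity then excludes a gap at
  \<open>x\<close>.\<close>

lemma symmetric_second_derivative_real:
  fixes f :: "'v::real_normed_vector \<Rightarrow> real"
  assumes S: "open S" "x \<in> S" and f: "smooth_on S f"
  shows "frechet_derivative (\<lambda>y. frechet_derivative f (at y) a) (at x) b =
    frechet_derivative (\<lambda>y. frechet_derivative f (at y) b) (at x) a"
proof (rule ccontr)
  define A where "A y = frechet_derivative (\<lambda>y. frechet_derivative f (at y) a) (at y) b" for y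
  define B where "B y = frechet_derivative (\<lambda>y. frechet_derivative f (at y) b) (at y) a" for y
  assume "\<not> ?thesis"
  then have "\<bar>A x - B x\<bar> / 2 > 0" (is "?e > 0") by (simp add: A_def B_def)
  have "continuous_on S A" "continuous_on S B"
    unfolding A_def B_def by (intro smooth_on_continuous smooth_on_derivative f)+
  then have "isCont A x" "isCont B x" using S by (auto simp: continuous_on_eq_continuous_at)
  then obtain r1 r2 where r12: "r1 > 0" "\<And>y. dist y x < r1 \<Longrightarrow> dist (A y) (A x) < ?e"
      "r2 > 0" "\<And>y. dist y x < r2 \<Longrightarrow> dist (B y) (B x) < ?e"
    using \<open>?e > 0\<close> unfolding continuous_at_eps_delta by metis
  obtain r3 where r3: "r3 > 0" "ball x r3 \<subseteq> S" using S openE by blast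
  define r where "r = min r1 (min r2 r3)"
  have r: "r > 0" "ball x r \<subseteq> S" using r12 r3 by (auto simp: r_def)
  \<comment> \<open>The \<open>+ 1\<close> keeps the denominator positive even for
    \<open>a = b = 0\<close>; the parallelogram stays inside the ball of radius
    \<open>r\<close>.\<close>
  define t where "t = r / (2 * (norm a + norm b + 1))"
  have n: "norm a + norm b + 1 > 0" by (smt (verit) norm_ge_zero)
  have t0: "t > 0" using r n by (simp add: t_def)
  have "t * (norm a + norm b) < t * (norm a + norm b + 1)" using t0 by simp
  also have "\<dots> = r / 2" using n unfolding t_def by (metis (no_types) less_irrefl mult.commute nonzero_mult_divide_mult_cancel_right times_divide_eq_right)
  also have "\<dots> < r" using r by simp
  finally have t: "t * (norm a + norm b) < r" .
  have d: "\<And>y. y \<in> ball x r \<Longrightarrow> f differentiable (at y)"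
    "\<And>y u. y \<in> ball x r \<Longrightarrow> (\<lambda>y. frechet_derivative f (at y) u) differentiable (at y)"
    using r(2) f smooth_on_differentiable smooth_on_derivative by blast+
  obtain y where y: "y \<in> ball x r"
    "f (x + t *\<^sub>R a + t *\<^sub>R b) - f (x + t *\<^sub>R a) - f (x + t *\<^sub>R b) + f x = t * t * A y"
    using second_difference_mean_value[OF d(1) d(2) t0 t] unfolding A_def by metis
  obtain z where z: "z \<in> ball x r"
    "f (x + t *\<^sub>R b + t *\<^sub>R a) - f (x + t *\<^sub>R b) - f (x + t *\<^sub>R a) + f x = t * t * B z"
    using second_difference_mean_value[OF d(1) d(2) t0, where a = b and b = a] t unfolding B_def
    by (metis add.commute)
  have "t * t * A y = t * t * B z" using y(2) z(2) by (simp add: algebra_simps)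
  then have "A y = B z" using t0 by simp
  moreover have "\<bar>A y - A x\<bar> < ?e" "\<bar>B z - B x\<bar> < ?e"
    using y(1) z(1) r12 by (auto simp: r_def dist_commute dist_real_def)
  ultimately show False by (smt (verit) field_sum_of_halves)
qed

lemma symmetric_second_derivative:
  fixes f :: "'v::real_normed_vector \<Rightarrow> 'w::euclidean_space"
  assumes S: "open S" "x \<in> S" and f: "smooth_on S f"
  shows "frechet_derivative (\<lambda>y. frechet_derivative f (at y) a) (at x) b =
    frechet_derivative (\<lambda>y. frechet_derivative f (at y) b) (at x) a"
proof (rule euclidean_eqI)
  fix i :: 'w assume "i \<in> Basis"
  have inner: "frechet_derivative (\<lambda>y. h y \<bullet> i) (at y) u = frechet_derivative h (at y) u \<bullet> i"
    if "smooth_on S h" "y \<in> S" for h :: "'v \<Rightarrow> 'w" and y u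
    using frechet_derivative_at[OF has_derivative_inner_left[OF smooth_on_has_derivative[OF that]]]
    by (metis (no_types, lifting))
  have fi: "smooth_on S (\<lambda>y. f y \<bullet> i)"
    by (rule smooth_on_bounded_linear[OF S(1) bounded_linear_inner_left f])
  have "frechet_derivative (\<lambda>y. frechet_derivative f (at y) u) (at x) w \<bullet> i =
    frechet_derivative (\<lambda>y. frechet_derivative (\<lambda>y. f y \<bullet> i) (at y) u) (at x) w" for u w
  proof -
    have "((\<lambda>y. frechet_derivative f (at y) u \<bullet> i) has_derivative
       (\<lambda>w. frechet_derivative (\<lambda>y. frechet_derivative f (at y) u) (at x) w \<bullet> i)) (at x)"
      by (rule has_derivative_inner_left[OF smooth_on_has_derivative[OF smooth_on_derivative[OF f] S(2)]])
    then have "((\<lambda>y. frechet_derivative (\<lambda>y. f y \<bullet> i) (at y) u) has_derivative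
       (\<lambda>w. frechet_derivative (\<lambda>y. frechet_derivative f (at y) u) (at x) w \<bullet> i)) (at x)"
      by (rule has_derivative_transform_within_open[OF _ S]) (simp add: inner[OF f])
    from frechet_derivative_at[OF this] show ?thesis by metis
  qed
  then show "frechet_derivative (\<lambda>y. frechet_derivative f (at y) a) (at x) b \<bullet> i =
    frechet_derivative (\<lambda>y. frechet_derivative f (at y) b) (at x) a \<bullet> i"
    using symmetric_second_derivative_real[OF S fi] by metis
qed

section \<open>Exterior derivatives in coordinates\<close>

definition dform2 :: "('v::real_normed_vector \<Rightarrow> 'v \<Rightarrow> 'v \<Rightarrow> real) \<Rightarrow> 'v \<Rightarrow> 'v \<Rightarrow> 'v \<Rightarrow> 'v \<Rightarrow> real" where
  "dform2 a x u v w =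
     frechet_derivative (\<lambda>y. a y v w) (at x) u - frechet_derivative (\<lambda>y. a y u w) (at x) v
     + frechet_derivative (\<lambda>y. a y u v) (at x) w"

definition dform3 ::
    "('v::real_normed_vector \<Rightarrow> 'v \<Rightarrow> 'v \<Rightarrow> 'v \<Rightarrow> real) \<Rightarrow> 'v \<Rightarrow> 'v \<Rightarrow> 'v \<Rightarrow> 'v \<Rightarrow> 'v \<Rightarrow> real" where
  "dform3 b x u v w z =
     frechet_derivative (\<lambda>y. b y v w z) (at x) u - frechet_derivative (\<lambda>y. b y u w z) (at x) v
     + frechet_derivative (\<lambda>y. b y u v z) (at x) w - frechet_derivative (\<lambda>y. b y u v w) (at x) z"

lemma smooth_on_dform2:
  assumes "open S" "\<And>u v. smooth_on S (\<lambda>x. a x u v)"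
  shows "smooth_on S (\<lambda>x. dform2 a x u v w)"
  unfolding dform2_def by (intro smooth_on_add smooth_on_diff smooth_on_derivative assms)

lemma smooth_on_dform3:
  assumes "open S" "\<And>u v w. smooth_on S (\<lambda>x. b x u v w)"
  shows "smooth_on S (\<lambda>x. dform3 b x u v w z)"
  unfolding dform3_def by (intro smooth_on_add smooth_on_diff smooth_on_derivative assms)

lemma frechet_derivative_cong_open:
  assumes "open S" "x \<in> S" "\<And>y. y \<in> S \<Longrightarrow> f y = g y"
  shows "frechet_derivative f (at x) = frechet_derivative g (at x)"
proof -
  have "(f has_derivative D) (at x) \<longleftrightarrow> (g has_derivative D) (at x)" for D
    using has_derivative_transform_within_open[OF _ assms(1,2), of f D UNIV g]
      has_derivative_transform_within_open[OF _ assms(1,2), of g D UNIV f] assms(3) by auto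
  then show ?thesis by (simp add: frechet_derivative_def)
qed

lemma dform2_cong_open:
  assumes "open S" "x \<in> S" "\<And>y u v. y \<in> S \<Longrightarrow> a y u v = b y u v"
  shows "dform2 a x = dform2 b x"
proof -
  have "frechet_derivative (\<lambda>y. a y u v) (at x) = frechet_derivative (\<lambda>y. b y u v) (at x)" for u v
    by (rule frechet_derivative_cong_open[OF assms(1,2)]) (rule assms(3))
  then show ?thesis by (simp add: dform2_def fun_eq_iff)
qed

lemma dform3_cong_open:
  assumes "open S" "x \<in> S" "\<And>y u v w. y \<in> S \<Longrightarrow> a y u v w = b y u v w"
  shows "dform3 a x = dform3 b x"
proof -
  have "frechet_derivative (\<lambda>y. a y u v w) (at x) = frechet_derivative (\<lambda>y. b y u v w) (at x)" for u v w
    by (rule frechet_derivative_cong_open[OF assms(1,2)]) (rule assms(3))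
  then show ?thesis by (simp add: dform3_def fun_eq_iff)
qed

lemma dform3_dform2:
  assumes S: "open S" "x \<in> S" and a: "\<And>u v. smooth_on S (\<lambda>x. a x u v)"
  shows "dform3 (dform2 a) x u v w z = 0"
proof -
  let ?D = "\<lambda>b c u v. frechet_derivative (\<lambda>y. frechet_derivative (\<lambda>y. a y b c) (at y) u) (at x) v"
  have D: "((\<lambda>y. dform2 a y u v w) has_derivative (\<lambda>h. ?D v w u h - ?D u w v h + ?D u v w h)) (at x)" for u v w
    unfolding dform2_def
    by (intro has_derivative_add has_derivative_diff smooth_on_has_derivative[OF smooth_on_derivative[OF a] S(2)])
  have E: "frechet_derivative (\<lambda>y. dform2 a y u v w) (at x) h = ?D v w u h - ?D u w v h + ?D u v w h" for u v w h
    using fun_cong[OF frechet_derivative_at[OF D]] by metis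
  have sym: "?D b c u v = ?D b c v u" for b c u v
    by (rule symmetric_second_derivative_real[OF S a])
  show ?thesis
    unfolding dform3_def E by (simp add: sym[of _ _ v u] sym[of _ _ w u] sym[of _ _ z u] sym[of _ _ w v] sym[of _ _ z v] sym[of _ _ z w])
qed

text \<open>This is d d = 0 one degree up, with the exterior derivative of a four-form spelled out
  as its five signed terms. It serves to differentiate the second structure equation.\<close>

lemma dform4_dform3:
  assumes S: "open S" "x \<in> S" and b: "\<And>u v w. smooth_on S (\<lambda>x. b x u v w)"
  defines "D \<equiv> \<lambda>u v w z y. frechet_derivative (\<lambda>q. dform3 b q v w z y) (at x) u"
  shows "D u v w z y - D v u w z y + D w u v z y - D z u v w y + D y u v w z = 0"
proof -
  let ?D = "\<lambda>b' c d u v. frechet_derivative (\<lambda>y. frechet_derivative (\<lambda>y. b y b' c d) (at y) u) (at x) v"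
  have D: "((\<lambda>y. dform3 b y u v w z) has_derivative
      (\<lambda>h. ?D v w z u h - ?D u w z v h + ?D u v z w h - ?D u v w z h)) (at x)" for u v w z
    unfolding dform3_def
    by (intro has_derivative_add has_derivative_diff smooth_on_has_derivative[OF smooth_on_derivative[OF b] S(2)])
  have E: "D h u v w z = ?D v w z u h - ?D u w z v h + ?D u v z w h - ?D u v w z h" for u v w z h
    unfolding D_def using fun_cong[OF frechet_derivative_at[OF D]] by metis
  have sym: "?D b c d u v = ?D b c d v u" for b c d u v
    by (rule symmetric_second_derivative_real[OF S b])
  show ?thesis
    unfolding E by (simp add: sym[of _ _ _ v u] sym[of _ _ _ w u] sym[of _ _ _ z u] sym[of _ _ _ y u]
      sym[of _ _ _ w v] sym[of _ _ _ z v] sym[of _ _ _ y v] sym[of _ _ _ z w] sym[of _ _ _ y w] sym[of _ _ _ y z])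
qed

lemma has_derivative_apply_bilinear:
  fixes F :: "'v::real_normed_vector \<Rightarrow> 'b::euclidean_space \<Rightarrow> 'c::euclidean_space \<Rightarrow> 'w::real_normed_vector"
  assumes S: "open S" "x \<in> S" and lin: "\<And>y b. y \<in> S \<Longrightarrow> linear (F y b)" "\<And>y c. y \<in> S \<Longrightarrow> linear (\<lambda>b. F y b c)"
    and D: "\<And>b c. ((\<lambda>y. F y b c) has_derivative F' b c) (at x)"
    and v: "(v has_derivative v') (at x)" and w: "(w has_derivative w') (at x)"
  shows "((\<lambda>y. F y (v y) (w y)) has_derivative
    (\<lambda>h. F' (v x) (w x) h + F x (v' h) (w x) + F x (v x) (w' h))) (at x)"
proof -
  have "((\<lambda>y. F y b (w y)) has_derivative (\<lambda>h. F' b (w x) h + F x b (w' h))) (at x)" for b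
    by (rule has_derivative_apply_linear[OF S lin(1) D w])
  from has_derivative_apply_linear[of S x "\<lambda>y b. F y b (w y)", OF S lin(2) this v]
  show ?thesis by (simp add: add_ac)
qed

lemma has_derivative_apply_trilinear:
  fixes F :: "'v::real_normed_vector \<Rightarrow> 'b::euclidean_space \<Rightarrow> 'c::euclidean_space \<Rightarrow>
    'd::euclidean_space \<Rightarrow> 'w::real_normed_vector"
  assumes S: "open S" "x \<in> S" and lin: "\<And>y b c. y \<in> S \<Longrightarrow> linear (F y b c)"
      "\<And>y b d. y \<in> S \<Longrightarrow> linear (\<lambda>c. F y b c d)" "\<And>y c d. y \<in> S \<Longrightarrow> linear (\<lambda>b. F y b c d)"
    and D: "\<And>b c d. ((\<lambda>y. F y b c d) has_derivative F' b c d) (at x)"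
    and v: "(v has_derivative v') (at x)" and w: "(w has_derivative w') (at x)"
    and z: "(z has_derivative z') (at x)"
  shows "((\<lambda>y. F y (v y) (w y) (z y)) has_derivative
    (\<lambda>h. F' (v x) (w x) (z x) h + F x (v' h) (w x) (z x) + F x (v x) (w' h) (z x)
      + F x (v x) (w x) (z' h))) (at x)"
proof -
  have "((\<lambda>y. F y b c (z y)) has_derivative (\<lambda>h. F' b c (z x) h + F x b c (z' h))) (at x)" for b c
    by (rule has_derivative_apply_linear[OF S lin(1) D z])
  from has_derivative_apply_bilinear[of S x "\<lambda>y b c. F y b c (z y)", OF S lin(2,3) this v w]
  show ?thesis by (simp add: add_ac)
qed

text \<open>Differentiating the Jacobians produces second derivatives of \<open>\<tau>\<close>;
  these are symmetric and cancel in the alternating sum.\<close>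

lemma dform2_pullback:
  fixes \<tau> :: "'v::euclidean_space \<Rightarrow> 'w::euclidean_space"
  assumes S: "open S" "x \<in> S" and T: "open T" "\<tau> ` S \<subseteq> T" and \<tau>: "smooth_on S \<tau>"
    and a: "\<And>u v. smooth_on T (\<lambda>y. a y u v)"
    and lin: "\<And>y v. y \<in> T \<Longrightarrow> linear (\<lambda>u. a y u v)" and skew: "\<And>y u v. y \<in> T \<Longrightarrow> a y u v = - a y v u"
    and b: "\<And>y u v. y \<in> S \<Longrightarrow>
      b y u v = a (\<tau> y) (frechet_derivative \<tau> (at y) u) (frechet_derivative \<tau> (at y) v)"
  shows "dform2 b x u v w = dform2 a (\<tau> x) (frechet_derivative \<tau> (at x) u)
    (frechet_derivative \<tau> (at x) v) (frechet_derivative \<tau> (at x) w)"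
proof -
  let ?t = "\<lambda>y. frechet_derivative \<tau> (at y)"
  let ?t2 = "\<lambda>u h. frechet_derivative (\<lambda>y. ?t y u) (at x) h"
  let ?A = "\<lambda>u v h. frechet_derivative (\<lambda>y. a y u v) (at (\<tau> x)) h"
  have xT: "\<tau> x \<in> T" using S T by auto
  have lin2: "linear (a y u)" if "y \<in> T" for y u
    using linear_compose_neg[OF lin[OF that, of u]] skew[OF that, of u]
    by (metis (no_types, lifting) ext)
  have d1: "((\<lambda>y. a (\<tau> y) u v) has_derivative (\<lambda>h. ?A u v (?t x h))) (at x)" for u v
    by (rule has_derivative_compose[OF smooth_on_has_derivative[OF \<tau> S(2)] smooth_on_has_derivative[OF a xT]])
  have d2: "((\<lambda>y. ?t y u) has_derivative ?t2 u) (at x)" for u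
    by (rule smooth_on_has_derivative[OF smooth_on_derivative[OF \<tau>] S(2)])
  have "((\<lambda>y. a (\<tau> y) (?t y u) (?t y v)) has_derivative (\<lambda>h. ?A (?t x u) (?t x v) (?t x h) +
      a (\<tau> x) (?t2 u h) (?t x v) + a (\<tau> x) (?t x u) (?t2 v h))) (at x)" for u v
    by (rule has_derivative_apply_bilinear[OF S _ _ d1 d2 d2]) (use lin lin2 T in auto)
  then have "((\<lambda>y. b y u v) has_derivative (\<lambda>h. ?A (?t x u) (?t x v) (?t x h) +
      a (\<tau> x) (?t2 u h) (?t x v) + a (\<tau> x) (?t x u) (?t2 v h))) (at x)" for u v
    by (rule has_derivative_transform_within_open[OF _ S]) (simp add: b)
  note d3 = this
  have E: "frechet_derivative (\<lambda>y. b y u v) (at x) h = ?A (?t x u) (?t x v) (?t x h) +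
      a (\<tau> x) (?t2 u h) (?t x v) + a (\<tau> x) (?t x u) (?t2 v h)" for u v h
    by (rule fun_cong[OF frechet_derivative_at[OF d3], symmetric])
  have sym: "?t2 u h = ?t2 h u" for u h by (rule symmetric_second_derivative[OF S \<tau>])
  show ?thesis
    unfolding dform2_def E
    by (simp add: sym[of v u] sym[of w u] sym[of w v] skew[OF xT, of "?t2 u w"])
qed

lemma dform3_pullback:
  fixes \<tau> :: "'v::euclidean_space \<Rightarrow> 'w::euclidean_space"
  assumes S: "open S" "x \<in> S" and T: "open T" "\<tau> ` S \<subseteq> T" and \<tau>: "smooth_on S \<tau>"
    and a: "\<And>u v w. smooth_on T (\<lambda>y. a y u v w)"
    and lin: "\<And>y v w. y \<in> T \<Longrightarrow> linear (\<lambda>u. a y u v w)"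
    and skew: "\<And>y u v w. y \<in> T \<Longrightarrow> a y u v w = - a y v u w" "\<And>y u v w. y \<in> T \<Longrightarrow> a y u v w = - a y u w v"
    and b: "\<And>y u v w. y \<in> S \<Longrightarrow> b y u v w = a (\<tau> y) (frechet_derivative \<tau> (at y) u)
      (frechet_derivative \<tau> (at y) v) (frechet_derivative \<tau> (at y) w)"
  shows "dform3 b x u v w z = dform3 a (\<tau> x) (frechet_derivative \<tau> (at x) u)
    (frechet_derivative \<tau> (at x) v) (frechet_derivative \<tau> (at x) w) (frechet_derivative \<tau> (at x) z)"
proof -
  let ?t = "\<lambda>y. frechet_derivative \<tau> (at y)"
  let ?t2 = "\<lambda>u h. frechet_derivative (\<lambda>y. ?t y u) (at x) h"
  let ?A = "\<lambda>u v w h. frechet_derivative (\<lambda>y. a y u v w) (at (\<tau> x)) h"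
  have xT: "\<tau> x \<in> T" using S T by auto
  have lin2: "linear (\<lambda>v. a y u v w)" if "y \<in> T" for y u w
    using linear_compose_neg[OF lin[OF that, of u w]] skew(1)[OF that, of u _ w]
    by (metis (no_types, lifting) ext)
  have lin3: "linear (a y u v)" if "y \<in> T" for y u v
    using linear_compose_neg[OF lin2[OF that, of u v]] skew(2)[OF that, of u v]
    by (metis (no_types, lifting) ext)
  have d1: "((\<lambda>y. a (\<tau> y) u v w) has_derivative (\<lambda>h. ?A u v w (?t x h))) (at x)" for u v w
    by (rule has_derivative_compose[OF smooth_on_has_derivative[OF \<tau> S(2)] smooth_on_has_derivative[OF a xT]])
  have d2: "((\<lambda>y. ?t y u) has_derivative ?t2 u) (at x)" for u
    by (rule smooth_on_has_derivative[OF smooth_on_derivative[OF \<tau>] S(2)])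
  have "((\<lambda>y. a (\<tau> y) (?t y u) (?t y v) (?t y w)) has_derivative (\<lambda>h. ?A (?t x u) (?t x v) (?t x w) (?t x h) +
      a (\<tau> x) (?t2 u h) (?t x v) (?t x w) + a (\<tau> x) (?t x u) (?t2 v h) (?t x w) +
      a (\<tau> x) (?t x u) (?t x v) (?t2 w h))) (at x)" for u v w
    by (rule has_derivative_apply_trilinear[OF S _ _ _ d1 d2 d2 d2]) (use lin lin2 lin3 T in auto)
  then have "((\<lambda>y. b y u v w) has_derivative (\<lambda>h. ?A (?t x u) (?t x v) (?t x w) (?t x h) +
      a (\<tau> x) (?t2 u h) (?t x v) (?t x w) + a (\<tau> x) (?t x u) (?t2 v h) (?t x w) +
      a (\<tau> x) (?t x u) (?t x v) (?t2 w h))) (at x)" for u v w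
    by (rule has_derivative_transform_within_open[OF _ S]) (simp add: b)
  note d3 = this
  have E: "frechet_derivative (\<lambda>y. b y u v w) (at x) h = ?A (?t x u) (?t x v) (?t x w) (?t x h) +
      a (\<tau> x) (?t2 u h) (?t x v) (?t x w) + a (\<tau> x) (?t x u) (?t2 v h) (?t x w) +
      a (\<tau> x) (?t x u) (?t x v) (?t2 w h)" for u v w h
    by (rule fun_cong[OF frechet_derivative_at[OF d3], symmetric])
  have sym: "?t2 u h = ?t2 h u" for u h by (rule symmetric_second_derivative[OF S \<tau>])
  have m: "a (\<tau> x) p q r = - a (\<tau> x) q p r" "a (\<tau> x) p q r = a (\<tau> x) q r p" for p q r
    using skew[OF xT] by (metis, metis minus_minus)
  \<comment> \<open>With every second derivative of \<open>\<tau>\<close> in the first slot, the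
    terms that cancel differ only by \<open>sym\<close> and a swap of the last two slots.\<close>
  have c: "a (\<tau> x) p (?t2 i j) q = - a (\<tau> x) (?t2 i j) p q" "a (\<tau> x) p q (?t2 i j) = a (\<tau> x) (?t2 i j) p q"
    for p q i j using m by metis+
  show ?thesis
    unfolding dform3_def E c
    by (simp add: sym[of v u] sym[of w u] sym[of z u] sym[of w v] sym[of z v] sym[of z w]
       skew(2)[OF xT, of _ "?t x v" "?t x u"] skew(2)[OF xT, of _ "?t x w" "?t x u"]
       skew(2)[OF xT, of _ "?t x z" "?t x u"] skew(2)[OF xT, of _ "?t x w" "?t x v"]
       skew(2)[OF xT, of _ "?t x z" "?t x v"] skew(2)[OF xT, of _ "?t x z" "?t x w"])
qed

section \<open>Charts\<close>

locale smooth_mfd =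
  fixes M :: "'a topology" and \<A> :: "('a, 'n::finite) chart set"
  assumes mfd: "smooth_manifold M \<A>"
begin

lemma chart: "c \<in> \<A> \<Longrightarrow> is_chart M c"
  using mfd by (simp add: smooth_manifold_def)

lemma chart_subset: "c \<in> \<A> \<Longrightarrow> fst c \<subseteq> topspace M"
  using mfd by (auto simp: smooth_manifold_def)

lemma chart_topspace: "c \<in> \<A> \<Longrightarrow> p \<in> fst c \<Longrightarrow> p \<in> topspace M"
  using chart_subset by blast

lemma chart_inj: "c \<in> \<A> \<Longrightarrow> inj_on (snd c) (fst c)"
  using chart[of c] chart_subset[of c] unfolding is_chart_def
  by (auto simp: homeomorphic_eq_everything_map Int_absorb1)

lemma chart_inv_eq [simp]: "c \<in> \<A> \<Longrightarrow> p \<in> fst c \<Longrightarrow> chart_inv c (snd c p) = p"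
  by (simp add: chart_inv_def chart_inj)

lemma open_chart_image: "c \<in> \<A> \<Longrightarrow> openin M U \<Longrightarrow> U \<subseteq> fst c \<Longrightarrow> open (snd c ` U)"
proof -
  assume c: "c \<in> \<A>" and U: "openin M U" "U \<subseteq> fst c"
  have h: "homeomorphic_map (subtopology M (fst c)) (top_of_set (snd c ` fst c)) (snd c)" "open (snd c ` fst c)"
    using chart[OF c] by (auto simp: is_chart_def)
  have "openin (subtopology M (fst c)) U"
    using U by (auto simp: openin_subtopology)
  then have "openin (top_of_set (snd c ` fst c)) (snd c ` U)"
    using homeomorphic_map_openness_eq[OF h(1)] by blast
  then show ?thesis using h(2) by (metis openin_open_trans)
qed

lemma open_preimage: "c \<in> \<A> \<Longrightarrow> open V \<Longrightarrow> openin M {q \<in> fst c. snd c q \<in> V}"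
proof -
  assume c: "c \<in> \<A>" and V: "open V"
  have h: "homeomorphic_map (subtopology M (fst c)) (top_of_set (snd c ` fst c)) (snd c)" "openin M (fst c)"
    using chart[OF c] by (auto simp: is_chart_def)
  have "continuous_map (subtopology M (fst c)) (top_of_set (snd c ` fst c)) (snd c)"
    using h(1) homeomorphic_imp_continuous_map by blast
  moreover have "openin (top_of_set (snd c ` fst c)) (snd c ` fst c \<inter> V)" using V by (rule openin_open_Int)
  ultimately have "openin (subtopology M (fst c))
     {q \<in> topspace (subtopology M (fst c)). snd c q \<in> snd c ` fst c \<inter> V}"
    by (rule openin_continuous_map_preimage)
  moreover have "{q \<in> topspace (subtopology M (fst c)). snd c q \<in> snd c ` fst c \<inter> V} = {q \<in> fst c. snd c q \<in> V}"
    using chart_subset[OF c] by auto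
  ultimately show ?thesis using h(2) openin_trans_full by metis
qed

lemma openin_chart: "c \<in> \<A> \<Longrightarrow> openin M (fst c)"
  using chart[of c] by (simp add: is_chart_def)

lemma open_dom: "c \<in> \<A> \<Longrightarrow> open (snd c ` fst c)"
  by (intro open_chart_image openin_chart) auto

lemma open_overlap: "c \<in> \<A> \<Longrightarrow> d \<in> \<A> \<Longrightarrow> open (snd c ` (fst c \<inter> fst d))"
  by (intro open_chart_image openin_Int openin_chart) auto

lemma chart_at_in: "p \<in> topspace M \<Longrightarrow> chart_at \<A> p \<in> \<A>"
  and in_chart_at: "p \<in> topspace M \<Longrightarrow> p \<in> fst (chart_at \<A> p)"
proof -
  assume "p \<in> topspace M"
  then have "p \<in> (\<Union>c\<in>\<A>. fst c)" using mfd by (simp add: smooth_manifold_def)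
  then have "\<exists>c. c \<in> \<A> \<and> p \<in> fst c" by blast
  then have "chart_at \<A> p \<in> \<A> \<and> p \<in> fst (chart_at \<A> p)" unfolding chart_at_def by (rule someI_ex)
  then show "chart_at \<A> p \<in> \<A>" "p \<in> fst (chart_at \<A> p)" by auto
qed

lemma transition_eq: "c \<in> \<A> \<Longrightarrow> p \<in> fst c \<Longrightarrow> transition c d (snd c p) = snd d p"
  by (simp add: transition_def)

lemma smooth_transition: "c \<in> \<A> \<Longrightarrow> d \<in> \<A> \<Longrightarrow> smooth_on (snd c ` (fst c \<inter> fst d)) (transition c d)"
  using mfd by (simp add: smooth_manifold_def)

text \<open>Both \<open>tangent_of\<close> and \<open>coords_of\<close> are cases of this Jacobian,
  so the single chain rule \<open>jac_jac\<close> yields that they are mutually inverse and how they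
  change with the chart.\<close>

definition jac :: "('a, 'n) chart \<Rightarrow> ('a, 'n) chart \<Rightarrow> 'a \<Rightarrow> real ^ 'n \<Rightarrow> real ^ 'n" where
  "jac c d p = frechet_derivative (transition c d) (at (snd c p))"

lemma jac_has_derivative:
  "\<lbrakk>c \<in> \<A>; d \<in> \<A>; p \<in> fst c; p \<in> fst d\<rbrakk> \<Longrightarrow> (transition c d has_derivative jac c d p) (at (snd c p))"
  unfolding jac_def by (rule smooth_on_has_derivative[OF smooth_transition]) auto

lemma linear_jac: "\<lbrakk>c \<in> \<A>; d \<in> \<A>; p \<in> fst c; p \<in> fst d\<rbrakk> \<Longrightarrow> linear (jac c d p)"
  using jac_has_derivative has_derivative_linear by blast

lemma jac_jac:
  assumes "c \<in> \<A>" "d \<in> \<A>" "e \<in> \<A>" "p \<in> fst c" "p \<in> fst d" "p \<in> fst e"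
  shows "jac d e p (jac c d p u) = jac c e p u"
proof -
  have "(transition d e has_derivative jac d e p) (at (transition c d (snd c p)))"
    using jac_has_derivative[of d e p] assms by (simp add: transition_eq)
  from has_derivative_compose[OF jac_has_derivative[of c d p] this] assms
  have "((\<lambda>x. transition d e (transition c d x)) has_derivative (\<lambda>u. jac d e p (jac c d p u))) (at (snd c p))"
    by simp
  then have "(transition c e has_derivative (\<lambda>u. jac d e p (jac c d p u))) (at (snd c p))"
    by (rule has_derivative_transform_within_open[OF _ open_overlap[of c d]])
      (use assms in \<open>auto simp: transition_eq\<close>)
  from frechet_derivative_at[OF this] show ?thesis unfolding jac_def[of c e] by metis
qed

lemma jac_same: assumes "c \<in> \<A>" "p \<in> fst c" shows "jac c c p u = u"
proof -
  have "(transition c c has_derivative (\<lambda>u. u)) (at (snd c p))"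
    by (rule has_derivative_transform_within_open[OF has_derivative_ident open_dom[of c]])
      (use assms in \<open>auto simp: transition_eq\<close>)
  from frechet_derivative_at[OF this] show ?thesis unfolding jac_def by metis
qed

lemma tangent_of_jac: "tangent_of \<A> c p = jac c (chart_at \<A> p) p"
  by (simp add: fun_eq_iff tangent_of_def jac_def)

lemma coords_of_jac: "coords_of \<A> c p = jac (chart_at \<A> p) c p"
  by (simp add: fun_eq_iff coords_of_def jac_def)

context
  fixes c p assumes c: "c \<in> \<A>" and p: "p \<in> fst c"
begin

lemma p_in: "p \<in> topspace M" using c p chart_subset by blast

lemma linear_tangent_of: "linear (tangent_of \<A> c p)"
  and linear_coords_of: "linear (coords_of \<A> c p)"
  using c p p_in by (simp_all add: tangent_of_jac coords_of_jac linear_jac chart_at_in in_chart_at)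

lemma coords_tangent: "coords_of \<A> c p (tangent_of \<A> c p u) = u"
  and tangent_coords: "tangent_of \<A> c p (coords_of \<A> c p u) = u"
  using c p p_in by (simp_all add: tangent_of_jac coords_of_jac jac_jac jac_same chart_at_in in_chart_at)

lemma tangent_of_change:
  "d \<in> \<A> \<Longrightarrow> p \<in> fst d \<Longrightarrow> tangent_of \<A> d p (jac c d p u) = tangent_of \<A> c p u"
  using c p p_in by (simp add: tangent_of_jac jac_jac chart_at_in in_chart_at)

end

lemma tangent_of_chart_at: "p \<in> topspace M \<Longrightarrow> tangent_of \<A> (chart_at \<A> p) p u = u"
  and coords_of_chart_at: "p \<in> topspace M \<Longrightarrow> coords_of \<A> (chart_at \<A> p) p u = u"
  by (simp_all add: tangent_of_jac coords_of_jac jac_same chart_at_in in_chart_at)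

section \<open>Exterior derivatives in an arbitrary chart\<close>

definition two_form :: "('a, 'n) cov2 \<Rightarrow> bool" where
  "two_form \<alpha> \<longleftrightarrow> (\<forall>p\<in>topspace M. (\<forall>v. linear (\<lambda>u. \<alpha> p u v)) \<and> (\<forall>u v. \<alpha> p u v = - \<alpha> p v u)) \<and>
     (\<forall>c\<in>\<A>. \<forall>u v. smooth_on (snd c ` fst c) (\<lambda>x. cov2_in \<A> c \<alpha> x u v))"

lemma cov2_in_at: "c \<in> \<A> \<Longrightarrow> p \<in> fst c \<Longrightarrow>
    cov2_in \<A> c \<alpha> (snd c p) u v = \<alpha> p (tangent_of \<A> c p u) (tangent_of \<A> c p v)"
  by (simp add: cov2_in_def)

lemma cov3_in_at: "c \<in> \<A> \<Longrightarrow> p \<in> fst c \<Longrightarrow> cov3_in \<A> c \<beta> (snd c p) u v w =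
    \<beta> p (tangent_of \<A> c p u) (tangent_of \<A> c p v) (tangent_of \<A> c p w)"
  by (simp add: cov3_in_def)

text \<open>\<open>ext_deriv2\<close> consults a different chart at each point and cannot be
  differentiated as it stands. Pullback along the transition map replaces it by a coordinate
  expression in one chart.\<close>

lemma ext_deriv2_in_chart:
  assumes \<alpha>: "two_form \<alpha>" and c: "c \<in> \<A>" "p \<in> fst c"
  shows "ext_deriv2 \<A> \<alpha> p (tangent_of \<A> c p u) (tangent_of \<A> c p v) (tangent_of \<A> c p w) =
    dform2 (cov2_in \<A> c \<alpha>) (snd c p) u v w"
proof -
  define d where "d = chart_at \<A> p"
  have p: "p \<in> topspace M" using c chart_subset by blast
  have d: "d \<in> \<A>" "p \<in> fst d" using chart_at_in[OF p] in_chart_at[OF p] by (auto simp: d_def)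
  let ?S = "snd c ` (fst c \<inter> fst d)" and ?T = "snd d ` fst d" and ?\<tau> = "transition c d"
  have "dform2 (cov2_in \<A> c \<alpha>) (snd c p) u v w = dform2 (cov2_in \<A> d \<alpha>) (?\<tau> (snd c p))
      (frechet_derivative ?\<tau> (at (snd c p)) u) (frechet_derivative ?\<tau> (at (snd c p)) v)
      (frechet_derivative ?\<tau> (at (snd c p)) w)"
  proof (rule dform2_pullback[of ?S _ ?T])
    show "open ?S" "open ?T" "smooth_on ?S ?\<tau>" using open_overlap open_dom smooth_transition c d by auto
    show "snd c p \<in> ?S" "?\<tau> ` ?S \<subseteq> ?T" using c d by (auto simp: transition_eq)
    show "smooth_on ?T (\<lambda>y. cov2_in \<A> d \<alpha> y u v)" for u v using \<alpha> d by (auto simp: two_form_def)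
  next
    fix y v assume "y \<in> ?T"
    then obtain q where q: "y = snd d q" "q \<in> fst d" by auto
    have "linear (\<lambda>u. \<alpha> q u (tangent_of \<A> d q v))" using \<alpha> chart_topspace[OF d(1) q(2)] unfolding two_form_def by blast
    from linear_compose[OF linear_tangent_of[OF d(1) q(2)] this]
    show "linear (\<lambda>u. cov2_in \<A> d \<alpha> y u v)" unfolding q(1) cov2_in_at[OF d(1) q(2)] o_def .
  next
    fix y u v assume "y \<in> ?T"
    then obtain q where q: "y = snd d q" "q \<in> fst d" by auto
    show "cov2_in \<A> d \<alpha> y u v = - cov2_in \<A> d \<alpha> y v u"
      using \<alpha> chart_topspace[OF d(1) q(2)] unfolding two_form_def q(1) cov2_in_at[OF d(1) q(2)] by blast
  next
    fix y u v assume "y \<in> ?S"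
    then obtain q where q: "y = snd c q" "q \<in> fst d" "q \<in> fst c" by auto
    show "cov2_in \<A> c \<alpha> y u v = cov2_in \<A> d \<alpha> (?\<tau> y) (frechet_derivative ?\<tau> (at y) u) (frechet_derivative ?\<tau> (at y) v)"
      using q d c by (simp add: cov2_in_at transition_eq jac_def[symmetric] tangent_of_change)
  qed
  then show ?thesis
    using c by (simp add: ext_deriv2_def Let_def dform2_def tangent_of_jac d_def transition_eq jac_def[symmetric])
qed

lemma ext_deriv3_in_chart:
  assumes \<beta>: "three_form M \<A> \<beta>" and c: "c \<in> \<A>" "p \<in> fst c"
  shows "ext_deriv3 \<A> \<beta> p (tangent_of \<A> c p u) (tangent_of \<A> c p v) (tangent_of \<A> c p w) (tangent_of \<A> c p z) =
    dform3 (cov3_in \<A> c \<beta>) (snd c p) u v w z"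
proof -
  define d where "d = chart_at \<A> p"
  have p: "p \<in> topspace M" using c chart_subset by blast
  have d: "d \<in> \<A>" "p \<in> fst d" using chart_at_in[OF p] in_chart_at[OF p] by (auto simp: d_def)
  let ?S = "snd c ` (fst c \<inter> fst d)" and ?T = "snd d ` fst d" and ?\<tau> = "transition c d"
  have "dform3 (cov3_in \<A> c \<beta>) (snd c p) u v w z = dform3 (cov3_in \<A> d \<beta>) (?\<tau> (snd c p))
      (frechet_derivative ?\<tau> (at (snd c p)) u) (frechet_derivative ?\<tau> (at (snd c p)) v)
      (frechet_derivative ?\<tau> (at (snd c p)) w) (frechet_derivative ?\<tau> (at (snd c p)) z)"
  proof (rule dform3_pullback[of ?S _ ?T])
    show "open ?S" "open ?T" "smooth_on ?S ?\<tau>" using open_overlap open_dom smooth_transition c d by auto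
    show "snd c p \<in> ?S" "?\<tau> ` ?S \<subseteq> ?T" using c d by (auto simp: transition_eq)
    show "smooth_on ?T (\<lambda>y. cov3_in \<A> d \<beta> y u v w)" for u v w using \<beta> d by (auto simp: three_form_def)
  next
    fix y v w assume "y \<in> ?T"
    then obtain q where q: "y = snd d q" "q \<in> fst d" by auto
    have "linear (\<lambda>u. \<beta> q u (tangent_of \<A> d q v) (tangent_of \<A> d q w))"
      using \<beta> chart_topspace[OF d(1) q(2)] unfolding three_form_def by blast
    from linear_compose[OF linear_tangent_of[OF d(1) q(2)] this]
    show "linear (\<lambda>u. cov3_in \<A> d \<beta> y u v w)" unfolding q(1) cov3_in_at[OF d(1) q(2)] o_def .
  next
    fix y u v w assume "y \<in> ?T"
    then obtain q where q: "y = snd d q" "q \<in> fst d" by auto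
    show "cov3_in \<A> d \<beta> y u v w = - cov3_in \<A> d \<beta> y v u w"
      using \<beta> chart_topspace[OF d(1) q(2)] unfolding three_form_def q(1) cov3_in_at[OF d(1) q(2)] by blast
    show "cov3_in \<A> d \<beta> y u v w = - cov3_in \<A> d \<beta> y u w v"
      using \<beta> chart_topspace[OF d(1) q(2)] unfolding three_form_def q(1) cov3_in_at[OF d(1) q(2)] by blast
  next
    fix y u v w assume "y \<in> ?S"
    then obtain q where q: "y = snd c q" "q \<in> fst d" "q \<in> fst c" by auto
    show "cov3_in \<A> c \<beta> y u v w = cov3_in \<A> d \<beta> (?\<tau> y) (frechet_derivative ?\<tau> (at y) u)
        (frechet_derivative ?\<tau> (at y) v) (frechet_derivative ?\<tau> (at y) w)"
      using q d c by (simp add: cov3_in_at transition_eq jac_def[symmetric] tangent_of_change)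
  qed
  then show ?thesis
    using c by (simp add: ext_deriv3_def Let_def dform3_def tangent_of_jac d_def transition_eq jac_def[symmetric])
qed

end

section \<open>Adapted frames of \<open>\<epsilon>\<close>-Hermitian vector spaces\<close>

locale eps_hermitian =
  fixes g :: "'v::euclidean_space \<Rightarrow> 'v \<Rightarrow> real" and j :: "'v \<Rightarrow> 'v" and \<epsilon> :: real
  assumes eps: "\<epsilon> = 1 \<or> \<epsilon> = - 1"
    and bilinear_g: "bilinear g" and g_sym: "g u v = g v u"
    and nondegenerate: "(\<And>v. g u v = 0) \<Longrightarrow> u = 0"
    and linear_j: "linear j" and jj [simp]: "j (j u) = \<epsilon> *\<^sub>R u"
    and gjj [simp]: "g (j u) (j v) = - \<epsilon> * g u v"
begin

lemma eps_simps [simp]: "\<epsilon> * \<epsilon> = 1" "\<epsilon> * (\<epsilon> * r) = r" "\<epsilon> \<noteq> 0" "\<epsilon>\<^sup>2 = 1"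
  using eps by auto

lemma eps_cases: "(\<epsilon> = 1 \<Longrightarrow> P) \<Longrightarrow> (\<epsilon> = - 1 \<Longrightarrow> P) \<Longrightarrow> P"
  using eps by blast

lemmas j_simps [simp] = linear_add[OF linear_j] linear_diff[OF linear_j] linear_neg[OF linear_j]
  linear_cmul[OF linear_j] linear_0[OF linear_j]

lemmas g_simps [simp] = bilinear_ladd[OF bilinear_g] bilinear_radd[OF bilinear_g]
  bilinear_lsub[OF bilinear_g] bilinear_rsub[OF bilinear_g] bilinear_lneg[OF bilinear_g]
  bilinear_rneg[OF bilinear_g] bilinear_lmul[OF bilinear_g] bilinear_rmul[OF bilinear_g]
  bilinear_lzero[OF bilinear_g] bilinear_rzero[OF bilinear_g]

lemma linear_g: "linear (g u)" "linear (\<lambda>u. g u v)"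
  using bilinear_g by (auto simp: bilinear_def)

lemma g_j_left: "g (j u) v = - g u (j v)"
  using gjj[of u "j v"] eps by auto

lemma g_j_skew: "g u (j v) = - g v (j u)"
  using g_j_left[of v u] g_sym[of u "j v"] by simp

lemma g_j_self [simp]: "g u (j u) = 0" "g (j u) u = 0"
  using g_j_skew[of u u] g_j_left[of u u] by auto

lemma g_eqI: "(\<And>v. g u v = g w v) \<Longrightarrow> u = w"
  using nondegenerate[of "u - w"] by simp

primrec unitary :: "'v list \<Rightarrow> bool" where
  "unitary [] = True"
| "unitary (e # es) \<longleftrightarrow>
     (g e e = 1 \<or> g e e = - 1) \<and> (\<forall>f\<in>set es. g e f = 0 \<and> g e (j f) = 0) \<and> unitary es"

text \<open>Orthogonal projection onto the span of \<open>es\<close> and \<open>j es\<close> for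
  unitary \<open>es\<close>. Norms are 1 or -1, hence their own inverses, and
  \<open>g (j e) (j e) = - \<epsilon> * g e e\<close> explains the coefficient of
  \<open>j e\<close>.\<close>

definition unitary_proj :: "'v list \<Rightarrow> 'v \<Rightarrow> 'v" where
  "unitary_proj es x =
     sum_list (map (\<lambda>e. (g e e * g x e) *\<^sub>R e - (\<epsilon> * g e e * g x (j e)) *\<^sub>R j e) es)"

lemma unitary_proj_simps [simp]:
  "unitary_proj [] x = 0"
  "unitary_proj (e # es) x =
    (g e e * g x e) *\<^sub>R e - (\<epsilon> * g e e * g x (j e)) *\<^sub>R j e + unitary_proj es x"
  by (simp_all add: unitary_proj_def)

lemma g_unitary_proj_orth:
  "(\<forall>f\<in>set es. g y f = 0 \<and> g y (j f) = 0) \<Longrightarrow> g (unitary_proj es x) y = 0"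
  by (induction es) (auto simp: g_sym[of _ y])

lemma unitary_orth_j: "(\<forall>f\<in>set es. g y f = 0 \<and> g y (j f) = 0) \<Longrightarrow> \<forall>f\<in>set es. g (j y) f = 0 \<and> g (j y) (j f) = 0"
  by (simp add: g_j_left)

lemma g_unitary_proj:
  "unitary es \<Longrightarrow> e \<in> set es \<Longrightarrow> g (unitary_proj es x) e = g x e \<and> g (unitary_proj es x) (j e) = g x (j e)"
proof (induction es)
  case (Cons f es)
  have sq: "g f f * g f f = 1" using Cons.prems by auto
  have 0: "\<forall>e\<in>set es. g f e = 0 \<and> g f (j e) = 0" using Cons.prems by simp
  show ?case
  proof (cases "e = f")
    case True
    then show ?thesis
      using sq g_unitary_proj_orth[OF 0] g_unitary_proj_orth[OF unitary_orth_j[OF 0]]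
      by (simp add: mult.assoc mult.left_commute[of "g f f"])
  next
    case False
    then have e: "e \<in> set es" using Cons.prems by simp
    then have "g f e = 0" "g f (j e) = 0" "g (j f) e = 0" "g (j f) (j e) = 0"
      using 0 by (auto simp: g_j_left)
    then show ?thesis using Cons.IH Cons.prems e by simp
  qed
qed simp

text \<open>For an indefinite metric the residual of \<open>x\<close> may be null, so Gram-Schmidt
  cannot just normalise it. The orthogonal complement still contains a non-null vector: otherwise
  polarisation makes it totally isotropic, and the residual, orthogonal to all projections as well,
  would be orthogonal to everything.\<close>

lemma unitary_extend:
  assumes es: "unitary es" and x: "x \<noteq> unitary_proj es x"
  shows "\<exists>e. unitary (e # es)"
proof -
  define W where "W = {w. \<forall>e\<in>set es. g w e = 0 \<and> g w (j e) = 0}"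
  have W_diff: "y - unitary_proj es y \<in> W" for y
    unfolding W_def using g_unitary_proj[OF es] by simp
  have W_add: "a + b \<in> W" if "a \<in> W" "b \<in> W" for a b using that by (simp add: W_def)
  have "\<exists>w\<in>W. g w w \<noteq> 0"
  proof (rule ccontr)
    assume 0: "\<not> (\<exists>w\<in>W. g w w \<noteq> 0)"
    have iso: "g a b = 0" if "a \<in> W" "b \<in> W" for a b
    proof -
      have "g (a + b) (a + b) = 0" "g a a = 0" "g b b = 0" using 0 that W_add by blast+
      then show ?thesis using g_sym[of a b] by simp
    qed
    let ?x = "x - unitary_proj es x"
    have "g ?x y = 0" for y
    proof -
      have "g ?x (unitary_proj es y) = 0"
        using W_diff[of x] g_unitary_proj_orth[of es ?x y] g_sym[of ?x] unfolding W_def by auto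
      moreover have "g ?x (y - unitary_proj es y) = 0" using iso W_diff by blast
      ultimately show ?thesis by simp
    qed
    then have "?x = 0" by (rule nondegenerate)
    then show False using x by simp
  qed
  then obtain w where w: "w \<in> W" "g w w \<noteq> 0" by blast
  define e where "e = (1 / sqrt \<bar>g w w\<bar>) *\<^sub>R w"
  have "g e e = g w w / \<bar>g w w\<bar>" using w by (simp add: e_def)
  then have "g e e = 1 \<or> g e e = - 1" using w(2) by (auto simp: abs_if)
  moreover have "\<forall>f\<in>set es. g e f = 0 \<and> g e (j f) = 0" using w(1) by (simp add: e_def W_def)
  ultimately show ?thesis using es by auto
qed

lemma unitary_proj_span: "unitary_proj es x \<in> span (set es \<union> j ` set es)"
proof (induction es)
  case (Cons e es)
  have "unitary_proj es x \<in> span (set (e # es) \<union> j ` set (e # es))"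
    using Cons.IH span_mono[of "set es \<union> j ` set es" "set (e # es) \<union> j ` set (e # es)"] by auto
  moreover have "e \<in> span (set (e # es) \<union> j ` set (e # es))" "j e \<in> span (set (e # es) \<union> j ` set (e # es))"
    by (auto intro: span_base)
  ultimately show ?case by (simp add: span_add span_diff span_scale)
qed simp

lemma unitary_exists: "2 * n \<le> DIM('v) \<Longrightarrow> \<exists>es. length es = n \<and> unitary es"
proof (induction n)
  case (Suc n)
  then obtain es where es: "length es = n" "unitary es" by auto
  let ?S = "set es \<union> j ` set es"
  have "card ?S \<le> card (set es) + card (j ` set es)" by (rule card_Un_le)
  also have "\<dots> \<le> length es + length es"
    by (intro add_mono card_length order_trans[OF card_image_le]) auto
  finally have "dim (span ?S) < DIM('v)"
    using Suc.prems es dim_le_card'[of ?S] by simp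
  then have "span ?S \<noteq> UNIV" by (metis dim_span dim_UNIV less_irrefl)
  then obtain x where "x \<notin> span ?S" by auto
  then have "x \<noteq> unitary_proj es x" using unitary_proj_span by metis
  from unitary_extend[OF es(2) this] obtain e where "unitary (e # es)" ..
  then show ?case using es(1) by (intro exI[of _ "e # es"]) auto
qed simp

section \<open>Orthogonal bases\<close>

lemma orthogonal_independent:
  assumes "finite B" "\<And>b. b \<in> B \<Longrightarrow> g b b \<noteq> 0" "\<And>b c. b \<in> B \<Longrightarrow> c \<in> B \<Longrightarrow> b \<noteq> c \<Longrightarrow> g b c = 0"
  shows "independent B"
proof (rule independent_if_scalars_zero[OF assms(1)])
  fix f b assume s: "(\<Sum>x\<in>B. f x *\<^sub>R x) = 0" and b: "b \<in> B"
  have "0 = g (\<Sum>x\<in>B. f x *\<^sub>R x) b" using s by simp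
  also have "\<dots> = (\<Sum>x\<in>B. f x * g x b)" by (simp add: linear_sum[OF linear_g(2)])
  also have "\<dots> = (\<Sum>x\<in>{b}. f x * g x b)"
    by (rule sum.mono_neutral_right) (use assms b in auto)
  finally show "f b = 0" using assms(2)[OF b] by simp
qed

lemma eq_0_if_orthogonal_basis:
  assumes "finite B" "\<And>b. b \<in> B \<Longrightarrow> g b b \<noteq> 0" "\<And>b c. b \<in> B \<Longrightarrow> c \<in> B \<Longrightarrow> b \<noteq> c \<Longrightarrow> g b c = 0"
    and "card B = DIM('v)" and y: "\<And>b. b \<in> B \<Longrightarrow> g y b = 0"
  shows "y = 0"
proof (rule nondegenerate)
  fix v
  have "span B = UNIV"
    using card_eq_dim[of B UNIV] orthogonal_independent[OF assms(1-3)] assms(1,4) by (auto simp: dim_UNIV)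
  then have "v \<in> span B" by simp
  then show "g y v = 0"
    by (rule span_induct[where P = "\<lambda>v. g y v = 0"]) (auto intro: subspaceI y)
qed

lemma unitary_basis:
  assumes "unitary es"
  defines "B \<equiv> set es \<union> j ` set es"
  shows "card B = 2 * length es" "\<And>b. b \<in> B \<Longrightarrow> g b b = 1 \<or> g b b = -1"
    "\<And>b c. b \<in> B \<Longrightarrow> c \<in> B \<Longrightarrow> b \<noteq> c \<Longrightarrow> g b c = 0"
proof -
  have n: "g b b = 1 \<or> g b b = - 1" if "e \<in> set es" "b = e \<or> b = j e" for e b
    using assms(1) that eps by (induction es) auto
  show nB: "\<And>b. b \<in> B \<Longrightarrow> g b b = 1 \<or> g b b = -1" using n by (auto simp: B_def)
  have o: "g a b = 0 \<and> g a (j b) = 0" if "a \<in> set es" "b \<in> set es" "a \<noteq> b" for a b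
    using assms(1) that by (induction es) (auto simp: g_sym[of _ b] g_j_skew[of a b] g_j_skew[of _ b])
  show "\<And>b c. b \<in> B \<Longrightarrow> c \<in> B \<Longrightarrow> b \<noteq> c \<Longrightarrow> g b c = 0"
  proof -
    fix b c assume bc: "b \<in> B" "c \<in> B" "b \<noteq> c"
    obtain a a' where a: "a \<in> set es" "b = a \<or> b = j a" "a' \<in> set es" "c = a' \<or> c = j a'"
      using bc by (auto simp: B_def)
    show "g b c = 0" using a bc(3) o[of a a'] by (cases "a = a'") (auto simp: g_j_left)
  qed
  show "card B = 2 * length es"
    unfolding B_def using assms(1)
  proof (induction es)
    case (Cons e es)
    have ne: "g e e \<noteq> 0" "g (j e) (j e) \<noteq> 0" using Cons.prems by auto
    have 1: "e \<notin> set es" "e \<notin> j ` set es" using Cons.prems ne by auto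
    have "g (j e) f = 0 \<and> g (j e) (j f) = 0" if "f \<in> set es" for f
      using Cons.prems that by (simp add: g_j_left)
    then have 2: "j e \<notin> set es" "j e \<notin> j ` set es" using ne by (metis, metis imageE)
    have 3: "e \<noteq> j e" using ne by (metis g_j_self(1))
    have "set (e # es) \<union> j ` set (e # es) = insert e (insert (j e) (set es \<union> j ` set es))" by auto
    then show ?case using Cons 1 2 3 by simp
  qed simp
qed

end

text \<open>The signs cover all signatures at once. Completeness of the frame is stated as an
  expansion formula, so that a linear map is determined by six explicit values.\<close>

locale hermitian_frame = eps_hermitian g j \<epsilon>
  for g :: "'v::euclidean_space \<Rightarrow> 'v \<Rightarrow> real" and j \<epsilon> +
  fixes e1 e2 e3 :: 'v and s1 s2 s3 :: real
  assumes norm: "g e1 e1 = s1" "g e2 e2 = s2" "g e3 e3 = s3"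
    and sign: "s1 = 1 \<or> s1 = - 1" "s2 = 1 \<or> s2 = - 1" "s3 = 1 \<or> s3 = - 1"
    and orth: "g e1 e2 = 0" "g e1 e3 = 0" "g e2 e3 = 0"
      "g e1 (j e2) = 0" "g e1 (j e3) = 0" "g e2 (j e3) = 0"
    and expansion: "x = (s1 * g x e1) *\<^sub>R e1 - (\<epsilon> * s1 * g x (j e1)) *\<^sub>R j e1 +
      (s2 * g x e2) *\<^sub>R e2 - (\<epsilon> * s2 * g x (j e2)) *\<^sub>R j e2 +
      (s3 * g x e3) *\<^sub>R e3 - (\<epsilon> * s3 * g x (j e3)) *\<^sub>R j e3"

lemma (in eps_hermitian) hermitian_frame_exists:
  assumes "DIM('v) = 6"
  shows "\<exists>e1 e2 e3 s1 s2 s3. hermitian_frame g j \<epsilon> e1 e2 e3 s1 s2 s3"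
proof -
  obtain es where es: "length es = 3" "unitary es" using unitary_exists[of 3] assms by auto
  then obtain e1 e2 e3 where e: "es = [e1, e2, e3]"
    by (auto simp: numeral_3_eq_3 length_Suc_conv)
  let ?B = "set es \<union> j ` set es"
  have "x = unitary_proj es x" for x
  proof -
    have "x - unitary_proj es x = 0"
    proof (rule eq_0_if_orthogonal_basis)
      show "finite ?B" by simp
      show "card ?B = DIM('v)" using unitary_basis(1)[OF es(2)] es(1) assms by simp
      show "g b b \<noteq> 0" if "b \<in> ?B" for b using unitary_basis(2)[OF es(2) that] by auto
      show "g b c = 0" if "b \<in> ?B" "c \<in> ?B" "b \<noteq> c" for b c using unitary_basis(3)[OF es(2) that] .
      show "g (x - unitary_proj es x) b = 0" if "b \<in> ?B" for b using that g_unitary_proj[OF es(2)] by auto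
    qed
    then show ?thesis by simp
  qed
  then have "hermitian_frame g j \<epsilon> e1 e2 e3 (g e1 e1) (g e2 e2) (g e3 e3)"
    using es(2) unfolding e by unfold_locales (auto simp: algebra_simps)
  then show ?thesis by blast
qed

context hermitian_frame begin

lemma sign_sq [simp]: "s1 * s1 = 1" "s2 * s2 = 1" "s3 * s3 = 1"
  "s1 * (s1 * r) = r" "s2 * (s2 * r) = r" "s3 * (s3 * r) = r" "s1 \<noteq> 0" "s2 \<noteq> 0" "s3 \<noteq> 0"
  using sign by auto

lemma linear_frame_eq:
  assumes "linear f"
  shows "f x = (s1 * g x e1) *\<^sub>R f e1 - (\<epsilon> * s1 * g x (j e1)) *\<^sub>R f (j e1) +
      (s2 * g x e2) *\<^sub>R f e2 - (\<epsilon> * s2 * g x (j e2)) *\<^sub>R f (j e2) +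
      (s3 * g x e3) *\<^sub>R f e3 - (\<epsilon> * s3 * g x (j e3)) *\<^sub>R f (j e3)"
  by (subst expansion[of x]) (simp add: linear_add[OF assms] linear_diff[OF assms] linear_cmul[OF assms])

lemma linear_frame_0:
  assumes "linear f" "f e1 = 0" "f e2 = 0" "f e3 = 0" "f (j e1) = 0" "f (j e2) = 0" "f (j e3) = 0"
  shows "f x = 0"
  by (subst linear_frame_eq[OF assms(1)]) (simp add: assms)

text \<open>The metric trace of the quadratic form \<open>q\<close>; \<open>- \<epsilon>\<close> is
  the sign of \<open>g (j e) (j e)\<close> relative to \<open>g e e\<close>.\<close>

definition frame_trace :: "('v \<Rightarrow> real) \<Rightarrow> real" where
  "frame_trace q = s1 * (q e1 - \<epsilon> * q (j e1)) + s2 * (q e2 - \<epsilon> * q (j e2)) + s3 * (q e3 - \<epsilon> * q (j e3))"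

lemma frame_trace_mult: "r * frame_trace q = frame_trace (\<lambda>e. r * q e)"
  by (simp add: frame_trace_def algebra_simps)

lemma frame_trace_sum: "(\<Sum>i\<in>I. frame_trace (q i)) = frame_trace (\<lambda>e. \<Sum>i\<in>I. q i e)"
  by (simp add: frame_trace_def sum.distrib sum_subtractf sum_distrib_left right_diff_distrib)

lemma g_frame_trace: "g x y = frame_trace (\<lambda>e. g x e * g y e)"
  by (subst linear_frame_eq[OF linear_g(1)[of x], of y])
    (simp add: frame_trace_def algebra_simps)

text \<open>The vector metrically dual to the covector \<open>f\<close>.\<close>

definition sharp :: "('v \<Rightarrow> real) \<Rightarrow> 'v" where
  "sharp f = (s1 * f e1) *\<^sub>R e1 - (\<epsilon> * s1 * f (j e1)) *\<^sub>R j e1 +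
      (s2 * f e2) *\<^sub>R e2 - (\<epsilon> * s2 * f (j e2)) *\<^sub>R j e2 +
      (s3 * f e3) *\<^sub>R e3 - (\<epsilon> * s3 * f (j e3)) *\<^sub>R j e3"

lemma g_sharp: "linear f \<Longrightarrow> g v (sharp f) = f v"
  by (subst linear_frame_eq[of f v]) (simp_all add: sharp_def)


definition frame_vec :: "real \<Rightarrow> real \<Rightarrow> real \<Rightarrow> real \<Rightarrow> real \<Rightarrow> real \<Rightarrow> 'v" where
  "frame_vec a1 b1 a2 b2 a3 b3 =
    a1 *\<^sub>R e1 + b1 *\<^sub>R j e1 + a2 *\<^sub>R e2 + b2 *\<^sub>R j e2 + a3 *\<^sub>R e3 + b3 *\<^sub>R j e3"

lemma j_frame_vec: "j (frame_vec a1 b1 a2 b2 a3 b3) =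
    frame_vec (\<epsilon> * b1) a1 (\<epsilon> * b2) a2 (\<epsilon> * b3) a3"
  by (simp add: frame_vec_def algebra_simps)

lemma orth_sym: "g e2 e1 = 0" "g e3 e1 = 0" "g e3 e2 = 0"
  "g e2 (j e1) = 0" "g e3 (j e1) = 0" "g e3 (j e2) = 0"
  using orth g_sym[of e1 e2] g_sym[of e1 e3] g_sym[of e2 e3]
    g_j_skew[of e1 e2] g_j_skew[of e1 e3] g_j_skew[of e2 e3] by linarith+

lemma g_frame_vec: "g (frame_vec a1 b1 a2 b2 a3 b3) (frame_vec c1 d1 c2 d2 c3 d3) =
    s1 * (a1 * c1 - \<epsilon> * b1 * d1) + s2 * (a2 * c2 - \<epsilon> * b2 * d2) + s3 * (a3 * c3 - \<epsilon> * b3 * d3)"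
  by (simp add: frame_vec_def norm orth orth_sym g_j_left algebra_simps)

lemma frame_vecE:
  obtains a1 b1 a2 b2 a3 b3 where "x = frame_vec a1 b1 a2 b2 a3 b3"
  using that[of "s1 * g x e1" "- (\<epsilon> * s1 * g x (j e1))" "s2 * g x e2" "- (\<epsilon> * s2 * g x (j e2))"
      "s3 * g x e3" "- (\<epsilon> * s3 * g x (j e3))"] expansion[of x] by (simp add: frame_vec_def)

text \<open>\<open>frame_sum3\<close> refers to an arbitrarily chosen frame. Expanding one argument
  of \<open>b\<close> in the adapted frame and exchanging sums lets the expansion in
  \<open>f\<close> restore the other argument.\<close>

lemma frame_trace_independent:
  fixes f :: "'n::finite \<Rightarrow> 'v"
  assumes f: "\<And>i. g (f i) (f i) = 1 \<or> g (f i) (f i) = - 1" "\<And>i k. i \<noteq> k \<Longrightarrow> g (f i) (f k) = 0"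
    and n: "CARD('n) = DIM('v)" and b: "bilinear b"
  shows "(\<Sum>i\<in>UNIV. g (f i) (f i) * b (f i) (f i)) = frame_trace (\<lambda>x. b x x)"
proof -
  have sq: "g (f i) (f i) * g (f i) (f i) = 1" for i using f(1)[of i] by auto
  have ne: "g (f i) (f i) \<noteq> 0" for i using f(1)[of i] by auto
  have "inj f" using f(2) ne by (metis injI)
  have exp: "(\<Sum>i\<in>UNIV. (g (f i) (f i) * g x (f i)) *\<^sub>R f i) = x" for x
  proof -
    have "x - (\<Sum>i\<in>UNIV. (g (f i) (f i) * g x (f i)) *\<^sub>R f i) = 0"
    proof (rule eq_0_if_orthogonal_basis[of "range f"])
      show "card (range f) = DIM('v)" using n \<open>inj f\<close> by (simp add: card_image)
      fix c assume "c \<in> range f"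
      then obtain k where k: "c = f k" by auto
      have "g (\<Sum>i\<in>UNIV. (g (f i) (f i) * g x (f i)) *\<^sub>R f i) (f k) =
          (\<Sum>i\<in>UNIV. g (f i) (f i) * g x (f i) * g (f i) (f k))"
        by (simp add: linear_sum[OF linear_g(2)])
      also have "\<dots> = (\<Sum>i\<in>{k}. g (f i) (f i) * g x (f i) * g (f i) (f k))"
        by (rule sum.mono_neutral_right) (use f(2) in auto)
      also have "\<dots> = g x (f k)" using sq[of k] by (simp add: mult_ac)
      finally show "g (x - (\<Sum>i\<in>UNIV. (g (f i) (f i) * g x (f i)) *\<^sub>R f i)) c = 0" by (simp add: k)
    qed (use f(2) ne in \<open>auto, metis\<close>)
    then show ?thesis by simp
  qed
  have lb: "linear (\<lambda>x. b x y)" "linear (b x)" for x y using b by (auto simp: bilinear_def)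
  have sw: "(\<Sum>i\<in>UNIV. g (f i) (f i) * (g (f i) e * b e (f i))) = b e e" for e
  proof -
    have "b e (\<Sum>i\<in>UNIV. (g (f i) (f i) * g e (f i)) *\<^sub>R f i) = b e e" by (simp only: exp)
    then show ?thesis by (simp add: linear_sum[OF lb(2)] linear_cmul[OF lb(2)] g_sym[of e] mult.assoc)
  qed
  have "(\<Sum>i\<in>UNIV. g (f i) (f i) * b (f i) (f i)) =
    (\<Sum>i\<in>UNIV. g (f i) (f i) * frame_trace (\<lambda>e. g (f i) e * b e (f i)))"
    by (rule sum.cong[OF refl], subst linear_frame_eq[OF lb(1)])
      (simp add: frame_trace_def algebra_simps)
  also have "\<dots> = frame_trace (\<lambda>e. \<Sum>i\<in>UNIV. g (f i) (f i) * (g (f i) e * b e (f i)))"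
    by (simp only: frame_trace_sum frame_trace_mult)
  finally show ?thesis by (simp add: sw)
qed

text \<open>Ensures that the choice inside \<open>frame_sum3\<close> yields an actual
  pseudo-orthonormal frame.\<close>

lemma orthonormal_exists:
  assumes n: "CARD('n::finite) = 6" "DIM('v) = 6"
  shows "\<exists>f :: 'n \<Rightarrow> 'v. (\<forall>i. g (f i) (f i) = 1 \<or> g (f i) (f i) = - 1) \<and> (\<forall>i k. i \<noteq> k \<longrightarrow> g (f i) (f k) = 0)"
proof -
  obtain es where es: "length es = 3" "unitary es" using unitary_exists[of 3] n by auto
  note B = unitary_basis[OF es(2)]
  have "finite (set es \<union> j ` set es)" "card (UNIV :: 'n set) = card (set es \<union> j ` set es)"
    using B(1) es n by auto
  then obtain f :: "'n \<Rightarrow> 'v" where f: "bij_betw f UNIV (set es \<union> j ` set es)"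
    using finite_same_card_bij[OF finite_class.finite_UNIV] by blast
  then have "f i \<in> set es \<union> j ` set es" "i \<noteq> k \<Longrightarrow> f i \<noteq> f k" for i k
    by (auto simp: bij_betw_def inj_eq)
  then show ?thesis using B(2,3) by meson
qed

end

section \<open>Three-forms of type (3,0) + (0,3)\<close>

text \<open>\<open>form_j\<close> is the real content of the type condition: by skewness
  \<open>j\<close> moves to any slot, and the form with real part \<open>\<psi> u v w\<close> and
  imaginary part \<open>\<epsilon> * \<psi> (j u) v w\<close> is multiplied by i_eps when
  \<open>j\<close> is applied to an argument.\<close>

locale form30_frame = hermitian_frame g j \<epsilon> e1 e2 e3 s1 s2 s3
  for g :: "'v::euclidean_space \<Rightarrow> 'v \<Rightarrow> real" and j \<epsilon> e1 e2 e3 s1 s2 s3 +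
  fixes \<psi> :: "'v \<Rightarrow> 'v \<Rightarrow> 'v \<Rightarrow> real"
  assumes linear_form: "linear (\<lambda>u. \<psi> u v w)"
    and skew12: "\<psi> u v w = - \<psi> v u w" and skew23: "\<psi> u v w = - \<psi> u w v"
    and form_j: "\<psi> (j u) v w = \<psi> u (j v) w"
begin

lemma linear_form2: "linear (\<lambda>v. \<psi> u v w)"
  using linear_compose_neg[OF linear_form[of u w]] skew12[of u _ w] by (metis (no_types, lifting) ext)

lemma linear_form3: "linear (\<psi> u v)"
  using linear_compose_neg[OF linear_form2[of u v]] skew23[of u v] by (metis (no_types, lifting) ext)

lemmas form_simps [simp] =
  linear_add[OF linear_form] linear_diff[OF linear_form] linear_neg[OF linear_form]
  linear_cmul[OF linear_form] linear_0[OF linear_form]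
  linear_add[OF linear_form2] linear_diff[OF linear_form2] linear_neg[OF linear_form2]
  linear_cmul[OF linear_form2] linear_0[OF linear_form2]
  linear_add[OF linear_form3] linear_diff[OF linear_form3] linear_neg[OF linear_form3]
  linear_cmul[OF linear_form3] linear_0[OF linear_form3]

lemma form_j2: "\<psi> u (j v) w = \<psi> (j u) v w"
  by (simp add: form_j)

lemma form_j3: "\<psi> u v (j w) = \<psi> (j u) v w"
  using form_j[of w v u] skew12 skew23 by (metis form_j)

lemma form_same [simp]: "\<psi> u u w = 0" "\<psi> u w u = 0" "\<psi> w u u = 0"
  using skew12[of u u w] skew23[of w u u] skew12[of u w u] by linarith+

lemma form_j_same [simp]: "\<psi> (j u) u w = 0" "\<psi> (j u) w u = 0"
  using form_j[of u u w] skew12[of u "j u" w] skew23[of "j u" w u] by linarith+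

text \<open>In dimension six a (3,0)-form is one \<open>\<epsilon>\<close>-complex number, its value
  on the frame. Here its real part is \<open>al\<close> and its imaginary part
  \<open>\<epsilon> * be\<close>.\<close>

definition al :: real where "al = \<psi> e1 e2 e3"
definition be :: real where "be = \<psi> (j e1) e2 e3"

lemma frame_values:
  "\<psi> e1 e2 e3 = al" "\<psi> e2 e3 e1 = al" "\<psi> e3 e1 e2 = al"
  "\<psi> e2 e1 e3 = - al" "\<psi> e1 e3 e2 = - al" "\<psi> e3 e2 e1 = - al"
  "\<psi> (j e1) e2 e3 = be" "\<psi> (j e2) e3 e1 = be" "\<psi> (j e3) e1 e2 = be"
  "\<psi> (j e2) e1 e3 = - be" "\<psi> (j e1) e3 e2 = - be" "\<psi> (j e3) e2 e1 = - be"
proof -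
  show "\<psi> e1 e2 e3 = al" "\<psi> e2 e3 e1 = al" "\<psi> e3 e1 e2 = al"
    "\<psi> e2 e1 e3 = - al" "\<psi> e1 e3 e2 = - al" "\<psi> e3 e2 e1 = - al"
    unfolding al_def using skew12 skew23 by (metis minus_minus)+
  show "\<psi> (j e1) e2 e3 = be" by (simp add: be_def)
  show a: "\<psi> (j e2) e1 e3 = - be" using form_j[of e2 e1 e3] skew12[of e2 "j e1" e3] by (simp add: be_def)
  show b: "\<psi> (j e1) e3 e2 = - be" using skew23[of "j e1" e3 e2] by (simp add: be_def)
  show "\<psi> (j e2) e3 e1 = be" using skew23[of "j e2" e3 e1] a by simp
  show c: "\<psi> (j e3) e1 e2 = be" using form_j[of e3 e1 e2] skew12[of e3 "j e1" e2] b by simp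
  show "\<psi> (j e3) e2 e1 = - be" using skew23[of "j e3" e2 e1] c by simp
qed

text \<open>The \<open>\<epsilon>\<close>-complex squared modulus of that number times the sign of
  the frame. By \<open>frame_sum3_form30\<close> it is a quarter of the squared length of
  \<open>\<psi>\<close>: the pointwise kappa.\<close>

definition kap :: real where "kap = s1 * s2 * s3 * (al\<^sup>2 - \<epsilon> * be\<^sup>2)"

text \<open>24 is six orderings times four: of the eight ways to insert \<open>j\<close> into a
  frame triple, four give \<open>al\<close> squared and four give \<open>be\<close> squared, the
  latter with the factor \<open>- \<epsilon>\<close>.\<close>

lemma form_trace:
  "frame_trace (\<lambda>u. frame_trace (\<lambda>v. frame_trace (\<lambda>w. (\<psi> u v w)\<^sup>2))) = 24 * kap"
  unfolding frame_trace_def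
  by (simp add: form_j2 form_j3 frame_values power_mult_distrib kap_def algebra_simps)


text \<open>The vector product of \<open>\<psi>\<close>. The slot order is that of g(v, (nabla_u J)
  x), so \<open>cross u x\<close> is (nabla_u J) x once \<open>\<psi>\<close> equals nabla
  omega.\<close>

definition cross :: "'v \<Rightarrow> 'v \<Rightarrow> 'v" where "cross u x = sharp (\<lambda>v. \<psi> u v x)"

lemma g_cross: "g v (cross u x) = \<psi> u v x"
  unfolding cross_def by (rule g_sharp) (rule linear_form2)

lemma cross_skew: "cross u x = - cross x u"
proof (rule g_eqI)
  fix v show "g (cross u x) v = g (- cross x u) v"
    using g_cross[of v u x] g_cross[of v x u] skew12[of u v x] skew23[of v u x] skew12[of v x u]
    by (simp add: g_sym[of _ v])
qed

lemma cross_j2: "cross u (j x) = - j (cross u x)"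
proof (rule g_eqI)
  fix v show "g (cross u (j x)) v = g (- j (cross u x)) v"
    using g_cross[of v u "j x"] g_cross[of "j v" u x] g_j_left[of v "cross u x"]
    by (simp add: g_sym[of _ v] form_j2 form_j3)
qed

lemma cross_j1: "cross (j u) x = - j (cross u x)"
  using cross_j2[of x u] cross_skew[of "j u" x] cross_skew[of u x] by simp

lemma g_cross_trace:
  "g (cross u x) (cross u y) = frame_trace (\<lambda>e. \<psi> u e x * \<psi> u e y)"
  by (subst g_frame_trace) (simp add: g_sym[of "cross _ _"] g_cross)

lemma form_frame_vec:
    "\<psi> (frame_vec a1 b1 a2 b2 a3 b3) e1 (frame_vec c1 d1 c2 d2 c3 d3) =
      - al * (a2 * c3 - a3 * c2 + \<epsilon> * (b2 * d3 - b3 * d2)) - be * (a2 * d3 + b2 * c3 - a3 * d2 - b3 * c2)"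
    "\<psi> (frame_vec a1 b1 a2 b2 a3 b3) e2 (frame_vec c1 d1 c2 d2 c3 d3) =
      - al * (a3 * c1 - a1 * c3 + \<epsilon> * (b3 * d1 - b1 * d3)) - be * (a3 * d1 + b3 * c1 - a1 * d3 - b1 * c3)"
    "\<psi> (frame_vec a1 b1 a2 b2 a3 b3) e3 (frame_vec c1 d1 c2 d2 c3 d3) =
      - al * (a1 * c2 - a2 * c1 + \<epsilon> * (b1 * d2 - b2 * d1)) - be * (a1 * d2 + b1 * c2 - a2 * d1 - b2 * c1)"
    "\<psi> (frame_vec a1 b1 a2 b2 a3 b3) (j e1) (frame_vec c1 d1 c2 d2 c3 d3) =
      - be * (a2 * c3 - a3 * c2 + \<epsilon> * (b2 * d3 - b3 * d2)) - \<epsilon> * al * (a2 * d3 + b2 * c3 - a3 * d2 - b3 * c2)"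
    "\<psi> (frame_vec a1 b1 a2 b2 a3 b3) (j e2) (frame_vec c1 d1 c2 d2 c3 d3) =
      - be * (a3 * c1 - a1 * c3 + \<epsilon> * (b3 * d1 - b1 * d3)) - \<epsilon> * al * (a3 * d1 + b3 * c1 - a1 * d3 - b1 * c3)"
    "\<psi> (frame_vec a1 b1 a2 b2 a3 b3) (j e3) (frame_vec c1 d1 c2 d2 c3 d3) =
      - be * (a1 * c2 - a2 * c1 + \<epsilon> * (b1 * d2 - b2 * d1)) - \<epsilon> * al * (a1 * d2 + b1 * c2 - a2 * d1 - b2 * c1)"
  unfolding frame_vec_def by (simp_all add: form_j2 form_j3 frame_values algebra_simps)

text \<open>Multiplicativity of the \<open>\<epsilon>\<close>-complex modulus: up to sign, the
  brackets are the real part and \<open>\<epsilon>\<close> times the imaginary part of the product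
  of \<open>al\<close> + i_eps \<open>\<epsilon> * be\<close> with \<open>P\<close> + i_eps
  \<open>Q\<close>.\<close>

lemma cross_product_norm:
  "s * ((- al * P - be * Q) * (- al * P' - be * Q') - \<epsilon> * ((- be * P - \<epsilon> * al * Q) * (- be * P' - \<epsilon> * al * Q')))
    = (al\<^sup>2 - \<epsilon> * be\<^sup>2) * (s * (P * P' - \<epsilon> * (Q * Q')))"
  by (rule eps_cases) (simp_all add: power2_eq_square algebra_simps)

lemma constant_type_single:
  "(a * a - \<epsilon> * b * b) * (c * f - \<epsilon> * d * h) - (a * c - \<epsilon> * b * d) * (a * f - \<epsilon> * b * h)
    + \<epsilon> * ((a * (\<epsilon> * d) - \<epsilon> * b * c) * (a * (\<epsilon> * h) - \<epsilon> * b * f)) = 0"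
  by (rule eps_cases) (simp_all add: algebra_simps)

text \<open>Lagrange's identity for two-by-two minors of \<open>\<epsilon>\<close>-complex numbers
  such as \<open>a\<close> + i_eps \<open>b\<close>. When primed and unprimed variables agree, the
  minors vanish and twice \<open>constant_type_single\<close> remains.\<close>

lemma constant_type_pair:
  "(a * c' - a' * c + \<epsilon> * (b * d' - b' * d)) * (a * f' - a' * f + \<epsilon> * (b * h' - b' * h))
    - \<epsilon> * ((a * d' + b * c' - a' * d - b' * c) * (a * h' + b * f' - a' * h - b' * f)) =
   (a * a - \<epsilon> * b * b) * (c' * f' - \<epsilon> * d' * h') + (a' * a' - \<epsilon> * b' * b') * (c * f - \<epsilon> * d * h)
    - (a * c - \<epsilon> * b * d) * (a' * f' - \<epsilon> * b' * h') - (a' * c' - \<epsilon> * b' * d') * (a * f - \<epsilon> * b * h)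
    + \<epsilon> * ((a * (\<epsilon> * d) - \<epsilon> * b * c) * (a' * (\<epsilon> * h') - \<epsilon> * b' * f')
      + (a' * (\<epsilon> * d') - \<epsilon> * b' * c') * (a * (\<epsilon> * h) - \<epsilon> * b * f))"
  by (rule eps_cases) (simp_all add: algebra_simps)

text \<open>In the expanded right side a mixed product of two signs with \<open>s1 * s2 * s3\<close>
  leaves the third sign, and the diagonal products vanish by assumption.\<close>

lemma sign_expand:
  assumes "U1 * X1 - A1 * B1 + \<epsilon> * (M1 * N1) = 0" "U2 * X2 - A2 * B2 + \<epsilon> * (M2 * N2) = 0"
    "U3 * X3 - A3 * B3 + \<epsilon> * (M3 * N3) = 0"
  shows "s1 * (U2 * X3 + U3 * X2 - A2 * B3 - A3 * B2 + \<epsilon> * (M2 * N3 + M3 * N2)) +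
     s2 * (U3 * X1 + U1 * X3 - A3 * B1 - A1 * B3 + \<epsilon> * (M3 * N1 + M1 * N3)) +
     s3 * (U1 * X2 + U2 * X1 - A1 * B2 - A2 * B1 + \<epsilon> * (M1 * N2 + M2 * N1)) =
   s1 * s2 * s3 * ((s1 * U1 + s2 * U2 + s3 * U3) * (s1 * X1 + s2 * X2 + s3 * X3)
     - (s1 * A1 + s2 * A2 + s3 * A3) * (s1 * B1 + s2 * B2 + s3 * B3)
     + \<epsilon> * ((s1 * M1 + s2 * M2 + s3 * M3) * (s1 * N1 + s2 * N2 + s3 * N3)))" (is "?L = ?R")
proof -
  have "?R = ?L + s1 * s2 * s3 * ((U1 * X1 - A1 * B1 + \<epsilon> * (M1 * N1)) +
    (U2 * X2 - A2 * B2 + \<epsilon> * (M2 * N2)) + (U3 * X3 - A3 * B3 + \<epsilon> * (M3 * N3)))"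
    using sign by (elim disjE) (simp_all add: algebra_simps)
  then show ?thesis by (simp add: assms)
qed

text \<open>Gray's constant type, polarised in the second argument. The components of a cross
  product are \<open>\<epsilon>\<close>-complex minors, so it is Lagrange's identity with the signs
  of the frame.\<close>

lemma constant_type:
  "g (cross u x) (cross u y) =
     kap * (g u u * g x y - g u x * g u y + \<epsilon> * (g u (j x) * g u (j y)))"
proof -
  obtain a1 b1 a2 b2 a3 b3 where u: "u = frame_vec a1 b1 a2 b2 a3 b3" by (rule frame_vecE)
  obtain c1 d1 c2 d2 c3 d3 where x: "x = frame_vec c1 d1 c2 d2 c3 d3" by (rule frame_vecE)
  obtain f1 h1 f2 h2 f3 h3 where y: "y = frame_vec f1 h1 f2 h2 f3 h3" by (rule frame_vecE)
  let ?P1 = "\<lambda>c1 d1 c2 d2 c3 d3. a2 * c3 - a3 * c2 + \<epsilon> * (b2 * d3 - b3 * d2)"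
  let ?Q1 = "\<lambda>c1 d1 c2 d2 c3 d3. a2 * d3 + b2 * c3 - a3 * d2 - b3 * c2"
  let ?P2 = "\<lambda>c1 d1 c2 d2 c3 d3. a3 * c1 - a1 * c3 + \<epsilon> * (b3 * d1 - b1 * d3)"
  let ?Q2 = "\<lambda>c1 d1 c2 d2 c3 d3. a3 * d1 + b3 * c1 - a1 * d3 - b1 * c3"
  let ?P3 = "\<lambda>c1 d1 c2 d2 c3 d3. a1 * c2 - a2 * c1 + \<epsilon> * (b1 * d2 - b2 * d1)"
  let ?Q3 = "\<lambda>c1 d1 c2 d2 c3 d3. a1 * d2 + b1 * c2 - a2 * d1 - b2 * c1"
  let ?D = "g u u * g x y - g u x * g u y + \<epsilon> * (g u (j x) * g u (j y))"
  have "s1 * (?P1 c1 d1 c2 d2 c3 d3 * ?P1 f1 h1 f2 h2 f3 h3 - \<epsilon> * (?Q1 c1 d1 c2 d2 c3 d3 * ?Q1 f1 h1 f2 h2 f3 h3))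
    + s2 * (?P2 c1 d1 c2 d2 c3 d3 * ?P2 f1 h1 f2 h2 f3 h3 - \<epsilon> * (?Q2 c1 d1 c2 d2 c3 d3 * ?Q2 f1 h1 f2 h2 f3 h3))
    + s3 * (?P3 c1 d1 c2 d2 c3 d3 * ?P3 f1 h1 f2 h2 f3 h3 - \<epsilon> * (?Q3 c1 d1 c2 d2 c3 d3 * ?Q3 f1 h1 f2 h2 f3 h3))
    = s1 * s2 * s3 * ?D"
    unfolding u x y j_frame_vec g_frame_vec constant_type_pair
    by (rule sign_expand) (rule constant_type_single)+
  note core = this
  have "g (cross u x) (cross u y) = (al\<^sup>2 - \<epsilon> * be\<^sup>2) * (s1 * (?P1 c1 d1 c2 d2 c3 d3 * ?P1 f1 h1 f2 h2 f3 h3 - \<epsilon> * (?Q1 c1 d1 c2 d2 c3 d3 * ?Q1 f1 h1 f2 h2 f3 h3))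
    + s2 * (?P2 c1 d1 c2 d2 c3 d3 * ?P2 f1 h1 f2 h2 f3 h3 - \<epsilon> * (?Q2 c1 d1 c2 d2 c3 d3 * ?Q2 f1 h1 f2 h2 f3 h3))
    + s3 * (?P3 c1 d1 c2 d2 c3 d3 * ?P3 f1 h1 f2 h2 f3 h3 - \<epsilon> * (?Q3 c1 d1 c2 d2 c3 d3 * ?Q3 f1 h1 f2 h2 f3 h3)))"
    unfolding g_cross_trace frame_trace_def u x y form_frame_vec cross_product_norm by (simp only: distrib_left)
  then have "g (cross u x) (cross u y) = (al\<^sup>2 - \<epsilon> * be\<^sup>2) * (s1 * s2 * s3 * ?D)"
    by (simp only: core)
  then show ?thesis by (simp add: kap_def algebra_simps)
qed

text \<open>Skewness moves one factor to the other side of \<open>g\<close>, where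
  \<open>constant_type\<close> applies. For \<open>kap \<noteq> 0\<close> and non-null
  \<open>u\<close>, this inverts \<open>cross u\<close> on the complement of \<open>u\<close> and
  \<open>j u\<close>.\<close>

lemma cross_cross:
  "cross u (cross u y) = - kap *\<^sub>R (g u u *\<^sub>R y - g u y *\<^sub>R u - (\<epsilon> * g u (j y)) *\<^sub>R j u)"
proof (rule g_eqI)
  fix x
  have "g (cross u (cross u y)) x = - g (cross u x) (cross u y)"
    using g_cross[of x u "cross u y"] g_cross[of "cross u y" u x] skew23[of u x "cross u y"]
    by (simp add: g_sym[of _ x] g_sym[of _ "cross u y"])
  then show "g (cross u (cross u y)) x = g (- kap *\<^sub>R (g u u *\<^sub>R y - g u y *\<^sub>R u - (\<epsilon> * g u (j y)) *\<^sub>R j u)) x"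
    unfolding constant_type by (simp add: g_sym[of y x] g_j_left algebra_simps)
qed

lemma cross_add1: "cross (u + u') v = cross u v + cross u' v"
proof (rule g_eqI)
  fix x show "g (cross (u + u') v) x = g (cross u v + cross u' v) x"
    using g_cross[of x "u + u'" v] g_cross[of x u v] g_cross[of x u' v] by (simp add: g_sym[of _ x])
qed

lemma cross_minus2: "cross u (- v) = - cross u v"
proof (rule g_eqI)
  fix x show "g (cross u (- v)) x = g (- cross u v) x"
    using g_cross[of x u "- v"] g_cross[of x u v] by (simp add: g_sym[of _ x])
qed

lemma cross_zero2: "cross v 0 = 0"
proof (rule g_eqI)
  fix x show "g (cross v 0) x = g 0 x" using g_cross[of x v 0] by (simp add: g_sym[of _ x])
qed

text \<open>The source of strictness. By \<open>cross_cross\<close>,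
  \<open>g v v *\<^sub>R u\<close> lies in the span of \<open>v\<close> and \<open>j v\<close> for
  every \<open>v\<close>: \<open>v = e1\<close> makes \<open>u\<close> orthogonal to
  \<open>e2\<close> and \<open>j e2\<close>, and then \<open>v = e2\<close> gives zero.\<close>

lemma cross_eq_0:
  assumes kap: "kap \<noteq> 0" and 0: "\<And>v. cross u v = 0"
  shows "u = 0"
proof -
  have "cross v u = 0" for v using 0[of v] cross_skew[of v u] by simp
  then have "kap *\<^sub>R (g v v *\<^sub>R u - g v u *\<^sub>R v - (\<epsilon> * g v (j u)) *\<^sub>R j v) = 0" for v
    using cross_cross[of v u] cross_zero2[of v] by simp
  then have "g v v *\<^sub>R u - g v u *\<^sub>R v - (\<epsilon> * g v (j u)) *\<^sub>R j v = 0" for v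
    using kap by (metis scaleR_eq_0_iff)
  then have e: "g v v *\<^sub>R u = g v u *\<^sub>R v + (\<epsilon> * g v (j u)) *\<^sub>R j v" for v
    by (simp add: diff_diff_eq)
  have "s1 * g u e2 = 0" "s1 * g u (j e2) = 0"
    using arg_cong[OF e[of e1], of "\<lambda>x. g x e2"] arg_cong[OF e[of e1], of "\<lambda>x. g x (j e2)"]
    by (simp_all add: norm orth g_j_left)
  then have "g e2 u = 0" "g e2 (j u) = 0" using g_sym[of e2 u] g_j_skew[of e2 u] by auto
  then show ?thesis using e[of e2] by (simp add: norm)
qed

end

section \<open>The first covariant derivatives of \<open>J\<close> and \<open>\<psi>\<^sup>+\<close> at a point\<close>

definition alt4 :: "('v \<Rightarrow> 'v \<Rightarrow> 'v \<Rightarrow> 'v \<Rightarrow> real) \<Rightarrow> 'v \<Rightarrow> 'v \<Rightarrow> 'v \<Rightarrow> 'v \<Rightarrow> real" where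
  "alt4 B u v w z = B u v w z - B v u w z + B w u v z - B z u v w"

text \<open>Any four of the six vectors of an adapted frame contain a pair \<open>e, j e\<close>.\<close>

lemma (in hermitian_frame) four_form_eq_0:
  assumes lin: "\<And>v w z. linear (\<lambda>u. F u v w z)"
    and skew: "\<And>u v w z. F u v w z = - F v u w z" "\<And>u v w z. F u v w z = - F u w v z"
      "\<And>u v w z. F u v w z = - F u v z w"
    and 0: "\<And>u w z. F u (j u) w z = 0"
  shows "F u v w z = (0 :: real)"
proof -
  have lin2: "linear (\<lambda>v. F u v w z)" for u w z
    using linear_compose_neg[OF lin[of u w z]] skew(1)[of u _ w z] by (metis (no_types, lifting) ext)
  have lin3: "linear (\<lambda>w. F u v w z)" for u v z
    using linear_compose_neg[OF lin2[of u v z]] skew(2)[of u v _ z] by (metis (no_types, lifting) ext)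
  have lin4: "linear (\<lambda>z. F u v w z)" for u v w
    using linear_compose_neg[OF lin3[of u v w]] skew(3)[of u v w] by (metis (no_types, lifting) ext)
  \<comment> \<open>Polarising the hypothesis lets \<open>j\<close> pass between neighbouring slots,
    so it can always be brought to the first one.\<close>
  have p1: "F u (j v) w z = F (j u) v w z" for u v w z
    using 0[of "u + v" w z] 0[of u w z] 0[of v w z] skew(1)[of v "j u" w z]
    by (simp add: linear_add[OF lin] linear_add[OF lin2])
  have p2: "F u v (j w) z = F u (j v) w z" for u v w z
    using p1[of v w u z] skew by metis
  have p3: "F u v w (j z) = F u v (j w) z" for u v w z
    using p2[of u w z v] skew by metis
  have s: "F u u w z = 0" "F u v v z = 0" "F u v w w = 0" "F u v u z = 0" "F u v w v = 0" "F u v w u = 0" for u v w z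
    using skew(1)[of u u w z] skew(2)[of u v v z] skew(3)[of u v w w] skew(1)[of u v u z] skew(2)[of v u u z]
      skew(3)[of u v w v] skew(2)[of u v v w] skew(3)[of u v w u] skew(2)[of u v u w] skew(1)[of u u v w]
    by linarith+
  have js: "F (j u) u w z = 0" "F (j u) w u z = 0" "F (j u) w z u = 0" for u w z
    using 0[of u] skew(1)[of u "j u"] skew(2)[of "j u" w u z] skew(3)[of "j u" w z u] skew(2)[of "j u" w u] by (metis neg_0_equal_iff_equal)+
  define E where "E = {e1, e2, e3}"
  \<comment> \<open>Four slots carry only three frame indices, so one repeats. The next lines free
    the remaining slots one at a time, always shifting \<open>j\<close> to the first slot.\<close>
  have a: "F X k l m = 0" if "k \<in> E" "l \<in> E" "m \<in> E" for X k l m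
    by (rule linear_frame_0[OF lin]) (use that in \<open>auto simp: E_def s js\<close>)
  have b: "F X k l z = 0" if "k \<in> E" "l \<in> E" for X k l z
    by (rule linear_frame_0[OF lin4]) (use that in \<open>auto simp: a E_def p1 p2 p3\<close>)
  have c: "F X k w z = 0" if "k \<in> E" for X k w z
    by (rule linear_frame_0[OF lin3]) (use that in \<open>auto simp: b E_def p1 p2 p3\<close>)
  have d: "F X v w z = 0" for X v w z
    by (rule linear_frame_0[OF lin2]) (auto simp: c E_def p1 p2 p3)
  show ?thesis by (rule d)
qed

text \<open>This is the derivative along \<open>a\<close> of \<open>\<psi> v (j v) w = 0\<close>,
  which follows from type and skewness. It is kept general in order to serve both psi^+ and
  psi^-.\<close>

lemma jet_pair:
  fixes B :: "'v \<Rightarrow> 'v \<Rightarrow> 'v \<Rightarrow> 'v \<Rightarrow> real"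
  assumes "\<And>u v w. \<psi> u v w = - \<psi> v u w" "\<And>u v w. B a u v w = - B a v u w"
    and "\<And>u v w. B a (j u) v w + \<psi> (J' a u) v w = B a u (j v) w + \<psi> u (J' a v) w"
  shows "B a v (j v) w = - \<psi> v (J' a v) w"
  using assms(3)[of v v w] assms(1)[of "J' a v" v w] assms(2)[of "j v" v w] by linarith

text \<open>\<open>J' a\<close> and \<open>B a\<close> stand for \<open>\<nabla>\<^sub>a J\<close> and \<open>\<nabla>\<^sub>a \<psi>\<^sup>+\<close>; below, \<open>\<phi>\<close> is \<open>\<psi>\<^sup>-\<close> and \<open>C a\<close> is
  \<open>\<nabla>\<^sub>a \<psi>\<^sup>-\<close>. As the connection is torsion-free, \<open>alt4\<close> turns them into \<open>d\<psi>\<^sup>+\<close> and \<open>d\<psi>\<^sup>-\<close>.\<close>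

locale form_jet = form30_frame g j \<epsilon> e1 e2 e3 s1 s2 s3 \<psi>
  for g :: "'v::euclidean_space \<Rightarrow> 'v \<Rightarrow> real" and j \<epsilon> e1 e2 e3 s1 s2 s3 \<psi> +
  fixes J' :: "'v \<Rightarrow> 'v \<Rightarrow> 'v" and B :: "'v \<Rightarrow> 'v \<Rightarrow> 'v \<Rightarrow> 'v \<Rightarrow> real"
  assumes J'_linear: "linear (\<lambda>a. J' a u)" "linear (J' a)"
    and J'_j: "J' a (j u) = - j (J' a u)"
    and J'_skew: "g u (J' a v) = - g v (J' a u)"
    and B_linear: "linear (\<lambda>a. B a u v w)" "linear (\<lambda>u. B a u v w)"
    and B_skew: "B a u v w = - B a v u w" "B a u v w = - B a u w v"
    and B_j: "B a (j u) v w + \<psi> (J' a u) v w = B a u (j v) w + \<psi> u (J' a v) w"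
    and closed: "alt4 B u v w z = 0"
begin

definition \<phi> :: "'v \<Rightarrow> 'v \<Rightarrow> 'v \<Rightarrow> real" where "\<phi> u v w = \<epsilon> * \<psi> (j u) v w"

definition C :: "'v \<Rightarrow> 'v \<Rightarrow> 'v \<Rightarrow> 'v \<Rightarrow> real" where
  "C a u v w = \<epsilon> * (B a (j u) v w + \<psi> (J' a u) v w)"

text \<open>\<open>\<omega> \<and> \<omega>\<close>, whose six terms coincide in pairs.\<close>

definition W :: "'v \<Rightarrow> 'v \<Rightarrow> 'v \<Rightarrow> 'v \<Rightarrow> real" where
  "W u v w z = 2 * (g u (j v) * g w (j z) - g u (j w) * g v (j z) + g u (j z) * g v (j w))"

lemma B_linear3: "linear (\<lambda>v. B a u v w)"
  using linear_compose_neg[OF B_linear(2)[of a u w]] B_skew(1)[of a u _ w] by (metis (no_types, lifting) ext)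

lemma B_scale: "B a (r *\<^sub>R u) v w = r * B a u v w" "B a u (r *\<^sub>R v) w = r * B a u v w"
  using linear_cmul[OF B_linear(2)] linear_cmul[OF B_linear3] by auto

lemma C_linear: "linear (\<lambda>a. C a u v w)" "linear (\<lambda>u. C a u v w)"
proof -
  have m: "linear (\<lambda>x. \<epsilon> * (f x + h x))" if "linear f" "linear h" for f h :: "'v \<Rightarrow> real"
    using linear_compose_scale_right[OF linear_compose_add[OF that], of \<epsilon>] by simp
  show "linear (\<lambda>a. C a u v w)"
    unfolding C_def
    by (intro m B_linear linear_compose[OF J'_linear(1) linear_form, unfolded o_def])
  show "linear (\<lambda>u. C a u v w)"
    unfolding C_def
    by (intro m linear_compose[OF linear_j B_linear(2), unfolded o_def]
        linear_compose[OF J'_linear(2) linear_form, unfolded o_def])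
qed

text \<open>The definition puts \<open>j\<close> into the first slot and so hides the skewness in
  the first two; the differentiated type condition \<open>B_j\<close> moves it across.\<close>

lemma C_skew: "C a u v w = - C a v u w" "C a u v w = - C a u w v"
proof -
  have "C a u v w = \<epsilon> * (B a u (j v) w + \<psi> u (J' a v) w)" by (simp only: C_def B_j)
  also have "\<dots> = \<epsilon> * (- B a (j v) u w + - \<psi> (J' a v) u w)"
    by (simp only: B_skew(1)[of a u "j v" w] skew12[of u "J' a v" w])
  also have "\<dots> = - C a v u w" unfolding C_def by argo
  finally show "C a u v w = - C a v u w" .
  have "C a u v w = \<epsilon> * (- B a (j u) w v + - \<psi> (J' a u) w v)"
    by (simp only: C_def B_skew(2)[of a "j u" v w] skew23[of "J' a u" v w])
  also have "\<dots> = - C a u w v" unfolding C_def by argo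
  finally show "C a u v w = - C a u w v" .
qed

lemma phi_skew: "\<phi> u v w = - \<phi> v u w" "\<phi> u v w = - \<phi> u w v"
  using skew12[of "j u" v w] skew23[of "j u" v w] by (simp_all add: \<phi>_def form_j2)

text \<open>The derivative of \<open>\<phi> (j u) v w = \<psi> u v w\<close>. Through it psi^-
  inherits the differentiated type condition, and \<open>jet_pair\<close> applies to it as
  well.\<close>

lemma C_j1: "C a (j u) v w + \<phi> (J' a u) v w = B a u v w"
  by (simp add: C_def \<phi>_def J'_j B_scale algebra_simps)

lemma C_j: "C a (j u) v w + \<phi> (J' a u) v w = C a u (j v) w + \<phi> u (J' a v) w"
  using C_j1[of a u v w] C_j1[of a v u w] C_skew(1)[of a u "j v" w] phi_skew(1)[of u "J' a v" w] B_skew(1)[of a u v w]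
  by linarith

lemma B_pair: "B a v (j v) w = - \<psi> v (J' a v) w"
  by (rule jet_pair[where \<psi> = \<psi> and B = B and J' = J' and j = j, OF skew12 B_skew(1) B_j])

lemma C_pair: "C a v (j v) w = - \<phi> v (J' a v) w"
  by (rule jet_pair[where \<psi> = \<phi> and B = C and J' = J' and j = j, OF phi_skew(1) C_skew(1) C_j])

lemma W_linear: "linear (\<lambda>u. W u v w z)"
  unfolding W_def by (rule linearI) (simp_all add: algebra_simps)

lemma W_skew: "W u v w z = - W v u w z" "W u v w z = - W u w v z" "W u v w z = - W u v z w"
  unfolding W_def using g_j_skew[of u v] g_j_skew[of v w] g_j_skew[of w z]
  by (simp_all add: algebra_simps)

lemma alt4_C_linear: "linear (\<lambda>u. alt4 C u v w z)"
  unfolding alt4_def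
  by (intro linear_compose_add linear_compose_sub C_linear)

lemma alt4_C_skew:
  "alt4 C u v w z = - alt4 C v u w z" "alt4 C u v w z = - alt4 C u w v z" "alt4 C u v w z = - alt4 C u v z w"
  unfolding alt4_def
  using C_skew(1)[of w u v z] C_skew(1)[of z u v w] C_skew(1)[of u v w z] C_skew(2)[of z u v w]
    C_skew(2)[of u v w z] C_skew(2)[of v u w z]
  by linarith+

text \<open>Closedness, evaluated on \<open>(u, j u, j x, y)\<close>, eliminates \<open>B\<close> from \<open>alt4 C u (j u) x y\<close>, which then
  becomes \<open>4 \<epsilon> g(J'\<^sub>u x, J'\<^sub>u (j y))\<close>; \<open>constant_type\<close> applies to it.\<close>

theorem alt4_C_eq:
  assumes J': "\<And>a v w. g v (J' a w) = \<psi> a v w"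
  shows "alt4 C u v w z = 2 * kap * W u v w z"
proof -
  have J'_cross: "J' a w = cross a w" for a w
    by (rule g_eqI) (metis J' g_cross g_sym)
  have cross_same: "cross a a = 0" for a
  proof -
    have "2 *\<^sub>R cross a a = 0" using cross_skew[of a a] by (simp add: scaleR_2 eq_neg_iff_add_eq_0)
    then show ?thesis by simp
  qed
  have pair: "alt4 C u (j u) x y = 2 * kap * W u (j u) x y" for u x y
  proof -
    \<comment> \<open>Derivatives along \<open>x\<close> and \<open>y\<close> meet the pair
      \<open>u\<close>, \<open>j u\<close> and reduce to \<open>X\<close> and \<open>Y\<close>.
      Those along \<open>u\<close> and \<open>j u\<close> stay unknown, but closedness determines
      the one combination that occurs.\<close>
    define X where "X = \<psi> (j u) (cross u x) y"
    define Y where "Y = \<psi> (j u) (cross u y) x"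
    have cr: "cross u (j u) = 0" "cross (j u) u = 0" by (simp_all add: cross_j1 cross_j2 cross_same)
    have t1: "C u (j u) x y = B u u x y"
      by (simp add: C_def J'_cross cr B_scale)
    have t2: "C (j u) u x y = \<epsilon> * B (j u) (j u) x y"
      by (simp add: C_def J'_cross cr)
    have t3: "C x u (j u) y = \<epsilon> * X"
      using cross_skew[of x u] by (simp add: C_pair J'_cross \<phi>_def X_def)
    have t4: "C y u (j u) x = \<epsilon> * Y"
      using cross_skew[of y u] by (simp add: C_pair J'_cross \<phi>_def Y_def)
    have b1: "B u (j u) (j x) y = \<epsilon> * B u u x y - X"
      using B_j[of u u "j x" y] by (simp add: J'_cross B_scale cross_j2 cross_same form_j2 X_def)
    have b2: "B (j u) u (j x) y = B (j u) (j u) x y + X"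
      using B_j[of "j u" u x y] by (simp add: J'_cross cross_same cross_j1 form_j2 X_def)
    have b3: "B (j x) u (j u) y = - X"
      using cross_skew[of x u] by (simp add: B_pair J'_cross cross_j1 form_j2 X_def)
    have b4: "B y u (j u) (j x) = Y"
      using cross_skew[of y u] by (simp add: B_pair J'_cross form_j3 Y_def)
    have "\<epsilon> * B u u x y - B (j u) (j u) x y = 3 * X + Y"
      using closed[of u "j u" "j x" y] unfolding alt4_def b1 b2 b3 b4 by simp
    then have "\<epsilon> * (\<epsilon> * B u u x y - B (j u) (j u) x y) = \<epsilon> * (3 * X + Y)" by simp
    then have "B u u x y - \<epsilon> * B (j u) (j u) x y = \<epsilon> * (3 * X + Y)" by (simp add: right_diff_distrib)
    then have "alt4 C u (j u) x y = 4 * \<epsilon> * X"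
      unfolding alt4_def t1 t2 t3 t4 by (simp add: algebra_simps)
    moreover have "X = g (cross u x) (cross u (j y))"
      using g_cross[of "cross u x" "j u" y] by (simp add: X_def cross_j1 cross_j2)
    ultimately show ?thesis
      unfolding constant_type W_def using g_sym[of u y]
      by (simp add: g_j_left algebra_simps)
  qed
  have "alt4 C u v w z - 2 * kap * W u v w z = 0"
  proof (rule four_form_eq_0[of "\<lambda>u v w z. alt4 C u v w z - 2 * kap * W u v w z"])
    show "linear (\<lambda>u. alt4 C u v w z - 2 * kap * W u v w z)" for v w z
      using linear_compose_sub[OF alt4_C_linear linear_compose_scale_right[OF W_linear, of "2 * kap"]] by simp
    fix u v w z
    show "alt4 C u v w z - 2 * kap * W u v w z = - (alt4 C v u w z - 2 * kap * W v u w z)"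
      using alt4_C_skew(1)[of u v w z] W_skew(1)[of u v w z] by (simp add: algebra_simps)
    show "alt4 C u v w z - 2 * kap * W u v w z = - (alt4 C u w v z - 2 * kap * W u w v z)"
      using alt4_C_skew(2)[of u v w z] W_skew(2)[of u v w z] by (simp add: algebra_simps)
    show "alt4 C u v w z - 2 * kap * W u v w z = - (alt4 C u v z w - 2 * kap * W u v z w)"
      using alt4_C_skew(3)[of u v w z] W_skew(3)[of u v w z] by (simp add: algebra_simps)
    show "alt4 C u (j u) w z - 2 * kap * W u (j u) w z = 0" by (simp add: pair)
  qed
  then show ?thesis by simp
qed


text \<open>Each of the four terms contains the pair of \<open>u\<close> or of \<open>v\<close>, so
  \<open>pair\<close> eliminates every derivative of the form; by \<open>J'_j1\<close> the terms
  along \<open>j u\<close> and \<open>j v\<close> repeat those along \<open>u\<close> and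
  \<open>v\<close>, whence the factors 2.\<close>

lemma alt4_pair:
  assumes B': "\<And>a u v w. B' a u v w = - B' a v u w" "\<And>a u v w. B' a u v w = - B' a u w v"
    and pair: "\<And>a v w. B' a v (j v) w = - \<psi>' v (J' a v) w"
    and lin: "\<And>u v w. \<psi>' u (- v) w = - \<psi>' u v w" and move: "\<And>u v w. \<psi>' u (j v) w = \<psi>' u v (j w)"
    and J'_j1: "\<And>a w. J' (j a) w = - j (J' a w)"
  shows "alt4 B' u (j u) v (j v) = - 2 * \<psi>' v (J' u v) (j u) - 2 * \<psi>' u (J' v u) (j v)"
proof -
  have r: "B' a p x q = B' a x q p" for a p x q
    using B'(1)[of a p x q] B'(2)[of a x p q] by linarith
  have "B' u (j u) v (j v) = - \<psi>' v (J' u v) (j u)" by (simp add: r[of u "j u"] pair)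
  moreover have "B' (j u) u v (j v) = \<psi>' v (J' u v) (j u)" by (simp add: r[of "j u" u] pair J'_j1 lin move)
  moreover have "B' v u (j u) (j v) = - \<psi>' u (J' v u) (j v)" by (simp add: pair)
  moreover have "B' (j v) u (j u) v = \<psi>' u (J' v u) (j v)" by (simp add: pair J'_j1 lin move)
  ultimately show ?thesis by (simp add: alt4_def)
qed

text \<open>\<open>S = \<nabla>\<omega> - \<psi>\<^sup>+\<close> has vanishing cyclic sum, hence no component outside the Gray-Hervella class
  \<open>W\<^sub>2\<close>. On \<open>(u, j u, v, j v)\<close> neither \<open>d\<psi>\<^sup>+\<close> nor \<open>d\<psi>\<^sup>-\<close> involves second derivatives, and the two
  equations determine \<open>S\<close>.\<close>

theorem J'_alternating:
  assumes cyc: "\<And>u v w. g v (J' u w) + g w (J' v u) + g u (J' w v) = 3 * \<psi> u v w"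
    and eq: "\<And>u v w z. alt4 C u v w z = 2 * k * W u v w z" and kap: "kap \<noteq> 0"
  shows "J' a a = 0"
proof -
  define S where "S a v w = g v (J' a w) - \<psi> a v w" for a v w
  have S_lin1: "linear (\<lambda>a. S a v w)" for v w
    unfolding S_def by (intro linear_compose_sub linear_form linear_compose[OF J'_linear(1) linear_g(1), unfolded o_def])
  have S_lin2: "linear (\<lambda>v. S a v w)" for a w
    unfolding S_def by (intro linear_compose_sub linear_form2 linear_g)
  have S_skew: "S a v w = - S a w v" for a v w
    using J'_skew[of v a w] skew23[of a v w] by (simp add: S_def)
  have S_lin3: "linear (S a v)" for a v
    unfolding S_def by (intro linear_compose_sub linear_form3 linear_compose[OF J'_linear(2) linear_g(1), unfolded o_def])
  have S_j: "S a (j v) w = S a v (j w)" for a v w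
    by (simp add: S_def J'_j g_j_left form_j2 form_j3)
  have S_cyc: "S u v w + S v w u + S w u v = 0" for u v w
    using cyc[of v u w] skew12[of u v w] skew23[of v u w] skew12[of w u v] skew23[of u w v]
    by (simp add: S_def)
  have S_jj: "S a (\<epsilon> *\<^sub>R v) w = \<epsilon> * S a v w" "S a v (\<epsilon> *\<^sub>R w) = \<epsilon> * S a v w" for a v w
    using linear_cmul[OF S_lin2] linear_cmul[OF S_lin3] by auto
  \<comment> \<open>Among the four cyclic sums below, adding 1 and 3 and subtracting 2 and 4
    isolates the claim.\<close>
  have S_j_j: "S (j u) (j v) w = \<epsilon> * S u v w" for u v w
  proof -
    have 1: "S (j u) (j v) w + S (j v) (j w) u + \<epsilon> * S w u v = 0"
      using S_cyc[of "j u" "j v" w] by (simp add: S_j S_jj)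
    have 2: "\<epsilon> * S u v w + S (j v) (j w) u + S (j w) (j u) v = 0"
      using S_cyc[of u "j v" "j w"] by (simp add: S_j S_jj)
    have 3: "S (j u) (j v) w + \<epsilon> * S v w u + S (j w) (j u) v = 0"
      using S_cyc[of "j u" v "j w"] by (simp add: S_j S_jj)
    have 4: "\<epsilon> * S u v w + \<epsilon> * S v w u + \<epsilon> * S w u v = 0"
      using S_cyc[of u v w] by (metis distrib_left mult_zero_right)
    from 1 2 3 4 show ?thesis by linarith
  qed
  have S_j1: "S (j u) v w = S u (j v) w" for u v w
  proof -
    have "\<epsilon> * S (j u) v w = \<epsilon> * S u (j v) w" using S_j_j[of u "j v" w] by (simp add: S_jj)
    then show ?thesis by simp
  qed
  have J'_j1: "J' (j u) w = - j (J' u w)" for u w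
  proof (rule g_eqI)
    fix v
    have "g v (J' (j u) w) = g (j v) (J' u w)"
      using S_j1[of u v w] by (simp add: S_def form_j2)
    then show "g (J' (j u) w) v = g (- j (J' u w)) v"
      by (simp add: g_sym[of _ v] g_j_left)
  qed
  \<comment> \<open>The cyclic sum trades the antisymmetrised derivative of \<open>J\<close> for
    \<open>S\<close> with the test vector \<open>m\<close> in front.\<close>
  have diff: "g (J' u v) m - g (J' v u) m = S m u v + 2 * g m (cross u v)" for u v m
    using S_cyc[of u v m] S_skew[of u v m] g_cross[of m u v] g_cross[of m v u] cross_skew[of v u]
    by (simp add: S_def g_sym[of _ m])
  \<comment> \<open>The consequence of d psi^+ = 0. Testing against \<open>j (cross u v)\<close>
    removes the term in \<open>cross u v\<close>, which is orthogonal to its own image under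
    \<open>j\<close>.\<close>
  have K: "S (j (cross u v)) u v = 0" for u v
  proof -
    have "alt4 B u (j u) v (j v) = - 2 * \<psi> v (J' u v) (j u) - 2 * \<psi> u (J' v u) (j v)"
      by (rule alt4_pair[where B' = B and \<psi>' = \<psi>, OF B_skew B_pair _ _ J'_j1]) (simp_all add: form_j2 form_j3)
    moreover have "\<psi> v (J' u v) (j u) = g (J' u v) (j (cross u v))"
      using g_cross[of "J' u v" v "j u"] cross_skew[of v u] by (simp add: cross_j2)
    moreover have "\<psi> u (J' v u) (j v) = - g (J' v u) (j (cross u v))"
      using g_cross[of "J' v u" u "j v"] by (simp add: cross_j2)
    ultimately show ?thesis using diff[of u v "j (cross u v)"] closed by simp
  qed
  define D where "D u u' v = g u u' * g v v - g u v * g u' v + \<epsilon> * (g u (j v) * g u' (j v))" for u u' v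
  \<comment> \<open>The consequence of the equation for d psi^-. Here the test vector is
    \<open>cross u v\<close> itself, whose norm is \<open>kap\<close> times \<open>D\<close> by
    constant type, so only the difference \<open>k - kap\<close> survives.\<close>
  have H: "S (cross u v) u v = 2 * (k - kap) * D u u v" for u v
  proof -
    have "alt4 C u (j u) v (j v) = - 2 * \<phi> v (J' u v) (j u) - 2 * \<phi> u (J' v u) (j v)"
      by (rule alt4_pair[where B' = C and \<psi>' = \<phi>, OF C_skew C_pair _ _ J'_j1]) (simp_all add: \<phi>_def form_j2 form_j3)
    moreover have "\<phi> v (J' u v) (j u) = - g (J' u v) (cross u v)"
      using g_cross[of "J' u v" v u] cross_skew[of v u] by (simp add: \<phi>_def form_j3)
    moreover have "\<phi> u (J' v u) (j v) = g (J' v u) (cross u v)"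
      using g_cross[of "J' v u" u v] by (simp add: \<phi>_def form_j3)
    ultimately have "2 * (g (J' u v) (cross u v) - g (J' v u) (cross u v)) = 2 * k * W u (j u) v (j v)"
      using eq[of u "j u" v "j v"] by simp
    moreover have "W u (j u) v (j v) = 2 * D u u v"
      by (simp add: W_def D_def g_j_left algebra_simps)
    moreover have "g (cross u v) (cross u v) = kap * D u u v"
      unfolding constant_type D_def by (simp add: algebra_simps)
    ultimately show ?thesis unfolding diff by (simp add: algebra_simps)
  qed
  have Hp: "S (cross u v) u' v + S (cross u' v) u v = 4 * (k - kap) * D u u' v" for u u' v
  proof -
    have "S (cross (u + u') v) (u + u') v = S (cross u v) u v + S (cross u' v) u' v + (S (cross u v) u' v + S (cross u' v) u v)"
      by (simp add: cross_add1 linear_add[OF S_lin1] linear_add[OF S_lin2])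
    moreover have "D (u + u') (u + u') v = D u u v + D u' u' v + 2 * D u u' v"
      using g_sym[of u' u] by (simp add: D_def algebra_simps)
    ultimately show ?thesis using H[of u v] H[of u' v] H[of "u + u'" v] by (simp add: algebra_simps)
  qed
  have Kp: "S (j (cross u v)) u' v + S (j (cross u' v)) u v = 0" for u u' v
    using K[of u v] K[of u' v] K[of "u + u'" v]
    by (simp add: cross_add1 linear_add[OF S_lin1] linear_add[OF S_lin2])
  \<comment> \<open>\<open>Hp\<close> with \<open>j u'\<close> in place of \<open>u'\<close> gives
    the difference of two mixed values, \<open>Kp\<close> gives their sum.\<close>
  have Sj: "S (j (cross u v)) u' v = 2 * (k - kap) * D u (j u') v" for u u' v
  proof -
    define d where "d = (k - kap) * D u (j u') v"
    have "S (j (cross u v)) u' v - S (j (cross u' v)) u v = 4 * d"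
      using Hp[of u v "j u'"] by (simp add: cross_j1 linear_neg[OF S_lin1] S_j1 d_def)
    then have "S (j (cross u v)) u' v = 2 * d" using Kp[of u v u'] by linarith
    then show ?thesis by (simp add: d_def)
  qed
  have main: "S (cross u v) u' v = 2 * (k - kap) * D u u' v" for u u' v
  proof -
    have "D (j u) (j u') v = - \<epsilon> * D u u' v" by (simp add: D_def g_j_left algebra_simps)
    then have "- (\<epsilon> * S (cross u v) u' v) = - (\<epsilon> * (2 * (k - kap) * D u u' v))"
      using Sj[of "j u" v u'] by (simp add: cross_j1 linear_neg[OF S_lin1] linear_cmul[OF S_lin1])
    then show ?thesis by simp
  qed
  \<comment> \<open>On \<open>e1\<close>, \<open>e2\<close> and \<open>cross e1 e2\<close>,
    \<open>main\<close> makes the three terms of the cyclic sum equal, so each of them is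
    zero.\<close>
  have "k = kap"
  proof -
    define w where "w = cross e1 e2"
    have w0: "g e1 w = 0" "g e2 w = 0" "g e1 (j w) = 0" "g e2 (j w) = 0"
      using g_cross[of e1 e1 e2] g_cross[of e2 e1 e2] g_cross[of e1 e1 "j e2"] g_cross[of e2 e1 "j e2"]
      by (simp_all add: w_def cross_j2 form_j3)
    have w0': "g w e1 = 0" "g w (j e1) = 0" using w0 g_sym[of w e1] g_j_skew[of w e1] by auto
    have ww: "g w w = kap * (s1 * s2)" by (simp add: w_def constant_type norm orth)
    have c1: "cross e2 w = (kap * s2) *\<^sub>R e1"
      using cross_cross[of e2 e1] by (simp add: w_def cross_skew[of e1 e2] cross_minus2 norm orth orth_sym)
    have c2: "cross w e1 = (kap * s1) *\<^sub>R e2"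
      using cross_cross[of e1 e2] cross_skew[of w e1] by (simp add: w_def norm orth orth_sym)
    have "S w e1 e2 = 2 * (k - kap) * (s1 * s2)"
      using main[of e1 e2 e1] by (simp add: w_def D_def norm orth)
    moreover have "(kap * s2) * S e1 e2 w = (kap * s2) * (2 * (k - kap) * (s1 * s2))"
      using main[of e2 w e2] unfolding c1 by (simp add: linear_cmul[OF S_lin1] D_def norm w0 ww algebra_simps)
    moreover have "(kap * s1) * S e2 w e1 = (kap * s1) * (2 * (k - kap) * (s1 * s2))"
      using main[of w e1 w] unfolding c2 by (simp add: linear_cmul[OF S_lin1] D_def norm w0' ww algebra_simps)
    moreover have "S w e1 e2 + S e1 e2 w + S e2 w e1 = 0" using S_cyc[of w e1 e2] .
    ultimately have "(k - kap) * (s1 * s2) = 0" using kap by simp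
    then show ?thesis by simp
  qed
  with main have main0: "S (cross u v) u' v = 0" for u u' v by simp
  \<comment> \<open>For such \<open>x\<close>, \<open>cross_cross\<close> exhibits a non-zero
    multiple of \<open>x\<close> as some \<open>cross y v\<close>, to which \<open>main0\<close>
    applies.\<close>
  have perp: "S x u' v = 0" if "g v v \<noteq> 0" "g x v = 0" "g x (j v) = 0" for x u' v
  proof -
    have "cross (cross v x) v = (kap * g v v) *\<^sub>R x"
      using cross_cross[of v x] cross_skew[of "cross v x" v] that g_sym[of v x] g_j_skew[of v x] by simp
    then have "kap * g v v * S x u' v = 0" using main0[of "cross v x" v u'] by (simp add: linear_cmul[OF S_lin1])
    then show ?thesis using kap that by simp
  qed
  define E where "E = {e1, e2, e3}"
  have E: "g a a \<noteq> 0" "b \<in> E \<Longrightarrow> a \<noteq> b \<Longrightarrow> g a b = 0" "b \<in> E \<Longrightarrow> a \<noteq> b \<Longrightarrow> g a (j b) = 0" if "a \<in> E" for a b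
    using that by (auto simp: E_def norm orth orth_sym)
  have same: "S x a a = 0" "S x (j a) a = 0" for x a
    using S_skew[of x a a] S_skew[of x "j a" a] S_j[of x a a] by auto
  \<comment> \<open>\<open>perp\<close> leaves only the diagonal \<open>a = b\<close>. There the
    skewness of \<open>S\<close> moves another frame vector into the last slot, and
    \<open>perp\<close> applies again.\<close>
  have SE: "S a u' b = 0" if ab: "a \<in> E" "b \<in> E" for a b u'
  proof (cases "a = b")
    case False
    then show ?thesis using perp E ab by blast
  next
    case True
    have 1: "S a b' a = 0" if "b' \<in> E" for b'
      using perp[of b' a a] E(1)[OF that] E(2,3)[OF ab(1) that] S_skew[of a b' a] same by (cases "a = b'") auto
    have 2: "S a (j b') a = 0" if "b' \<in> E" for b'
      using perp[of b' a "j a"] E(1)[OF that] E(2,3)[OF ab(1) that] S_skew[of a "j b'" a] S_j[of a a b'] same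
      by (cases "a = b'") auto
    have "S a u' a = 0"
      by (rule linear_frame_0[OF S_lin2]) (use 1 2 in \<open>auto simp: E_def\<close>)
    then show ?thesis using True by simp
  qed
  have S1: "S x u' b = 0" if "b \<in> E" for x u' b
    by (rule linear_frame_0[OF S_lin1]) (use SE that in \<open>auto simp: E_def S_j1\<close>)
  have S0: "S x u' v = 0" for x u' v
    by (rule linear_frame_0[OF S_lin3]) (use S1 in \<open>auto simp: E_def S_j[symmetric]\<close>)
  show ?thesis
  proof (rule g_eqI)
    fix v show "g (J' a a) v = g 0 v" using S0[of a v a] by (simp add: S_def g_sym[of _ v])
  qed
qed

end

section \<open>Squared lengths\<close>

lemma linear_times:
  fixes f :: "'b::real_vector \<Rightarrow> real"
  assumes "linear f" shows "linear (\<lambda>x. r * f x)" "linear (\<lambda>x. f x * r)"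
  using linear_compose_scale_right[OF assms, of r] by (simp_all add: mult.commute)

context hermitian_frame begin

lemma bilinear_frame_trace:
  assumes "\<And>w. bilinear (\<lambda>x y. b x y w)"
  shows "bilinear (\<lambda>x y. frame_trace (b x y))"
proof -
  have "linear (\<lambda>x. b x y w)" "linear (\<lambda>y. b x y w)" for x y w using assms by (auto simp: bilinear_def)
  then show ?thesis
    unfolding bilinear_def frame_trace_def
    by (intro conjI allI linear_compose_add linear_compose_sub linear_times)
qed

lemma bilinear_mult:
  "linear f \<Longrightarrow> linear h \<Longrightarrow> bilinear (\<lambda>x y. f x * h y :: real)"
  unfolding bilinear_def by (auto intro: linear_times)

text \<open>In each single slot the square of \<open>T\<close> is the diagonal of a bilinear form,
  so frame independence can be applied slot by slot.\<close>

lemma triple_sum_trace: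
  fixes f :: "'n::finite \<Rightarrow> 'v"
  assumes f: "\<And>i. g (f i) (f i) = 1 \<or> g (f i) (f i) = - 1" "\<And>i k. i \<noteq> k \<Longrightarrow> g (f i) (f k) = 0"
    and n: "CARD('n) = DIM('v)"
    and T: "\<And>v w. linear (\<lambda>u. T u v w)" "\<And>u w. linear (\<lambda>v. T u v w)" "\<And>u v. linear (T u v)"
  shows "(\<Sum>i\<in>UNIV. \<Sum>k\<in>UNIV. \<Sum>l\<in>UNIV. g (f i) (f i) * g (f k) (f k) * g (f l) (f l) * (T (f i) (f k) (f l))\<^sup>2)
    = frame_trace (\<lambda>u. frame_trace (\<lambda>v. frame_trace (\<lambda>w. (T u v w)\<^sup>2)))" (is "?L = ?R")
proof -
  let ?g = "\<lambda>i. g (f i) (f i)"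
  have tr: "(\<Sum>i\<in>UNIV. ?g i * b (f i) (f i)) = frame_trace (\<lambda>x. b x x)" if "bilinear b" for b
    using frame_trace_independent[of f b] f n that by blast
  have 1: "(\<Sum>l\<in>UNIV. ?g l * (T u v (f l))\<^sup>2) = frame_trace (\<lambda>w. (T u v w)\<^sup>2)" for u v
    using tr[OF bilinear_mult[OF T(3) T(3)], of u v u v] by (simp add: power2_eq_square)
  have 2: "(\<Sum>k\<in>UNIV. ?g k * frame_trace (\<lambda>w. (T u (f k) w)\<^sup>2)) = frame_trace (\<lambda>v. frame_trace (\<lambda>w. (T u v w)\<^sup>2))" for u
    using tr[OF bilinear_frame_trace[of "\<lambda>x y w. T u x w * T u y w", OF bilinear_mult[OF T(2) T(2)]]]
    by (simp add: power2_eq_square)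
  have 3: "(\<Sum>i\<in>UNIV. ?g i * frame_trace (\<lambda>v. frame_trace (\<lambda>w. (T (f i) v w)\<^sup>2))) = ?R"
    using tr[OF bilinear_frame_trace[of "\<lambda>x y v. frame_trace (\<lambda>w. T x v w * T y v w)",
        OF bilinear_frame_trace[of "\<lambda>x y w. T x v w * T y v w" for v, OF bilinear_mult[OF T(1) T(1)]]]]
    by (simp add: power2_eq_square)
  have "?L = (\<Sum>i\<in>UNIV. ?g i * (\<Sum>k\<in>UNIV. ?g k * (\<Sum>l\<in>UNIV. ?g l * (T (f i) (f k) (f l))\<^sup>2)))"
    by (simp add: sum_distrib_left mult.assoc)
  also have "\<dots> = ?R" by (simp only: 1 2 3)
  finally show ?thesis .
qed

end

lemma frame_sum3_diff:
  "frame_sum3 h (\<lambda>u v w. P u v w - r * Q u v w) = frame_sum3 h P - r * frame_sum3 h Q"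
  unfolding frame_sum3_def Let_def
  by (simp add: right_diff_distrib sum_subtractf diff_divide_distrib sum_distrib_left mult_ac)

lemma frame_sum3_trace:
  fixes g :: "real ^ 'n \<Rightarrow> real ^ 'n \<Rightarrow> real"
  assumes H: "hermitian_frame g j \<epsilon> e1 e2 e3 s1 s2 s3" and n: "CARD('n::finite) = 6"
    and T: "\<And>v w. linear (\<lambda>u. T u v w)" "\<And>u w. linear (\<lambda>v. T u v w)" "\<And>u v. linear (T u v)"
  shows "frame_sum3 g (\<lambda>u v w. (T u v w)\<^sup>2) =
    hermitian_frame.frame_trace j \<epsilon> e1 e2 e3 s1 s2 s3 (\<lambda>u. hermitian_frame.frame_trace j \<epsilon> e1 e2 e3 s1 s2 s3
      (\<lambda>v. hermitian_frame.frame_trace j \<epsilon> e1 e2 e3 s1 s2 s3 (\<lambda>w. (T u v w)\<^sup>2))) / 6"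
proof -
  interpret hermitian_frame g j \<epsilon> e1 e2 e3 s1 s2 s3 by fact
  define f where "f = (SOME e :: 'n \<Rightarrow> real ^ 'n. pseudo_orthonormal g e)"
  have "\<exists>e :: 'n \<Rightarrow> real ^ 'n. pseudo_orthonormal g e"
    using orthonormal_exists[where 'n = 'n] n by (auto simp: pseudo_orthonormal_def)
  then have "pseudo_orthonormal g f" unfolding f_def by (rule someI_ex)
  then have f: "\<And>i. g (f i) (f i) = 1 \<or> g (f i) (f i) = - 1" "\<And>i k. i \<noteq> k \<Longrightarrow> g (f i) (f k) = 0"
    by (auto simp: pseudo_orthonormal_def)
  show ?thesis
    unfolding frame_sum3_def f_def[symmetric] Let_def
    using triple_sum_trace[of f T] f n T by simp
qed

lemma frame_sum3_form30:
  fixes g :: "real ^ 'n \<Rightarrow> real ^ 'n \<Rightarrow> real"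
  assumes F: "form30_frame g j \<epsilon> e1 e2 e3 s1 s2 s3 \<psi>" and n: "CARD('n::finite) = 6"
  shows "frame_sum3 g (\<lambda>u v w. (\<psi> u v w)\<^sup>2) =
    4 * (s1 * s2 * s3 * ((\<psi> e1 e2 e3)\<^sup>2 - \<epsilon> * (\<psi> (j e1) e2 e3)\<^sup>2))"
proof -
  interpret form30_frame g j \<epsilon> e1 e2 e3 s1 s2 s3 \<psi> by fact
  show ?thesis
    using frame_sum3_trace[OF hermitian_frame_axioms n linear_form linear_form2 linear_form3] form_trace
    by (simp add: kap_def al_def be_def)
qed

text \<open>psi^- has \<open>- \<epsilon>\<close> times the squared length of psi^+, so the real and
  imaginary parts contribute equally: 8 = 4 + 4.\<close>

lemma frame_sum3_eps_sqmod:
  fixes g :: "real ^ 'n \<Rightarrow> real ^ 'n \<Rightarrow> real"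
  assumes F: "form30_frame g j \<epsilon> e1 e2 e3 s1 s2 s3 \<psi>" and n: "CARD('n::finite) = 6"
  shows "frame_sum3 g (\<lambda>u v w. eps_sqmod \<epsilon> (\<psi> u v w, \<epsilon> * \<psi> (j u) v w)) =
    8 * (s1 * s2 * s3 * ((\<psi> e1 e2 e3)\<^sup>2 - \<epsilon> * (\<psi> (j e1) e2 e3)\<^sup>2))"
proof -
  interpret form30_frame g j \<epsilon> e1 e2 e3 s1 s2 s3 \<psi> by fact
  have s: "linear (\<lambda>u. \<epsilon> * \<psi> (j u) v w)" for v w
    by (rule linear_times(1)[OF linear_compose[OF linear_j linear_form, unfolded o_def]])
  have "form30_frame g j \<epsilon> e1 e2 e3 s1 s2 s3 (\<lambda>u v w. \<epsilon> * \<psi> (j u) v w)"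
  proof (rule form30_frame.intro[OF hermitian_frame_axioms], rule form30_frame_axioms.intro, rule s)
    fix u v w
    show "\<epsilon> * \<psi> (j u) v w = - (\<epsilon> * \<psi> (j v) u w)" using form_j[of u v w] skew12[of u "j v" w] by simp
    show "\<epsilon> * \<psi> (j u) v w = - (\<epsilon> * \<psi> (j u) w v)" using skew23[of "j u" v w] by simp
    show "\<epsilon> * \<psi> (j (j u)) v w = \<epsilon> * \<psi> (j u) (j v) w" by (simp only: form_j)
  qed
  note phi = frame_sum3_form30[OF this n]
  have 1: "frame_sum3 g (\<lambda>u v w. (\<epsilon> * \<psi> (j u) v w)\<^sup>2) =
      - \<epsilon> * (4 * (s1 * s2 * s3 * ((\<psi> e1 e2 e3)\<^sup>2 - \<epsilon> * (\<psi> (j e1) e2 e3)\<^sup>2)))"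
    unfolding phi by (rule eps_cases) (simp_all add: algebra_simps)
  show ?thesis
    unfolding eps_sqmod_def fst_conv snd_conv frame_sum3_diff frame_sum3_form30[OF F n] 1
    by (simp add: algebra_simps)
qed

section \<open>The Levi-Civita connection in a chart\<close>

text \<open>The base point is a parameter and the chart need not be the preferred one, so the point
  can later vary within one chart.\<close>

locale local_structure =
  fixes S :: "'v::euclidean_space set" and x :: 'v and G :: "'v \<Rightarrow> 'v \<Rightarrow> 'v \<Rightarrow> real" and J :: "'v \<Rightarrow> 'v \<Rightarrow> 'v"
    and \<epsilon> :: real
  assumes open_S: "open S" and x_S: "x \<in> S"
    and hermitian: "y \<in> S \<Longrightarrow> eps_hermitian (G y) (J y) \<epsilon>"
    and smooth_G: "smooth_on S (\<lambda>y. G y u v)" and smooth_J: "smooth_on S (\<lambda>y. J y u)"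
begin

sublocale h: eps_hermitian "G x" "J x" \<epsilon> by (rule hermitian[OF x_S])

abbreviation dG where "dG a u v \<equiv> frechet_derivative (\<lambda>y. G y u v) (at x) a"
abbreviation dJ where "dJ a u \<equiv> frechet_derivative (\<lambda>y. J y u) (at x) a"

lemma D_G: "((\<lambda>y. G y u v) has_derivative (\<lambda>a. dG a u v)) (at x)"
  by (rule smooth_on_has_derivative[OF smooth_G x_S])

lemma D_J: "((\<lambda>y. J y u) has_derivative (\<lambda>a. dJ a u)) (at x)"
  by (rule smooth_on_has_derivative[OF smooth_J x_S])

lemma lin_G: "y \<in> S \<Longrightarrow> linear (G y u)" "y \<in> S \<Longrightarrow> linear (\<lambda>u. G y u v)"
  using eps_hermitian.linear_g[OF hermitian] by auto

lemma lin_J: "y \<in> S \<Longrightarrow> linear (J y)"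
  using hermitian eps_hermitian.linear_j by blast

lemma dG_linear: "linear (\<lambda>a. dG a u v)" "linear (\<lambda>u. dG a u v)" "linear (\<lambda>v. dG a u v)"
  and dG_sym: "dG a u v = dG a v u"
proof -
  show "linear (\<lambda>a. dG a u v)" by (rule has_derivative_linear[OF D_G])
  have d: "(\<lambda>y. G y u v) differentiable (at x)" for u v using D_G by (rule differentiableI)
  show "linear (\<lambda>u. dG a u v)" "linear (\<lambda>v. dG a u v)"
    using derivative_linear_family[OF open_S x_S lin_G(2) d]
      derivative_linear_family[OF open_S x_S lin_G(1) d] by blast+
  have "frechet_derivative (\<lambda>y. G y u v) (at x) = frechet_derivative (\<lambda>y. G y v u) (at x)"
    by (rule frechet_derivative_cong_open[OF open_S x_S]) (rule eps_hermitian.g_sym[OF hermitian])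
  then show "dG a u v = dG a v u" by simp
qed

lemma dJ_linear: "linear (\<lambda>a. dJ a u)" "linear (dJ a)"
proof -
  show "linear (\<lambda>a. dJ a u)" by (rule has_derivative_linear[OF D_J])
  show "linear (dJ a)" 
    by (rule derivative_linear_family[OF open_S x_S lin_J differentiableI[OF D_J]])
qed

lemma dJ_J: "dJ a (J x u) = - J x (dJ a u)"
proof -
  have "((\<lambda>y. J y (J y u)) has_derivative (\<lambda>a. dJ a (J x u) + J x (dJ a u))) (at x)"
    by (rule has_derivative_apply_linear[OF open_S x_S lin_J D_J D_J])
  moreover have "((\<lambda>y. J y (J y u)) has_derivative (\<lambda>a. 0)) (at x)"
    by (rule has_derivative_transform_within_open[OF has_derivative_const[of "\<epsilon> *\<^sub>R u"] open_S x_S])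
      (simp add: eps_hermitian.jj[OF hermitian])
  ultimately have "(\<lambda>a. dJ a (J x u) + J x (dJ a u)) = (\<lambda>a. 0)"
    by (rule has_derivative_unique)
  from fun_cong[OF this, of a] show ?thesis by (simp add: eq_neg_iff_add_eq_0)
qed

lemma D_omega: "((\<lambda>y. G y u (J y v)) has_derivative (\<lambda>a. dG a u (J x v) + G x u (dJ a v))) (at x)"
  by (rule has_derivative_apply_linear[OF open_S x_S lin_G(1) D_G D_J])

text \<open>The condition inside the description in \<open>christoffel\<close>, freed from the
  preferred chart.\<close>

definition levi_civita_form :: "('v \<Rightarrow> 'v \<Rightarrow> 'v) \<Rightarrow> bool" where
  "levi_civita_form \<Gamma> \<longleftrightarrow> bilinear \<Gamma> \<and> (\<forall>u v. \<Gamma> u v = \<Gamma> v u) \<and>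
    (\<forall>u v w. dG u v w = G x (\<Gamma> u v) w + G x v (\<Gamma> u w))"

lemma koszul:
  assumes "levi_civita_form \<Gamma>"
  shows "G x (\<Gamma> u v) w = (dG u v w + dG v u w - dG w u v) / 2"
proof -
  have s: "\<Gamma> u v = \<Gamma> v u" and m: "dG u v w = G x (\<Gamma> u v) w + G x v (\<Gamma> u w)" for u v w
    using assms by (auto simp: levi_civita_form_def)
  show ?thesis
    unfolding m using s[of u v] s[of u w] s[of v w] h.g_sym[of v "\<Gamma> w u"] by simp
qed

lemma levi_civita_form_ex1:
  assumes "DIM('v) = 6"
  shows "\<exists>!\<Gamma>. levi_civita_form \<Gamma>"
proof (rule ex_ex1I)
  obtain e1 e2 e3 s1 s2 s3 where "hermitian_frame (G x) (J x) \<epsilon> e1 e2 e3 s1 s2 s3"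
    using h.hermitian_frame_exists[OF assms] by blast
  then interpret f: hermitian_frame "G x" "J x" \<epsilon> e1 e2 e3 s1 s2 s3 .
  \<comment> \<open>The Koszul formula read as a definition; the adapted frame supplies the metric
    dual of the covector.\<close>
  define \<Gamma> where "\<Gamma> u v = f.sharp (\<lambda>w. (dG u v w + dG v u w - dG w u v) / 2)" for u v
  have lin: "linear (\<lambda>w. (dG u v w + dG v u w - dG w u v) / 2)" for u v
    using linear_times(1)[OF linear_compose_sub[OF linear_compose_add[OF dG_linear(3)[of v u] dG_linear(3)[of u v]]
        dG_linear(1)[of u v]], of "1 / 2"] by simp
  have g\<Gamma>: "G x w (\<Gamma> u v) = (dG u v w + dG v u w - dG w u v) / 2" for u v w
    unfolding \<Gamma>_def by (rule f.g_sharp[OF lin])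
  have "levi_civita_form \<Gamma>"
    unfolding levi_civita_form_def bilinear_def
  proof (intro conjI allI)
    have add: "dG (a + b) u v = dG a u v + dG b u v" "dG a (u + u') v = dG a u v + dG a u' v"
      "dG a u (v + v') = dG a u v + dG a u v'" "dG (r *\<^sub>R a) u v = r * dG a u v"
      "dG a (r *\<^sub>R u) v = r * dG a u v" "dG a u (r *\<^sub>R v) = r * dG a u v" for a b u u' v v' r
      using linear_add[OF dG_linear(1)] linear_add[OF dG_linear(2)] linear_add[OF dG_linear(3)]
        linear_cmul[OF dG_linear(1)] linear_cmul[OF dG_linear(2)] linear_cmul[OF dG_linear(3)] by auto
    show sym: "\<Gamma> u v = \<Gamma> v u" for u v
      by (rule h.g_eqI) (simp add: h.g_sym[of "\<Gamma> _ _"] g\<Gamma> dG_sym[of v u])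
    show l: "linear (\<Gamma> u)" for u
    proof (rule linearI)
      fix v v' r
      show "\<Gamma> u (v + v') = \<Gamma> u v + \<Gamma> u v'"
        by (rule h.g_eqI) (simp add: h.g_sym[of "\<Gamma> _ _"] g\<Gamma> add field_simps)
      show "\<Gamma> u (r *\<^sub>R v) = r *\<^sub>R \<Gamma> u v"
        by (rule h.g_eqI) (simp add: h.g_sym[of "\<Gamma> _ _"] g\<Gamma> add field_simps)
    qed
    show "linear (\<lambda>u. \<Gamma> u v)" for v using l[of v] sym[of v] by (metis (no_types, lifting) ext)
    show "dG u v w = G x (\<Gamma> u v) w + G x v (\<Gamma> u w)" for u v w
      using dG_sym[of u w v] dG_sym[of v w u] dG_sym[of w v u]
      by (simp add: h.g_sym[of "\<Gamma> _ _"] g\<Gamma> field_simps)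
  qed
  then show "\<exists>\<Gamma>. levi_civita_form \<Gamma>" by blast
next
  fix \<Gamma> \<Gamma>' assume "levi_civita_form \<Gamma>" "levi_civita_form \<Gamma>'"
  then have "\<Gamma> u v = \<Gamma>' u v" for u v by (intro h.g_eqI) (simp add: koszul)
  then show "\<Gamma> = \<Gamma>'" by blast
qed


end

text \<open>This is where vanishing torsion enters: the connection terms alternate to zero, so
  covariant and coordinate derivatives of a three-form give the same exterior derivative.\<close>

lemma alt4_connection_terms:
  fixes \<phi> :: "'v::real_vector \<Rightarrow> 'v \<Rightarrow> 'v \<Rightarrow> real"
  assumes skew: "\<And>u v w. \<phi> u v w = - \<phi> v u w" "\<And>u v w. \<phi> u v w = - \<phi> u w v"
    and sym: "\<And>u v. \<Gamma> u v = \<Gamma> v u"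
  shows "alt4 (\<lambda>a u v w. \<phi> (\<Gamma> a u) v w + \<phi> u (\<Gamma> a v) w + \<phi> u v (\<Gamma> a w)) u v w z = 0"
proof -
  have c: "\<phi> p (\<Gamma> a b) q = - \<phi> (\<Gamma> a b) p q" "\<phi> p q (\<Gamma> a b) = \<phi> (\<Gamma> a b) p q" for p q a b
    using skew(1)[of p "\<Gamma> a b" q] skew(1)[of p "\<Gamma> a b" q] skew(2)[of p q "\<Gamma> a b"] by linarith+
  show ?thesis
    unfolding alt4_def c
    by (simp add: sym[of v u] sym[of w u] sym[of z u] sym[of w v] sym[of z v] sym[of z w]
      skew(2)[of _ v u] skew(2)[of _ w u] skew(2)[of _ z u] skew(2)[of _ w v] skew(2)[of _ z v] skew(2)[of _ z w])
qed

locale local_connection = local_structure S x G J \<epsilon>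
  for S :: "'v::euclidean_space set" and x G J \<epsilon> +
  fixes \<Gamma> :: "'v \<Rightarrow> 'v \<Rightarrow> 'v"
  assumes lc: "levi_civita_form \<Gamma>"
begin

definition nabla_J :: "'v \<Rightarrow> 'v \<Rightarrow> 'v" where
  "nabla_J a u = dJ a u + \<Gamma> a (J x u) - J x (\<Gamma> a u)"

lemma \<Gamma>_sym: "\<Gamma> u v = \<Gamma> v u" and \<Gamma>_linear: "linear (\<Gamma> u)" "linear (\<lambda>u. \<Gamma> u v)"
  and dG_\<Gamma>: "dG u v w = G x (\<Gamma> u v) w + G x v (\<Gamma> u w)"
  using lc by (auto simp: levi_civita_form_def bilinear_def)

lemma nabla_J_linear: "linear (\<lambda>a. nabla_J a u)" "linear (nabla_J a)"
proof -
  show "linear (\<lambda>a. nabla_J a u)"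
    unfolding nabla_J_def
    by (intro linear_compose_add linear_compose_sub dJ_linear \<Gamma>_linear
        linear_compose[OF \<Gamma>_linear(2) h.linear_j, unfolded o_def])
  have "linear (\<lambda>u. nabla_J a u)"
    unfolding nabla_J_def
    by (intro linear_compose_add linear_compose_sub dJ_linear(2)
        linear_compose[OF h.linear_j \<Gamma>_linear(1), unfolded o_def]
        linear_compose[OF \<Gamma>_linear(1) h.linear_j, unfolded o_def])
  then show "linear (nabla_J a)" by simp
qed

lemma nabla_J_J: "nabla_J a (J x u) = - J x (nabla_J a u)"
  by (simp add: nabla_J_def dJ_J linear_cmul[OF \<Gamma>_linear(1)] algebra_simps)

lemma nabla_omega: "G x u (nabla_J a v) =
    dG a u (J x v) + G x u (dJ a v) - G x (\<Gamma> a u) (J x v) - G x u (J x (\<Gamma> a v))"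
  by (simp add: nabla_J_def dG_\<Gamma>)

lemma nabla_J_skew: "G x u (nabla_J a v) = - G x v (nabla_J a u)"
proof -
  have "((\<lambda>y. G y u (J y v)) has_derivative (\<lambda>a. - (dG a v (J x u) + G x v (dJ a u)))) (at x)"
    by (rule has_derivative_transform_within_open[OF has_derivative_minus[OF D_omega] open_S x_S])
      (simp add: eps_hermitian.g_j_skew[OF hermitian, of _ u v])
  from fun_cong[OF has_derivative_unique[OF D_omega this], of a]
  have "dG a u (J x v) + G x u (dJ a v) = - (dG a v (J x u) + G x v (dJ a u))" by simp
  then show ?thesis
    unfolding nabla_omega using h.g_j_skew[of "\<Gamma> a u" v] h.g_j_skew[of "\<Gamma> a v" u] by linarith
qed

lemma dform2_omega: "dform2 (\<lambda>y u v. G y u (J y v)) x u v w =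
    G x v (nabla_J u w) + G x w (nabla_J v u) + G x u (nabla_J w v)"
proof -
  have "frechet_derivative (\<lambda>y. G y u (J y v)) (at x) a = dG a u (J x v) + G x u (dJ a v)" for a u v
    by (rule fun_cong[OF frechet_derivative_at[OF D_omega], symmetric])
  then have E: "frechet_derivative (\<lambda>y. G y u (J y v)) (at x) a =
      G x u (nabla_J a v) + G x (\<Gamma> a u) (J x v) + G x u (J x (\<Gamma> a v))" for a u v
    unfolding nabla_omega by simp
  show ?thesis
    unfolding dform2_def E
    using nabla_J_skew[of u v w] h.g_j_skew[of "\<Gamma> w u" v] \<Gamma>_sym[of u v] \<Gamma>_sym[of u w] \<Gamma>_sym[of v w] by simp
qed

end

section \<open>A closed three-form of type (3,0) + (0,3) in a chart\<close>

locale local_form = local_connection S x G J \<epsilon> \<Gamma>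
  for S :: "'v::euclidean_space set" and x G J \<epsilon> \<Gamma> +
  fixes P :: "'v \<Rightarrow> 'v \<Rightarrow> 'v \<Rightarrow> 'v \<Rightarrow> real"
  assumes lin_P: "y \<in> S \<Longrightarrow> linear (\<lambda>u. P y u v w)"
    and skew_P: "y \<in> S \<Longrightarrow> P y u v w = - P y v u w" "y \<in> S \<Longrightarrow> P y u v w = - P y u w v"
    and P_J: "y \<in> S \<Longrightarrow> P y (J y u) v w = P y u (J y v) w"
    and smooth_P: "smooth_on S (\<lambda>y. P y u v w)"
    and closed_P: "dform3 P x u v w z = 0"
begin

abbreviation dP where "dP a u v w \<equiv> frechet_derivative (\<lambda>y. P y u v w) (at x) a"

definition nabla_P :: "'v \<Rightarrow> 'v \<Rightarrow> 'v \<Rightarrow> 'v \<Rightarrow> real" where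
  "nabla_P a u v w = dP a u v w - (P x (\<Gamma> a u) v w + P x u (\<Gamma> a v) w + P x u v (\<Gamma> a w))"

lemma lin_P2: "y \<in> S \<Longrightarrow> linear (\<lambda>v. P y u v w)"
  using linear_compose_neg[OF lin_P[of y u w]] skew_P(1)[of y u _ w] by (metis (no_types, lifting) ext)

lemma lin_P3: "y \<in> S \<Longrightarrow> linear (P y u v)"
  using linear_compose_neg[OF lin_P2[of y u v]] skew_P(2)[of y u v] by (metis (no_types, lifting) ext)

lemma D_P: "((\<lambda>y. P y u v w) has_derivative (\<lambda>a. dP a u v w)) (at x)"
  by (rule smooth_on_has_derivative[OF smooth_P x_S])

lemma dP_linear: "linear (\<lambda>a. dP a u v w)" "linear (\<lambda>u. dP a u v w)"
  by (rule has_derivative_linear[OF D_P],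
      rule derivative_linear_family[OF open_S x_S lin_P differentiableI[OF D_P]])

lemma dP_skew: "dP a u v w = - dP a v u w" "dP a u v w = - dP a u w v"
proof -
  have "((\<lambda>y. P y u v w) has_derivative (\<lambda>a. - dP a v u w)) (at x)"
    by (rule has_derivative_transform_within_open[OF has_derivative_minus[OF D_P] open_S x_S]) (simp add: skew_P(1)[of _ v])
  from has_derivative_unique[OF D_P this] show "dP a u v w = - dP a v u w" by metis
  have "((\<lambda>y. P y u v w) has_derivative (\<lambda>a. - dP a u w v)) (at x)"
    by (rule has_derivative_transform_within_open[OF has_derivative_minus[OF D_P] open_S x_S]) (simp add: skew_P(2)[of _ _ w])
  from has_derivative_unique[OF D_P this] show "dP a u v w = - dP a u w v" by metis
qed

lemma D_PJ: "((\<lambda>y. P y (J y u) v w) has_derivative (\<lambda>a. dP a (J x u) v w + P x (dJ a u) v w)) (at x)"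
  by (rule has_derivative_apply_linear[where F = "\<lambda>y u. P y u v w", OF open_S x_S lin_P D_P D_J])

lemma dP_J: "dP a (J x u) v w + P x (dJ a u) v w = dP a u (J x v) w + P x u (dJ a v) w"
proof -
  have "((\<lambda>y. P y u (J y v) w) has_derivative (\<lambda>a. dP a u (J x v) w + P x u (dJ a v) w)) (at x)"
    by (rule has_derivative_apply_linear[where F = "\<lambda>y v. P y u v w", OF open_S x_S lin_P2 D_P D_J])
  then have "((\<lambda>y. P y (J y u) v w) has_derivative (\<lambda>a. dP a u (J x v) w + P x u (dJ a v) w)) (at x)"
    by (rule has_derivative_transform_within_open[OF _ open_S x_S]) (simp add: P_J)
  from has_derivative_unique[OF D_PJ this] show ?thesis by metis
qed

text \<open>The passage from analysis to linear algebra. Coordinate derivatives satisfy the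
  differentiated identities, and the connection terms contribute only what the undifferentiated
  identities already control.\<close>

lemma form_jet: 
  assumes "hermitian_frame (G x) (J x) \<epsilon> e1 e2 e3 s1 s2 s3"
  shows "form_jet (G x) (J x) \<epsilon> e1 e2 e3 s1 s2 s3 (P x) nabla_J nabla_P"
proof -
  interpret hermitian_frame "G x" "J x" \<epsilon> e1 e2 e3 s1 s2 s3 by fact
  show ?thesis
  proof (intro form_jet.intro form30_frame.intro hermitian_frame_axioms form30_frame_axioms.intro form_jet_axioms.intro)
    show "linear (\<lambda>u. P x u v w)" for v w by (rule lin_P[OF x_S])
    show "P x u v w = - P x v u w" "P x u v w = - P x u w v" "P x (J x u) v w = P x u (J x v) w" for u v w
      using skew_P[OF x_S] P_J[OF x_S] by blast+
    show "linear (\<lambda>a. nabla_J a u)" "linear (nabla_J a)" for a u by (rule nabla_J_linear)+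
    show "nabla_J a (J x u) = - J x (nabla_J a u)" for a u by (rule nabla_J_J)
    show "G x u (nabla_J a v) = - G x v (nabla_J a u)" for a u v by (rule nabla_J_skew)
    note linP = lin_P[OF x_S] lin_P2[OF x_S] lin_P3[OF x_S]
    show "linear (\<lambda>a. nabla_P a u v w)" for u v w
      unfolding nabla_P_def
      by (intro linear_compose_add linear_compose_sub dP_linear
          linear_compose[OF \<Gamma>_linear(2) linP(1), unfolded o_def]
          linear_compose[OF \<Gamma>_linear(2) linP(2), unfolded o_def]
          linear_compose[OF \<Gamma>_linear(2) linP(3), unfolded o_def])
    show "linear (\<lambda>u. nabla_P a u v w)" for a v w
      unfolding nabla_P_def
      by (intro linear_compose_add linear_compose_sub dP_linear linP(1)
          linear_compose[OF \<Gamma>_linear(1) linP(1), unfolded o_def])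
    show "nabla_P a u v w = - nabla_P a v u w" for a u v w
      using dP_skew(1)[of u v w a] skew_P(1)[OF x_S, of "\<Gamma> a u" v w] skew_P(1)[OF x_S, of u "\<Gamma> a v" w]
        skew_P(1)[OF x_S, of u v "\<Gamma> a w"] unfolding nabla_P_def by linarith
    show "nabla_P a u v w = - nabla_P a u w v" for a u v w
      using dP_skew(2)[of u v w a] skew_P(2)[OF x_S, of "\<Gamma> a u" v w] skew_P(2)[OF x_S, of u "\<Gamma> a v" w]
        skew_P(2)[OF x_S, of u v "\<Gamma> a w"] unfolding nabla_P_def by linarith
    have PJ: "P x (J x u) v w = P x u (J x v) w" for u v w by (rule P_J[OF x_S])
    show "nabla_P a (J x u) v w + P x (nabla_J a u) v w = nabla_P a u (J x v) w + P x u (nabla_J a v) w" for a u v w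
      using dP_J[of u v w a] PJ[of u "\<Gamma> a v" w] PJ[of "\<Gamma> a u" v w] PJ[of u v "\<Gamma> a w"]
      unfolding nabla_P_def nabla_J_def
      by (simp add: linear_add[OF linP(1)] linear_diff[OF linP(1)] linear_add[OF linP(2)] linear_diff[OF linP(2)])
    show "alt4 nabla_P u v w z = 0" for u v w z
      using alt4_connection_terms[of "P x" \<Gamma> u v w z, OF skew_P[OF x_S] \<Gamma>_sym] closed_P[of u v w z]
      unfolding alt4_def nabla_P_def dform3_def by linarith
  qed
qed

text \<open>\<open>C\<close> is the covariant derivative of psi^-: the coordinate derivative splits
  into \<open>C\<close> and connection terms, and the latter alternate to zero.\<close>

lemma dform3_J:
  assumes "hermitian_frame (G x) (J x) \<epsilon> e1 e2 e3 s1 s2 s3"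
  shows "dform3 (\<lambda>y u v w. \<epsilon> * P y (J y u) v w) x u v w z = alt4 (form_jet.C (J x) \<epsilon> (P x) nabla_J nabla_P) u v w z"
proof -
  interpret form_jet "G x" "J x" \<epsilon> e1 e2 e3 s1 s2 s3 "P x" nabla_J nabla_P by (rule form_jet[OF assms])
  have "((\<lambda>y. \<epsilon> * P y (J y u) v w) has_derivative
      (\<lambda>a. \<epsilon> * (dP a (J x u) v w + P x (dJ a u) v w))) (at x)" for u v w
    by (rule has_derivative_mult_right[OF D_PJ])
  from fun_cong[OF frechet_derivative_at[OF this]]
  have E: "frechet_derivative (\<lambda>y. \<epsilon> * P y (J y u) v w) (at x) a =
      \<epsilon> * (dP a (J x u) v w + P x (dJ a u) v w)" for a u v w by metis
  have "frechet_derivative (\<lambda>y. \<epsilon> * P y (J y u) v w) (at x) a =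
      C a u v w + (\<phi> (\<Gamma> a u) v w + \<phi> u (\<Gamma> a v) w + \<phi> u v (\<Gamma> a w))" for a u v w
    unfolding E C_def nabla_P_def nabla_J_def \<phi>_def
    by (simp add: algebra_simps)
  then show ?thesis
    using alt4_connection_terms[of \<phi> \<Gamma> u v w z, OF phi_skew \<Gamma>_sym]
    unfolding alt4_def dform3_def by simp
qed


section \<open>Constancy of the structure function\<close>

definition omega_sq :: "'v \<Rightarrow> 'v \<Rightarrow> 'v \<Rightarrow> 'v \<Rightarrow> 'v \<Rightarrow> real" where
  "omega_sq y u v w z = 2 * (G y u (J y v) * G y w (J y z) - G y u (J y w) * G y v (J y z)
    + G y u (J y z) * G y v (J y w))"

lemma smooth_omega: "smooth_on S (\<lambda>y. G y u (J y v))"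
  by (rule smooth_on_apply_linear[OF open_S lin_G(1) smooth_G smooth_J])

lemma smooth_omega_sq: "smooth_on S (\<lambda>y. omega_sq y u v w z)"
  unfolding omega_sq_def
  by (intro smooth_on_mult smooth_on_add smooth_on_diff smooth_on_const smooth_omega open_S)

lemma smooth_PJ: "smooth_on S (\<lambda>y. \<epsilon> * P y (J y u) v w)"
  by (rule smooth_on_mult[OF open_S smooth_on_const
        smooth_on_apply_linear[where F = "\<lambda>y u. P y u v w", OF open_S lin_P smooth_P smooth_J]])

text \<open>Comparing the exterior derivative of both sides of \<open>d\<psi>\<^sup>- = 2 \<kappa> \<omega> \<and> \<omega>\<close> gives
  \<open>d\<kappa> \<and> \<omega> \<and> \<omega> = 0\<close>, because \<open>\<omega> \<and> d\<omega> = 3 \<omega> \<and> \<psi>\<^sup>+ = 0\<close> by type.\<close>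

lemma structure_function_stationary:
  assumes F: "hermitian_frame (G x) (J x) \<epsilon> e1 e2 e3 s1 s2 s3"
    and eq: "\<And>y u v w z. y \<in> S \<Longrightarrow>
      dform3 (\<lambda>y u v w. \<epsilon> * P y (J y u) v w) y u v w z = 2 * \<kappa> y * omega_sq y u v w z"
    and d\<omega>: "\<And>u v w. dform2 (\<lambda>y u v. G y u (J y v)) x u v w = 3 * P x u v w"
  shows "(\<kappa> has_derivative (\<lambda>a. 0)) (at x)"
proof -
  interpret form_jet "G x" "J x" \<epsilon> e1 e2 e3 s1 s2 s3 "P x" nabla_J nabla_P by (rule form_jet[OF F])
  let ?Q = "\<lambda>y u v w z. dform3 (\<lambda>y u v w. \<epsilon> * P y (J y u) v w) y u v w z"
  let ?\<omega> = "\<lambda>u v. G x u (J x v)"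
  have sQ: "smooth_on S (\<lambda>y. ?Q y u v w z)" for u v w z
    by (rule smooth_on_dform3[OF open_S smooth_PJ])
  \<comment> \<open>\<open>\<kappa>\<close> is not assumed differentiable. Near \<open>x\<close>
    this component of omega^omega is non-zero, so \<open>\<kappa>\<close> is there a quotient of
    smooth functions.\<close>
  define f where "f y = omega_sq y e1 (J x e1) e2 (J x e2)" for y
  have fx: "f x \<noteq> 0" by (simp add: f_def omega_sq_def norm orth orth_sym h.g_j_left)
  define S' where "S' = {y \<in> S. f y \<noteq> 0}"
  have sf: "smooth_on S f" unfolding f_def by (rule smooth_omega_sq)
  have S': "open S'" "x \<in> S'"
  proof -
    have "open (S \<inter> f -` (- {0}))"
      by (rule continuous_open_preimage[OF smooth_on_continuous[OF sf] open_S]) auto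
    moreover have "S' = S \<inter> f -` (- {0})" by (auto simp: S'_def)
    ultimately show "open S'" by simp
    show "x \<in> S'" using x_S fx by (simp add: S'_def)
  qed
  have "(\<lambda>y. ?Q y e1 (J x e1) e2 (J x e2) / (2 * f y)) differentiable (at x)"
    by (intro differentiable_divide differentiable_mult smooth_on_differentiable[OF sQ x_S]
        smooth_on_differentiable[OF sf x_S] differentiable_const) (simp add: fx)
  then obtain K where "((\<lambda>y. ?Q y e1 (J x e1) e2 (J x e2) / (2 * f y)) has_derivative K) (at x)"
    by (auto simp: differentiable_def)
  then have K: "(\<kappa> has_derivative K) (at x)"
    by (rule has_derivative_transform_within_open[OF _ S']) (auto simp: S'_def eq f_def)
  define d where "d a u v = frechet_derivative (\<lambda>y. G y u (J y v)) (at x) a" for a u v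
  have d: "((\<lambda>y. G y u (J y v)) has_derivative (\<lambda>a. d a u v)) (at x)" for u v
    unfolding d_def by (rule smooth_on_has_derivative[OF smooth_omega x_S])
  define dW where "dW a u v w z = 2 * (?\<omega> u v * d a w z + d a u v * ?\<omega> w z
    - (?\<omega> u w * d a v z + d a u w * ?\<omega> v z) + (?\<omega> u z * d a v w + d a u z * ?\<omega> v w))" for a u v w z
  have "((\<lambda>y. omega_sq y u v w z) has_derivative (\<lambda>a. dW a u v w z)) (at x)" for u v w z
    unfolding omega_sq_def dW_def
    by (intro has_derivative_mult_right has_derivative_add has_derivative_diff has_derivative_mult d)
  from has_derivative_mult[OF has_derivative_mult_right[OF K] this]
  have "((\<lambda>y. 2 * \<kappa> y * omega_sq y u v w z) has_derivative
      (\<lambda>a. 2 * \<kappa> x * dW a u v w z + 2 * K a * omega_sq x u v w z)) (at x)" for u v w z .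
  then have "((\<lambda>y. ?Q y u v w z) has_derivative
      (\<lambda>a. 2 * \<kappa> x * dW a u v w z + 2 * K a * omega_sq x u v w z)) (at x)" for u v w z
    by (rule has_derivative_transform_within_open[OF _ open_S x_S]) (simp add: eq)
  from fun_cong[OF frechet_derivative_at[OF this]]
  have dQ: "frechet_derivative (\<lambda>y. ?Q y u v w z) (at x) a =
      2 * \<kappa> x * dW a u v w z + 2 * K a * omega_sq x u v w z" for a u v w z by metis
  have d3: "d a u v - d u a v + d v a u = 3 * P x a u v" for a u v
    using d\<omega>[of a u v] by (simp add: dform2_def d_def)
  \<comment> \<open>The five-form is tested on \<open>a\<close>, \<open>b\<close>,
    \<open>J b\<close>, \<open>e\<close>, \<open>J e\<close>. As \<open>a\<close> is
    omega-orthogonal to the other four, d kappa contributes only through \<open>K a\<close>.\<close>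
  have K0: "K a = 0"
    if o: "?\<omega> a b = 0" "?\<omega> a (J x b) = 0" "?\<omega> a e = 0" "?\<omega> a (J x e) = 0" "?\<omega> b e = 0"
      "?\<omega> b (J x e) = 0" and ne: "?\<omega> b (J x b) \<noteq> 0" "?\<omega> e (J x e) \<noteq> 0" for a b e
  proof -
    have o': "?\<omega> (J x b) e = 0" "?\<omega> (J x b) (J x e) = 0" using o by (simp_all add: h.g_j_left)
    \<comment> \<open>psi^+ vanishes by type on a pair \<open>b\<close>, \<open>J b\<close>. With d
      omega = 3 psi^+ this relates derivatives of omega so that the terms with the factor
      \<open>\<kappa> x\<close> cancel.\<close>
    have P0: "P x a b (J x b) = 0" "P x a e (J x e) = 0"
      by (simp_all add: form_j3 form_j2[symmetric])
    have e1: "d a b (J x b) = d b a (J x b) - d (J x b) a b" "d a e (J x e) = d e a (J x e) - d (J x e) a e"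
      using d3[of a b "J x b"] d3[of a e "J x e"] P0 by linarith+
    have "2 * K a * omega_sq x b (J x b) e (J x e) = 0"
      using dform4_dform3[where S = S and b = "\<lambda>y u v w. \<epsilon> * P y (J y u) v w" and u = a and v = b and w = "J x b" and z = e and y = "J x e",
          OF open_S x_S smooth_PJ]
      unfolding dQ by (simp only: dW_def omega_sq_def o o' e1) (simp add: algebra_simps)
    moreover have "omega_sq x b (J x b) e (J x e) = 2 * (?\<omega> b (J x b) * ?\<omega> e (J x e))"
      by (simp only: omega_sq_def o o') simp
    ultimately show ?thesis using ne by auto
  qed
  have "K a = 0" for a
  proof (rule linear_frame_0[OF has_derivative_linear[OF K]])
    show "K e1 = 0" "K (J x e1) = 0"
      by (rule K0[of _ e2 e3]; simp add: norm orth orth_sym h.g_j_left)+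
    show "K e2 = 0" "K (J x e2) = 0"
      by (rule K0[of _ e1 e3]; simp add: norm orth orth_sym h.g_j_left)+
    show "K e3 = 0" "K (J x e3) = 0"
      by (rule K0[of _ e1 e2]; simp add: norm orth orth_sym h.g_j_left)+
  qed
  then have "K = (\<lambda>a. 0)" by blast
  with K show ?thesis by simp
qed

end

section \<open>Nearly \<open>\<epsilon>\<close>-Kaehler manifolds\<close>

lemma locally_constant_connected:
  assumes "connected_space M" and loc: "\<And>p. p \<in> topspace M \<Longrightarrow> \<exists>V. openin M V \<and> p \<in> V \<and> (\<forall>q\<in>V. f q = f p)"
    and "p \<in> topspace M" "q \<in> topspace M"
  shows "f q = f p"
proof -
  \<comment> \<open>An arbitrary predicate \<open>Q\<close> covers a level set and its complement at
    once.\<close>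
  have op: "openin M {q \<in> topspace M. Q (f q)}" for Q
  proof (subst openin_subopen, intro ballI)
    fix r assume "r \<in> {q \<in> topspace M. Q (f q)}"
    then have r: "r \<in> topspace M" "Q (f r)" by auto
    then obtain V where V: "openin M V" "r \<in> V" "\<forall>q\<in>V. f q = f r" using loc by blast
    have "V \<subseteq> {q \<in> topspace M. Q (f q)}"
    proof
      fix q assume "q \<in> V"
      then have "f q = f r" "q \<in> topspace M" using V(3) openin_subset[OF V(1)] by blast+
      then show "q \<in> {q \<in> topspace M. Q (f q)}" using r(2) by simp
    qed
    with V show "\<exists>T. openin M T \<and> r \<in> T \<and> T \<subseteq> {q \<in> topspace M. Q (f q)}" by blast
  qed
  let ?U = "{q \<in> topspace M. f q = f p}"
  have "topspace M - ?U = {q \<in> topspace M. f q \<noteq> f p}" by blast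
  then have "closedin M ?U" using op[of "\<lambda>y. y \<noteq> f p"] by (simp add: closedin_def)
  moreover have "openin M ?U" by (rule op)
  ultimately have "?U = {} \<or> ?U = topspace M" using assms(1) connected_space_clopen_in by blast
  moreover have "p \<in> ?U" using assms(3) by simp
  ultimately have "q \<in> ?U" using assms(4) by blast
  then show ?thesis by simp
qed

locale hermitian_mfd = smooth_mfd M \<A>
  for M :: "'a topology" and \<A> :: "('a, 6) chart set" +
  fixes \<epsilon> :: real and g :: "('a, 6) cov2" and J :: "('a, 6) endo" and \<omega> :: "('a, 6) cov2"
  assumes eps: "\<epsilon> = 1 \<or> \<epsilon> = - 1" and hermitian_structure: "almost_eps_hermitian \<epsilon> M \<A> g J \<omega>"
begin

lemma omega_eq: "p \<in> topspace M \<Longrightarrow> \<omega> p u v = g p u (J p v)"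
  using hermitian_structure by (simp add: almost_eps_hermitian_def)

lemma eps_hermitian_at:
  assumes p: "p \<in> topspace M" shows "eps_hermitian (g p) (J p) \<epsilon>"
proof -
  have "smooth_metric M \<A> g" "smooth_endo M \<A> J"
    and a: "\<And>u. J p (J p u) = \<epsilon> *\<^sub>R u" "\<And>u v. g p (J p u) (J p v) = - \<epsilon> * g p u v"
    using hermitian_structure p unfolding almost_eps_hermitian_def by blast+
  then have b: "linear (J p)" "bilinear (g p)" "\<And>u v. g p u v = g p v u"
    "\<And>u. (\<forall>v. g p u v = 0) \<Longrightarrow> u = 0"
    using p unfolding smooth_metric_def smooth_endo_def by blast+
  show ?thesis
    by (rule eps_hermitian.intro[OF eps b(2) b(3) _ b(1) a]) (use b(4) in blast)
qed

lemma endo_in_at: "c \<in> \<A> \<Longrightarrow> p \<in> fst c \<Longrightarrow>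
    endo_in \<A> c J (snd c p) u = coords_of \<A> c p (J p (tangent_of \<A> c p u))"
  by (simp add: endo_in_def)

lemma tangent_of_endo_in: "c \<in> \<A> \<Longrightarrow> p \<in> fst c \<Longrightarrow>
    tangent_of \<A> c p (endo_in \<A> c J (snd c p) u) = J p (tangent_of \<A> c p u)"
  by (simp add: endo_in_at tangent_coords)

lemma tangent_of_eq_0: "c \<in> \<A> \<Longrightarrow> p \<in> fst c \<Longrightarrow> tangent_of \<A> c p u = 0 \<Longrightarrow> u = 0"
  using coords_tangent[of c p u] linear_0[OF linear_coords_of[of c p]] by simp

lemma eps_hermitian_in_chart:
  assumes c: "c \<in> \<A>" "p \<in> fst c"
  shows "eps_hermitian (cov2_in \<A> c g (snd c p)) (endo_in \<A> c J (snd c p)) \<epsilon>"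
proof -
  interpret eps_hermitian "g p" "J p" \<epsilon> using eps_hermitian_at chart_topspace[OF c] .
  note t = linear_tangent_of[OF c] and s = linear_coords_of[OF c]
  note gc = cov2_in_at[OF c, of g] and tJ = tangent_of_endo_in[OF c]
  show ?thesis
  proof (rule eps_hermitian.intro[OF eps])
    show "bilinear (cov2_in \<A> c g (snd c p))"
      unfolding bilinear_def gc
      by (intro conjI allI linear_compose[OF t linear_g(1), unfolded o_def] linear_compose[OF t linear_g(2), unfolded o_def])
    show "cov2_in \<A> c g (snd c p) u v = cov2_in \<A> c g (snd c p) v u" for u v
      unfolding gc by (rule g_sym)
    show "u = 0" if "\<And>v. cov2_in \<A> c g (snd c p) u v = 0" for u
    proof (rule tangent_of_eq_0[OF c nondegenerate])
      fix v show "g p (tangent_of \<A> c p u) v = 0"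
        using that[of "coords_of \<A> c p v"] by (simp add: gc tangent_coords[OF c])
    qed
    have "linear (\<lambda>u. endo_in \<A> c J (snd c p) u)"
      unfolding endo_in_at[OF c]
      using linear_compose[OF linear_compose[OF t linear_j] s] by (simp add: o_def)
    then show "linear (endo_in \<A> c J (snd c p))" by simp
    show "endo_in \<A> c J (snd c p) (endo_in \<A> c J (snd c p) u) = \<epsilon> *\<^sub>R u" for u
      by (simp add: endo_in_at[OF c] tangent_coords[OF c] coords_tangent[OF c] linear_cmul[OF s])
    show "cov2_in \<A> c g (snd c p) (endo_in \<A> c J (snd c p) u) (endo_in \<A> c J (snd c p) v) =
        - \<epsilon> * cov2_in \<A> c g (snd c p) u v" for u v
      by (simp add: gc tJ)
  qed
qed

lemma smooth_g_in_chart: "c \<in> \<A> \<Longrightarrow> smooth_on (snd c ` fst c) (\<lambda>y. cov2_in \<A> c g y u v)"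
  and smooth_J_in_chart: "c \<in> \<A> \<Longrightarrow> smooth_on (snd c ` fst c) (\<lambda>y. endo_in \<A> c J y u)"
  using hermitian_structure unfolding almost_eps_hermitian_def smooth_metric_def smooth_endo_def by blast+

lemma local_structure_in_chart:
  assumes c: "c \<in> \<A>" "p \<in> fst c"
  shows "local_structure (snd c ` fst c) (snd c p) (cov2_in \<A> c g) (endo_in \<A> c J) \<epsilon>"
proof (rule local_structure.intro)
  show "open (snd c ` fst c)" by (rule open_dom[OF c(1)])
  show "snd c p \<in> snd c ` fst c" using c by blast
  show "eps_hermitian (cov2_in \<A> c g y) (endo_in \<A> c J y) \<epsilon>" if "y \<in> snd c ` fst c" for y
    using that eps_hermitian_in_chart[OF c(1)] by blast
qed (rule smooth_g_in_chart[OF c(1)], rule smooth_J_in_chart[OF c(1)])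

lemma omega_in_chart: "c \<in> \<A> \<Longrightarrow> y \<in> snd c ` fst c \<Longrightarrow>
    cov2_in \<A> c \<omega> y u v = cov2_in \<A> c g y u (endo_in \<A> c J y v)"
  by (auto simp: cov2_in_at omega_eq chart_topspace tangent_of_endo_in)

lemma two_form_omega: "two_form \<omega>"
  unfolding two_form_def
proof (intro conjI ballI allI)
  fix p assume p: "p \<in> topspace M"
  interpret eps_hermitian "g p" "J p" \<epsilon> by (rule eps_hermitian_at[OF p])
  show "linear (\<lambda>u. \<omega> p u v)" for v unfolding omega_eq[OF p] by (rule linear_g)
  show "\<omega> p u v = - \<omega> p v u" for u v unfolding omega_eq[OF p] by (rule g_j_skew)
next
  fix c u v assume c: "c \<in> \<A>"
  show "smooth_on (snd c ` fst c) (\<lambda>x. cov2_in \<A> c \<omega> x u v)"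
  \<comment> \<open>A chart with empty domain offers no base point for
    \<open>local_structure\<close>.\<close>
  proof (cases "fst c = {}")
    case True then show ?thesis by (intro smooth_on_cong[OF _ smooth_on_const[of _ 0]]) auto
  next
    case False
    then obtain p where p: "p \<in> fst c" by blast
    interpret local_structure "snd c ` fst c" "snd c p" "cov2_in \<A> c g" "endo_in \<A> c J" \<epsilon>
      by (rule local_structure_in_chart[OF c p])
    have "smooth_on (snd c ` fst c) (\<lambda>y. cov2_in \<A> c g y u (endo_in \<A> c J y v))"
      by (rule smooth_on_apply_linear[OF open_S lin_G(1) smooth_g_in_chart[OF c] smooth_J_in_chart[OF c]])
    then show ?thesis
      by (rule smooth_on_cong[OF open_S]) (simp add: omega_in_chart[OF c])
  qed
qed

lemma ext_deriv2_omega_in_chart: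
  assumes c: "c \<in> \<A>" "p \<in> fst c"
  shows "ext_deriv2 \<A> \<omega> p (tangent_of \<A> c p u) (tangent_of \<A> c p v) (tangent_of \<A> c p w) =
    dform2 (\<lambda>y u v. cov2_in \<A> c g y u (endo_in \<A> c J y v)) (snd c p) u v w"
proof -
  have "dform2 (cov2_in \<A> c \<omega>) (snd c p) =
      dform2 (\<lambda>y u v. cov2_in \<A> c g y u (endo_in \<A> c J y v)) (snd c p)"
    by (rule dform2_cong_open[OF open_dom[OF c(1)]]) (use c omega_in_chart[OF c(1)] in auto)
  then show ?thesis using ext_deriv2_in_chart[OF two_form_omega c] by simp
qed

context
  fixes p assumes p: "p \<in> topspace M"
begin

lemma in_preferred_chart: "(chart_at \<A> p) \<in> \<A>" "p \<in> fst (chart_at \<A> p)"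
  using chart_at_in[OF p] in_chart_at[OF p] .

lemma at_chart_at: "cov2_in \<A> (chart_at \<A> p) g (snd (chart_at \<A> p) p) = g p" "endo_in \<A> (chart_at \<A> p) J (snd (chart_at \<A> p) p) = J p"
    "cov3_in \<A> (chart_at \<A> p) \<beta> (snd (chart_at \<A> p) p) = \<beta> p"
  by (simp_all add: fun_eq_iff cov2_in_at[OF in_preferred_chart] endo_in_at[OF in_preferred_chart] cov3_in_at[OF in_preferred_chart]
      tangent_of_chart_at[OF p] coords_of_chart_at[OF p])

lemma local_connection_at:
  "local_connection (snd (chart_at \<A> p) ` fst (chart_at \<A> p)) (snd (chart_at \<A> p) p) (cov2_in \<A> (chart_at \<A> p) g) (endo_in \<A> (chart_at \<A> p) J) \<epsilon> (christoffel \<A> g p)"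
proof -
  interpret local_structure "snd (chart_at \<A> p) ` fst (chart_at \<A> p)" "snd (chart_at \<A> p) p" "cov2_in \<A> (chart_at \<A> p) g" "endo_in \<A> (chart_at \<A> p) J" \<epsilon>
    by (rule local_structure_in_chart[OF in_preferred_chart])
  have "christoffel \<A> g p = (THE \<Gamma>. levi_civita_form \<Gamma>)"
    unfolding christoffel_def Let_def levi_civita_form_def at_chart_at ..
  moreover have "levi_civita_form (THE \<Gamma>. levi_civita_form \<Gamma>)"
    using theI'[OF levi_civita_form_ex1] by simp
  ultimately show ?thesis by unfold_locales simp
qed

interpretation local_connection "snd (chart_at \<A> p) ` fst (chart_at \<A> p)" "snd (chart_at \<A> p) p" "cov2_in \<A> (chart_at \<A> p) g" "endo_in \<A> (chart_at \<A> p) J" \<epsilon> "christoffel \<A> g p"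
  by (rule local_connection_at)

lemma nabla_endo_eq: "nabla_endo \<A> g J p = nabla_J"
proof (intro ext)
  fix u v
  have "vfield_in \<A> (chart_at \<A> p) (\<lambda>q. J q (tangent_of \<A> (chart_at \<A> p) q v)) = (\<lambda>x. endo_in \<A> (chart_at \<A> p) J x v)"
    by (simp add: fun_eq_iff vfield_in_def endo_in_def)
  moreover have "frechet_derivative (vfield_in \<A> (chart_at \<A> p) (\<lambda>q. tangent_of \<A> (chart_at \<A> p) q v)) (at (snd (chart_at \<A> p) p)) = (\<lambda>a. 0)"
  proof -
    have "frechet_derivative (vfield_in \<A> (chart_at \<A> p) (\<lambda>q. tangent_of \<A> (chart_at \<A> p) q v)) (at (snd (chart_at \<A> p) p)) =
        frechet_derivative (\<lambda>y. v) (at (snd (chart_at \<A> p) p))"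
      by (rule frechet_derivative_cong_open[OF open_S x_S])
        (use in_preferred_chart in \<open>auto simp: vfield_in_def coords_tangent\<close>)
    then show ?thesis by simp
  qed
  ultimately show "nabla_endo \<A> g J p u v = nabla_J u v"
    unfolding nabla_endo_def levi_civita_def Let_def nabla_J_def
    by (simp add: tangent_of_chart_at[OF p] at_chart_at)
qed

lemma nabla_endo_linear: "linear (\<lambda>a. nabla_endo \<A> g J p a u)" "linear (nabla_endo \<A> g J p a)"
  using nabla_J_linear unfolding nabla_endo_eq by blast+

lemma nabla_endo_J: "nabla_endo \<A> g J p a (J p u) = - J p (nabla_endo \<A> g J p a u)"
  using nabla_J_J unfolding nabla_endo_eq at_chart_at .

lemma nabla_endo_skew: "g p u (nabla_endo \<A> g J p a v) = - g p v (nabla_endo \<A> g J p a u)"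
  using nabla_J_skew unfolding nabla_endo_eq at_chart_at .

lemma ext_deriv2_omega: "ext_deriv2 \<A> \<omega> p u v w =
    g p v (nabla_endo \<A> g J p u w) + g p w (nabla_endo \<A> g J p v u) + g p u (nabla_endo \<A> g J p w v)"
  using ext_deriv2_omega_in_chart[OF in_preferred_chart, of u v w] dform2_omega[of u v w]
  unfolding nabla_endo_eq at_chart_at tangent_of_chart_at[OF p] by simp

end


end

text \<open>Common ground of the two implications: \<open>\<psi>\<close> is a third of d omega in
  one and the real part of \<open>\<Psi>\<close> in the other. Nothing here yet says that nabla
  omega equals \<open>\<psi>\<close>.\<close>

locale closed_structure_form = hermitian_mfd +
  fixes \<psi> :: "('a, 6) cov3"
  assumes three_form_psi: "three_form M \<A> \<psi>"
    and psi_J: "p \<in> topspace M \<Longrightarrow> \<psi> p (J p u) v w = \<psi> p u (J p v) w"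
    and d_omega: "p \<in> topspace M \<Longrightarrow> ext_deriv2 \<A> \<omega> p u v w = 3 * \<psi> p u v w"
begin

lemma psi_linear: "p \<in> topspace M \<Longrightarrow> linear (\<lambda>u. \<psi> p u v w)"
  and psi_skew: "p \<in> topspace M \<Longrightarrow> \<psi> p u v w = - \<psi> p v u w"
    "p \<in> topspace M \<Longrightarrow> \<psi> p u v w = - \<psi> p u w v"
  and smooth_psi: "c \<in> \<A> \<Longrightarrow> smooth_on (snd c ` fst c) (\<lambda>y. cov3_in \<A> c \<psi> y u v w)"
  using three_form_psi unfolding three_form_def by blast+

lemma psi_in_chart_properties:
  assumes c: "c \<in> \<A>" "p \<in> fst c"
  defines "P \<equiv> cov3_in \<A> c \<psi> (snd c p)" and "j \<equiv> endo_in \<A> c J (snd c p)"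
  shows "linear (\<lambda>u. P u v w)" "P u v w = - P v u w" "P u v w = - P u w v" "P (j u) v w = P u (j v) w"
proof -
  note p = chart_topspace[OF c]
  show "linear (\<lambda>u. P u v w)"
    unfolding P_def cov3_in_at[OF c]
    by (rule linear_compose[OF linear_tangent_of[OF c] psi_linear[OF p], unfolded o_def])
  show "P u v w = - P v u w" "P u v w = - P u w v"
    unfolding P_def cov3_in_at[OF c] by (rule psi_skew[OF p])+
  show "P (j u) v w = P u (j v) w"
    unfolding P_def j_def cov3_in_at[OF c] tangent_of_endo_in[OF c] by (rule psi_J[OF p])
qed

lemma dform2_omega_in_chart:
  assumes c: "c \<in> \<A>" "p \<in> fst c"
  shows "dform2 (\<lambda>y u v. cov2_in \<A> c g y u (endo_in \<A> c J y v)) (snd c p) u v w =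
    3 * cov3_in \<A> c \<psi> (snd c p) u v w"
  using ext_deriv2_omega_in_chart[OF c, of u v w] d_omega[OF chart_topspace[OF c]]
  by (simp add: cov3_in_at[OF c])

text \<open>Throughout the chart \<open>\<psi>\<close> is d of omega/3, so d d = 0 applies.\<close>

lemma psi_closed_in_chart:
  assumes c: "c \<in> \<A>" "p \<in> fst c"
  shows "dform3 (cov3_in \<A> c \<psi>) (snd c p) u v w z = 0"
proof -
  let ?S = "snd c ` fst c"
  let ?a = "\<lambda>y u v. 1 / 3 * cov2_in \<A> c \<omega> y u v"
  have S: "open ?S" "snd c p \<in> ?S" using open_dom c by auto
  have sm: "smooth_on ?S (\<lambda>y. cov2_in \<A> c \<omega> y u v)" for u v
    using two_form_omega c(1) unfolding two_form_def by blast
  have sa: "smooth_on ?S (\<lambda>y. ?a y u v)" for u v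
    by (rule smooth_on_mult[OF S(1) smooth_on_const sm])
  have "cov3_in \<A> c \<psi> y u v w = dform2 ?a y u v w" if y: "y \<in> ?S" for y u v w
  proof -
    have D: "frechet_derivative (\<lambda>y. ?a y u v) (at y) h =
        1 / 3 * frechet_derivative (\<lambda>y. cov2_in \<A> c \<omega> y u v) (at y) h" for u v h
      by (rule fun_cong[OF frechet_derivative_at[OF
          has_derivative_mult_right[OF smooth_on_has_derivative[OF sm y]]], symmetric])
    have "dform2 ?a y u v w = dform2 (cov2_in \<A> c \<omega>) y u v w / 3"
      unfolding dform2_def D by (simp add: field_simps)
    moreover obtain q where q: "q \<in> fst c" "y = snd c q" using y by blast
    moreover have "dform2 (cov2_in \<A> c \<omega>) y u v w = 3 * cov3_in \<A> c \<psi> y u v w"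
      using ext_deriv2_in_chart[OF two_form_omega c(1) q(1), of u v w] d_omega[OF chart_topspace[OF c(1) q(1)]]
      by (simp add: q(2) cov3_in_at[OF c(1) q(1)])
    ultimately show ?thesis by simp
  qed
  then have "dform3 (cov3_in \<A> c \<psi>) (snd c p) = dform3 (dform2 ?a) (snd c p)"
    by (intro dform3_cong_open[OF S]) auto
  then show ?thesis using dform3_dform2[OF S sa] by simp
qed

lemma local_form_in_chart:
  assumes c: "c \<in> \<A>" "p \<in> fst c"
    and "local_connection (snd c ` fst c) (snd c p) (cov2_in \<A> c g) (endo_in \<A> c J) \<epsilon> \<Gamma>"
  shows "local_form (snd c ` fst c) (snd c p) (cov2_in \<A> c g) (endo_in \<A> c J) \<epsilon> \<Gamma> (cov3_in \<A> c \<psi>)"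
proof (rule local_form.intro[OF assms(3)], rule local_form_axioms.intro)
  fix y u v w z assume "y \<in> snd c ` fst c"
  then obtain q where q: "q \<in> fst c" "y = snd c q" by blast
  show "linear (\<lambda>u. cov3_in \<A> c \<psi> y u v w)" "cov3_in \<A> c \<psi> y u v w = - cov3_in \<A> c \<psi> y v u w"
    "cov3_in \<A> c \<psi> y u v w = - cov3_in \<A> c \<psi> y u w v"
    "cov3_in \<A> c \<psi> y (endo_in \<A> c J y u) v w = cov3_in \<A> c \<psi> y u (endo_in \<A> c J y v) w"
    unfolding q(2) by (rule psi_in_chart_properties[OF c(1) q(1)])+
next
  show "smooth_on (snd c ` fst c) (\<lambda>y. cov3_in \<A> c \<psi> y u v w)" for u v w by (rule smooth_psi[OF c(1)])
  show "dform3 (cov3_in \<A> c \<psi>) (snd c p) u v w z = 0" for u v w z by (rule psi_closed_in_chart[OF c])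
qed

lemma J_psi_in_chart:
  assumes \<beta>: "\<And>p u v w. p \<in> topspace M \<Longrightarrow> \<beta> p u v w = \<epsilon> * \<psi> p (J p u) v w"
    and c: "c \<in> \<A>" and y: "y \<in> snd c ` fst c"
  shows "cov3_in \<A> c \<beta> y u v w = \<epsilon> * cov3_in \<A> c \<psi> y (endo_in \<A> c J y u) v w"
proof -
  obtain q where q: "q \<in> fst c" "y = snd c q" using y by blast
  show ?thesis
    unfolding q(2) cov3_in_at[OF c q(1)] \<beta>[OF chart_topspace[OF c q(1)]] tangent_of_endo_in[OF c q(1)] ..
qed

lemma three_form_J_psi: "three_form M \<A> (\<lambda>p u v w. \<epsilon> * \<psi> p (J p u) v w)"
  unfolding three_form_def
proof (intro conjI ballI allI)
  fix p assume p: "p \<in> topspace M"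
  interpret eps_hermitian "g p" "J p" \<epsilon> by (rule eps_hermitian_at[OF p])
  show "linear (\<lambda>u. \<epsilon> * \<psi> p (J p u) v w)" for v w
    by (rule linear_times(1)[OF linear_compose[OF linear_j psi_linear[OF p], unfolded o_def]])
  show "\<epsilon> * \<psi> p (J p u) v w = - (\<epsilon> * \<psi> p (J p v) u w)" for u v w
    using psi_J[OF p, of u v w] psi_skew(1)[OF p, of u "J p v" w] by simp
  show "\<epsilon> * \<psi> p (J p u) v w = - (\<epsilon> * \<psi> p (J p u) w v)" for u v w
    using psi_skew(2)[OF p, of "J p u" v w] by simp
next
  fix c u v w assume c: "c \<in> \<A>"
  let ?S = "snd c ` fst c"
  have lin: "linear (\<lambda>u. cov3_in \<A> c \<psi> y u v w)" if "y \<in> ?S" for y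
    using that psi_in_chart_properties(1)[OF c] by blast
  have "smooth_on ?S (\<lambda>y. \<epsilon> * cov3_in \<A> c \<psi> y (endo_in \<A> c J y u) v w)"
    by (rule smooth_on_mult[OF open_dom[OF c] smooth_on_const
          smooth_on_apply_linear[where F = "\<lambda>y u. cov3_in \<A> c \<psi> y u v w",
            OF open_dom[OF c] lin smooth_psi[OF c] smooth_J_in_chart[OF c]]])
  then show "smooth_on ?S (\<lambda>y. cov3_in \<A> c (\<lambda>p u v w. \<epsilon> * \<psi> p (J p u) v w) y u v w)"
    by (rule smooth_on_cong[OF open_dom[OF c]]) (rule J_psi_in_chart[OF _ c, symmetric], simp_all)
qed

lemma ext_deriv3_J_psi_in_chart:
  assumes \<beta>: "three_form M \<A> \<beta>" "\<And>p u v w. p \<in> topspace M \<Longrightarrow> \<beta> p u v w = \<epsilon> * \<psi> p (J p u) v w"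
    and c: "c \<in> \<A>" "p \<in> fst c"
  shows "ext_deriv3 \<A> \<beta> p (tangent_of \<A> c p u) (tangent_of \<A> c p v) (tangent_of \<A> c p w) (tangent_of \<A> c p z) =
    dform3 (\<lambda>y u v w. \<epsilon> * cov3_in \<A> c \<psi> y (endo_in \<A> c J y u) v w) (snd c p) u v w z"
proof -
  have "dform3 (cov3_in \<A> c \<beta>) (snd c p) =
      dform3 (\<lambda>y u v w. \<epsilon> * cov3_in \<A> c \<psi> y (endo_in \<A> c J y u) v w) (snd c p)"
    by (rule dform3_cong_open[OF open_dom[OF c(1)]]) (use c J_psi_in_chart[OF \<beta>(2) c(1)] in auto)
  then show ?thesis using ext_deriv3_in_chart[OF \<beta>(1) c] by simp
qed

text \<open>Hides chart and frame: \<open>B\<close> matters only through the jet axioms and the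
  formula for d psi^-. The form \<open>\<beta>\<close> has to agree with psi^- on the manifold only,
  which is all that is known of \<open>\<Psi>\<close>.\<close>

lemma form_jet_at:
  assumes p: "p \<in> topspace M"
  obtains e1 e2 e3 s1 s2 s3 B where
    "form_jet (g p) (J p) \<epsilon> e1 e2 e3 s1 s2 s3 (\<psi> p) (nabla_endo \<A> g J p) B"
    "\<And>\<beta> u v w z. three_form M \<A> \<beta> \<Longrightarrow> (\<And>p u v w. p \<in> topspace M \<Longrightarrow> \<beta> p u v w = \<epsilon> * \<psi> p (J p u) v w) \<Longrightarrow>
      ext_deriv3 \<A> \<beta> p u v w z = alt4 (form_jet.C (J p) \<epsilon> (\<psi> p) (nabla_endo \<A> g J p) B) u v w z"
proof -
  let ?c = "chart_at \<A> p"
  note c = in_preferred_chart[OF p]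
  interpret local_form "snd ?c ` fst ?c" "snd ?c p" "cov2_in \<A> ?c g" "endo_in \<A> ?c J" \<epsilon>
      "christoffel \<A> g p" "cov3_in \<A> ?c \<psi>"
    by (rule local_form_in_chart[OF c local_connection_at[OF p]])
  obtain e1 e2 e3 s1 s2 s3 where F:
    "hermitian_frame (cov2_in \<A> ?c g (snd ?c p)) (endo_in \<A> ?c J (snd ?c p)) \<epsilon> e1 e2 e3 s1 s2 s3"
    using h.hermitian_frame_exists by fastforce
  note jet = form_jet[OF F, unfolded at_chart_at[OF p] nabla_endo_eq[OF p, symmetric]]
  note dJ = dform3_J[OF F, unfolded at_chart_at[OF p] nabla_endo_eq[OF p, symmetric]]
  show thesis
  proof (rule that[OF jet])
    fix \<beta> u v w z assume \<beta>: "three_form M \<A> \<beta>" "\<And>p u v w. p \<in> topspace M \<Longrightarrow> \<beta> p u v w = \<epsilon> * \<psi> p (J p u) v w"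
    show "ext_deriv3 \<A> \<beta> p u v w z = alt4 (form_jet.C (J p) \<epsilon> (\<psi> p) (nabla_endo \<A> g J p) nabla_P) u v w z"
      using ext_deriv3_J_psi_in_chart[OF \<beta> c, of u v w z] unfolding dJ tangent_of_chart_at[OF p] .
  qed
qed

lemma wedge22_omega:
  "p \<in> topspace M \<Longrightarrow> wedge22 \<omega> \<omega> p u v w z = 2 * (g p u (J p v) * g p w (J p z)
    - g p u (J p w) * g p v (J p z) + g p u (J p z) * g p v (J p w))"
  by (simp add: wedge22_def omega_eq algebra_simps)

end

context closed_structure_form begin

lemma frame_sum3_psi:
  assumes p: "p \<in> topspace M"
    and \<Psi>: "\<And>u v w. \<Psi> u v w = (\<psi> p u v w, \<epsilon> * \<psi> p (J p u) v w)"
  shows "frame_sum3 (g p) (\<lambda>u v w. eps_sqmod \<epsilon> (\<Psi> u v w)) = 2 * frame_sum3 (g p) (\<lambda>u v w. (\<psi> p u v w)\<^sup>2)"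
proof -
  obtain e1 e2 e3 s1 s2 s3 B where "form_jet (g p) (J p) \<epsilon> e1 e2 e3 s1 s2 s3 (\<psi> p) (nabla_endo \<A> g J p) B"
    using form_jet_at[OF p] by metis
  then have F: "form30_frame (g p) (J p) \<epsilon> e1 e2 e3 s1 s2 s3 (\<psi> p)" by (rule form_jet.axioms)
  show ?thesis
    unfolding \<Psi> by (simp add: frame_sum3_eps_sqmod[OF F] frame_sum3_form30[OF F])
qed

lemma sqnorm_nabla_eq:
  assumes p: "p \<in> topspace M" and nk: "\<And>u v w. g p v (nabla_endo \<A> g J p u w) = \<psi> p u v w"
  shows "sqnorm_nabla \<A> g J p = frame_sum3 (g p) (\<lambda>u v w. (\<psi> p u v w)\<^sup>2)"
proof -
  interpret eps_hermitian "g p" "J p" \<epsilon> by (rule eps_hermitian_at[OF p])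
  have "(g p (nabla_endo \<A> g J p u v) w)\<^sup>2 = (\<psi> p u v w)\<^sup>2" for u v w
    using nk[of w u v] g_sym[of w] psi_skew(2)[OF p, of u v w] by simp
  then show ?thesis by (simp add: sqnorm_nabla_def)
qed

lemma ext_deriv3_J_psi:
  assumes p: "p \<in> topspace M" and nk: "\<And>u v w. g p v (nabla_endo \<A> g J p u w) = \<psi> p u v w"
    and \<beta>: "three_form M \<A> \<beta>" "\<And>p u v w. p \<in> topspace M \<Longrightarrow> \<beta> p u v w = \<epsilon> * \<psi> p (J p u) v w"
  shows "ext_deriv3 \<A> \<beta> p u v w z = 2 * (sqnorm_nabla \<A> g J p / 4) * wedge22 \<omega> \<omega> p u v w z"
proof -
  obtain e1 e2 e3 s1 s2 s3 B where jet: "form_jet (g p) (J p) \<epsilon> e1 e2 e3 s1 s2 s3 (\<psi> p) (nabla_endo \<A> g J p) B"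
    and d: "\<And>\<beta> u v w z. three_form M \<A> \<beta> \<Longrightarrow> (\<And>p u v w. p \<in> topspace M \<Longrightarrow> \<beta> p u v w = \<epsilon> * \<psi> p (J p u) v w) \<Longrightarrow>
      ext_deriv3 \<A> \<beta> p u v w z = alt4 (form_jet.C (J p) \<epsilon> (\<psi> p) (nabla_endo \<A> g J p) B) u v w z"
    using form_jet_at[OF p] by metis
  interpret form_jet "g p" "J p" \<epsilon> e1 e2 e3 s1 s2 s3 "\<psi> p" "nabla_endo \<A> g J p" B by fact
  have "sqnorm_nabla \<A> g J p / 4 = kap"
    unfolding sqnorm_nabla_eq[OF p nk]
    using frame_sum3_form30[OF form30_frame_axioms] by (simp add: kap_def al_def be_def)
  moreover have "ext_deriv3 \<A> \<beta> p u v w z = alt4 C u v w z" by (rule d[OF \<beta>(1)]) (rule \<beta>(2))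
  ultimately show ?thesis
    unfolding alt4_C_eq[OF nk] W_def wedge22_omega[OF p] by simp
qed

lemma sqnorm_constant:
  assumes conn: "connected_space M"
    and nk: "\<And>p u v w. p \<in> topspace M \<Longrightarrow> g p v (nabla_endo \<A> g J p u w) = \<psi> p u v w"
    and p: "p \<in> topspace M" and q: "q \<in> topspace M"
  shows "sqnorm_nabla \<A> g J q = sqnorm_nabla \<A> g J p"
proof (rule locally_constant_connected[OF conn _ p q])
  fix p assume p: "p \<in> topspace M"
  define c where "c = chart_at \<A> p"
  have c: "c \<in> \<A>" "p \<in> fst c" using in_preferred_chart[OF p] by (auto simp: c_def)
  let ?S = "snd c ` fst c" and ?\<phi> = "\<lambda>p u v w. \<epsilon> * \<psi> p (J p u) v w"
  define k where "k y = sqnorm_nabla \<A> g J (chart_inv c y) / 4" for y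
  have D: "(k has_derivative (\<lambda>a. 0)) (at y)" if y: "y \<in> ?S" for y
  proof -
    obtain q where q: "q \<in> fst c" "y = snd c q" using y by blast
    have local_c: "local_structure ?S y (cov2_in \<A> c g) (endo_in \<A> c J) \<epsilon>"
      using local_structure_in_chart[OF c(1) q(1)] q(2) by simp
    interpret ls: local_structure ?S y "cov2_in \<A> c g" "endo_in \<A> c J" \<epsilon> by (rule local_c)
    \<comment> \<open>\<open>christoffel\<close> refers to the preferred chart at \<open>q\<close>,
      which may differ from \<open>c\<close>; the connection is therefore taken afresh in
      \<open>c\<close>.\<close>
    obtain \<Gamma> where "ls.levi_civita_form \<Gamma>" using ls.levi_civita_form_ex1 by auto
    then have "local_connection ?S y (cov2_in \<A> c g) (endo_in \<A> c J) \<epsilon> \<Gamma>" by unfold_locales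
    then interpret local_form ?S y "cov2_in \<A> c g" "endo_in \<A> c J" \<epsilon> \<Gamma> "cov3_in \<A> c \<psi>"
      using local_form_in_chart[OF c(1) q(1)] q(2) by simp
    obtain e1 e2 e3 s1 s2 s3 where F:
      "hermitian_frame (cov2_in \<A> c g y) (endo_in \<A> c J y) \<epsilon> e1 e2 e3 s1 s2 s3"
      using ls.h.hermitian_frame_exists by fastforce
    show ?thesis
    proof (rule structure_function_stationary[OF F])
      show "dform2 (\<lambda>y u v. cov2_in \<A> c g y u (endo_in \<A> c J y v)) y u v w = 3 * cov3_in \<A> c \<psi> y u v w" for u v w
        using dform2_omega_in_chart[OF c(1) q(1)] q(2) by simp
      fix y' u v w z assume "y' \<in> ?S"
      then obtain r where r: "r \<in> fst c" "y' = snd c r" by blast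
      note rM = chart_topspace[OF c(1) r(1)]
      have "dform3 (\<lambda>y u v w. \<epsilon> * cov3_in \<A> c \<psi> y (endo_in \<A> c J y u) v w) y' u v w z =
          ext_deriv3 \<A> ?\<phi> r (tangent_of \<A> c r u) (tangent_of \<A> c r v) (tangent_of \<A> c r w) (tangent_of \<A> c r z)"
        unfolding r(2) by (rule ext_deriv3_J_psi_in_chart[OF three_form_J_psi refl c(1) r(1), symmetric])
      also have "\<dots> = 2 * k y' * omega_sq y' u v w z"
        unfolding ext_deriv3_J_psi[OF rM nk[OF rM] three_form_J_psi refl] wedge22_omega[OF rM] omega_sq_def
        using c(1) r by (simp add: k_def cov2_in_at tangent_of_endo_in)
      finally show "dform3 (\<lambda>y u v w. \<epsilon> * cov3_in \<A> c \<psi> y (endo_in \<A> c J y u) v w) y' u v w z =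
          2 * k y' * omega_sq y' u v w z" .
    qed
  qed
  obtain r where r: "r > 0" "ball (snd c p) r \<subseteq> ?S" using open_dom[OF c(1)] c(2) openE by blast
  let ?V = "{q \<in> fst c. snd c q \<in> ball (snd c p) r}"
  have "sqnorm_nabla \<A> g J q = sqnorm_nabla \<A> g J p" if q: "q \<in> ?V" for q
  proof -
    have "\<exists>l. \<forall>y\<in>ball (snd c p) r. k y = l"
    proof (rule has_derivative_zero_constant)
      show "(k has_derivative (\<lambda>h. 0)) (at y within ball (snd c p) r)" if "y \<in> ball (snd c p) r" for y
        by (rule has_derivative_at_withinI[OF D]) (use r(2) that in blast)
    qed (rule convex_ball)
    then have "k (snd c q) = k (snd c p)" using q r(1) by (metis (no_types, lifting) centre_in_ball mem_Collect_eq)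
    then show ?thesis using c q by (simp add: k_def)
  qed
  moreover have "openin M ?V" by (rule open_preimage[OF c(1)]) simp
  moreover have "p \<in> ?V" using c(2) r(1) by simp
  ultimately show "\<exists>V. openin M V \<and> p \<in> V \<and> (\<forall>q\<in>V. sqnorm_nabla \<A> g J q = sqnorm_nabla \<A> g J p)"
    by blast
qed

end

section \<open>The structure form of a nearly \<open>\<epsilon>\<close>-Kaehler manifold\<close>

context hermitian_mfd begin

text \<open>Polarising the nearly Kaehler condition makes nabla omega alternating, so d omega, its
  cyclic sum, is three times nabla omega. \<open>\<psi>\<close> is defined through d omega because
  smoothness is then immediate in a chart.\<close>

lemma nearly_kaehler_closed_structure_form:
  assumes nk: "nearly_kaehler M \<A> g J"
  defines "\<psi> \<equiv> \<lambda>p u v w. ext_deriv2 \<A> \<omega> p u v w / 3"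
  shows "closed_structure_form M \<A> \<epsilon> g J \<omega> \<psi>"
    and "\<And>p u v w. p \<in> topspace M \<Longrightarrow> g p v (nabla_endo \<A> g J p u w) = \<psi> p u v w"
proof -
  define T where "T p u v w = g p v (nabla_endo \<A> g J p u w)" for p u v w
  have T23: "T p u v w = - T p u w v" if "p \<in> topspace M" for p u v w
    unfolding T_def by (rule nabla_endo_skew[OF that])
  have nabla_skew: "nabla_endo \<A> g J p u w = - nabla_endo \<A> g J p w u" if p: "p \<in> topspace M" for p u w
  proof -
    have "nabla_endo \<A> g J p (u + w) (u + w) = 0" "nabla_endo \<A> g J p u u = 0" "nabla_endo \<A> g J p w w = 0"
      using nk p by (auto simp: nearly_kaehler_def)
    then show ?thesis
      by (simp add: linear_add[OF nabla_endo_linear(1)[OF p]] linear_add[OF nabla_endo_linear(2)[OF p]] eq_neg_iff_add_eq_0 add.commute)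
  qed
  have T13: "T p u v w = - T p w v u" if p: "p \<in> topspace M" for p u v w
  proof -
    interpret eps_hermitian "g p" "J p" \<epsilon> by (rule eps_hermitian_at[OF p])
    show ?thesis unfolding T_def using nabla_skew[OF p, of u w] by simp
  qed
  have T12: "T p u v w = - T p v u w" if "p \<in> topspace M" for p u v w
    using T23[OF that, of u v w] T13[OF that, of u w v] T23[OF that, of v w u] by linarith
  have \<psi>_T: "\<psi> p u v w = T p u v w" if p: "p \<in> topspace M" for p u v w
    using ext_deriv2_omega[OF p, of u v w] T12[OF p, of u v w] T23[OF p, of v u w] T13[OF p, of w u v] T23[OF p, of v w u]
    by (simp add: \<psi>_def T_def)
  show "g p v (nabla_endo \<A> g J p u w) = \<psi> p u v w" if "p \<in> topspace M" for p u v w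
    using \<psi>_T[OF that] by (simp add: T_def)
  have T_J23: "T p u (J p v) w = T p u v (J p w)" if p: "p \<in> topspace M" for p u v w
  proof -
    interpret eps_hermitian "g p" "J p" \<epsilon> by (rule eps_hermitian_at[OF p])
    show ?thesis unfolding T_def by (simp add: nabla_endo_J[OF p] g_j_left)
  qed
  show "closed_structure_form M \<A> \<epsilon> g J \<omega> \<psi>"
  proof (rule closed_structure_form.intro[OF hermitian_mfd_axioms], rule closed_structure_form_axioms.intro)
    show "ext_deriv2 \<A> \<omega> p u v w = 3 * \<psi> p u v w" for p u v w by (simp add: \<psi>_def)
    \<comment> \<open>\<open>J\<close> anticommutes with nabla J, which gives the type condition in
      the last two slots; skewness carries it to the first two.\<close>
    show "\<psi> p (J p u) v w = \<psi> p u (J p v) w" if p: "p \<in> topspace M" for p u v w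
      unfolding \<psi>_T[OF p]
      using T12[OF p, of "J p u" v w] T_J23[OF p, of v u w] T12[OF p, of v u "J p w"] T_J23[OF p, of u v w]
      by linarith
    show "three_form M \<A> \<psi>"
      unfolding three_form_def
    proof (intro conjI ballI allI)
      fix p assume p: "p \<in> topspace M"
      interpret eps_hermitian "g p" "J p" \<epsilon> by (rule eps_hermitian_at[OF p])
      show "linear (\<lambda>u. \<psi> p u v w)" for v w
        unfolding \<psi>_T[OF p] T_def
        by (rule linear_compose[OF nabla_endo_linear(1)[OF p] linear_g(1), unfolded o_def])
      show "\<psi> p u v w = - \<psi> p v u w" "\<psi> p u v w = - \<psi> p u w v" for u v w
        unfolding \<psi>_T[OF p] by (rule T12[OF p], rule T23[OF p])
    next
      fix c u v w assume c: "c \<in> \<A>"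
      let ?S = "snd c ` fst c"
      have "smooth_on ?S (\<lambda>y. cov2_in \<A> c \<omega> y u v)" for u v
        using two_form_omega c unfolding two_form_def by blast
      then have "smooth_on ?S (\<lambda>y. 1 / 3 * dform2 (cov2_in \<A> c \<omega>) y u v w)"
        by (intro smooth_on_mult[OF open_dom[OF c] smooth_on_const] smooth_on_dform2[OF open_dom[OF c]])
      then show "smooth_on ?S (\<lambda>y. cov3_in \<A> c \<psi> y u v w)"
      proof (rule smooth_on_cong[OF open_dom[OF c]])
        fix y assume "y \<in> ?S"
        then obtain q where q: "q \<in> fst c" "y = snd c q" by blast
        show "1 / 3 * dform2 (cov2_in \<A> c \<omega>) y u v w = cov3_in \<A> c \<psi> y u v w"
          using ext_deriv2_in_chart[OF two_form_omega c q(1), of u v w]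
          by (simp add: q(2) cov3_in_at[OF c q(1)] \<psi>_def)
      qed
    qed
  qed
qed

end

section \<open>Extension of real multilinear maps to \<open>\<epsilon>\<close>-complex
  vectors\<close>

lemma ieps_times_simps [simp]:
  "ieps_times \<epsilon> (a + b) = ieps_times \<epsilon> a + ieps_times \<epsilon> b" "ieps_times \<epsilon> (- a) = - ieps_times \<epsilon> a"
  "ieps_times \<epsilon> 0 = 0"
  by (simp_all add: ieps_times_def scaleR_add_right prod_eq_iff)

text \<open>A (0,1)-vector has the form \<open>- j y\<close> + i_eps \<open>y\<close>, and the
  contributions of its two parts cancel.\<close>

lemma eps_extend_T01:
  assumes "\<And>x. f (- x) = - f x" "\<And>x. f (j x) = ieps_times \<epsilon> (f x)" "Z \<in> T01 \<epsilon> j"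
  shows "eps_extend \<epsilon> f Z = 0"
proof -
  have "fst Z = - j (snd Z)" using assms(3) by (simp add: T01_def ieps_times_def prod_eq_iff)
  then show ?thesis by (simp add: eps_extend_def assms(1,2))
qed

lemma eps_extend_minus: "eps_extend \<epsilon> (\<lambda>x. - f x) Z = - eps_extend \<epsilon> f Z"
  and eps_extend_ieps_times: "eps_extend \<epsilon> (\<lambda>x. ieps_times \<epsilon> (f x)) Z = ieps_times \<epsilon> (eps_extend \<epsilon> f Z)"
  and eps_extend_zero: "eps_extend \<epsilon> (\<lambda>x. 0) Z = 0"
  by (simp_all add: eps_extend_def)

lemma eps_extend_real: "f 0 = 0 \<Longrightarrow> eps_extend \<epsilon> f (v, 0) = f v"
  by (simp add: eps_extend_def)

lemma eps_extend3_T01: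
  assumes "\<And>u v w. F (- u) v w = - F u v w" "\<And>u v w. F u (- v) w = - F u v w" "\<And>u v w. F u v (- w) = - F u v w"
    and "\<And>u v w. F (j u) v w = ieps_times \<epsilon> (F u v w)" "\<And>u v w. F u (j v) w = ieps_times \<epsilon> (F u v w)"
      "\<And>u v w. F u v (j w) = ieps_times \<epsilon> (F u v w)"
    and "Z1 \<in> T01 \<epsilon> j \<or> Z2 \<in> T01 \<epsilon> j \<or> Z3 \<in> T01 \<epsilon> j"
  shows "eps_extend3 \<epsilon> F Z1 Z2 Z3 = 0"
  using assms(7)
proof (elim disjE)
  have F: "F (- u) v = (\<lambda>w. - F u v w)" "F (j u) v = (\<lambda>w. ieps_times \<epsilon> (F u v w))" for u v
    using assms(1,4) by blast+
  assume "Z1 \<in> T01 \<epsilon> j"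
  then show ?thesis
    unfolding eps_extend3_def
    by (intro eps_extend_T01[where j = j]) (simp_all add: F eps_extend_minus eps_extend_ieps_times)
next
  assume "Z2 \<in> T01 \<epsilon> j"
  then have "eps_extend \<epsilon> (\<lambda>v. eps_extend \<epsilon> (\<lambda>w. F u v w) Z3) Z2 = 0" for u
    by (intro eps_extend_T01[where j = j]) (simp_all add: assms(2,5) eps_extend_minus eps_extend_ieps_times)
  then show ?thesis by (simp add: eps_extend3_def eps_extend_zero)
next
  assume "Z3 \<in> T01 \<epsilon> j"
  then have "eps_extend \<epsilon> (\<lambda>w. F u v w) Z3 = 0" for u v
    by (intro eps_extend_T01[where j = j]) (simp_all add: assms(3,6))
  then show ?thesis by (simp add: eps_extend3_def eps_extend_zero)
qed

lemma T01_I: "linear j \<Longrightarrow> (\<And>u. j (j u) = \<epsilon> *\<^sub>R u) \<Longrightarrow> (- j y, y) \<in> T01 \<epsilon> j"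
  by (simp add: T01_def ieps_times_def linear_neg)

section \<open>The two implications\<close>

context hermitian_mfd begin

lemma structure_equations_of_nearly_kaehler:
  assumes conn: "connected_space M" and nk: "nearly_kaehler M \<A> g J"
    and ne: "\<forall>p\<in>topspace M. sqnorm_nabla \<A> g J p \<noteq> 0"
  shows "\<exists>\<Psi> \<kappa>. su_reduction \<epsilon> M \<A> g J \<Psi> \<and>
       \<kappa> \<noteq> 0 \<and> (\<forall>p\<in>topspace M. \<kappa> = sqnorm_nabla \<A> g J p / 4) \<and>
       (\<forall>p\<in>topspace M. \<forall>u v w. ext_deriv2 \<A> \<omega> p u v w = 3 * fst (\<Psi> p u v w)) \<and>
       (\<forall>p\<in>topspace M. \<forall>u v w z.
          ext_deriv3 \<A> (\<lambda>q a b c. snd (\<Psi> q a b c)) p u v w z = 2 * \<kappa> * wedge22 \<omega> \<omega> p u v w z)"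
proof -
  define \<psi> where "\<psi> = (\<lambda>p u v w. ext_deriv2 \<A> \<omega> p u v w / 3)"
  interpret closed_structure_form M \<A> \<epsilon> g J \<omega> \<psi>
    unfolding \<psi>_def by (rule nearly_kaehler_closed_structure_form(1)[OF nk])
  have nabla: "\<And>p u v w. p \<in> topspace M \<Longrightarrow> g p v (nabla_endo \<A> g J p u w) = \<psi> p u v w"
    unfolding \<psi>_def by (rule nearly_kaehler_closed_structure_form(2)[OF nk])
  define \<Psi> where "\<Psi> p u v w = (\<psi> p u v w, \<epsilon> * \<psi> p (J p u) v w)" for p u v w
  obtain \<kappa> where \<kappa>: "\<kappa> \<noteq> 0" "\<forall>p\<in>topspace M. \<kappa> = sqnorm_nabla \<A> g J p / 4"
  proof (cases "topspace M = {}")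
    \<comment> \<open>On the empty manifold \<open>\<kappa>\<close> is constrained only by
      \<open>\<kappa> \<noteq> 0\<close>.\<close>
    case True then show ?thesis using that[of 1] by simp
  next
    case False
    then obtain p where p: "p \<in> topspace M" by blast
    show ?thesis
    proof (rule that)
      show "sqnorm_nabla \<A> g J p / 4 \<noteq> 0" using ne p by simp
      show "\<forall>q\<in>topspace M. sqnorm_nabla \<A> g J p / 4 = sqnorm_nabla \<A> g J q / 4"
      proof
        fix q assume "q \<in> topspace M"
        from sqnorm_constant[OF conn nabla p this] show "sqnorm_nabla \<A> g J p / 4 = sqnorm_nabla \<A> g J q / 4" by simp
      qed
    qed
  qed
  have "form30 \<epsilon> M \<A> J \<Psi>"
    unfolding form30_def
  proof (intro conjI ballI allI impI)
    show "three_form M \<A> (\<lambda>p u v w. fst (\<Psi> p u v w))" "three_form M \<A> (\<lambda>p u v w. snd (\<Psi> p u v w))"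
      using three_form_psi three_form_J_psi by (simp_all add: \<Psi>_def)
    fix p and Z1 Z2 Z3 :: "(real ^ 6) \<times> (real ^ 6)"
    assume p: "p \<in> topspace M" and Z: "Z1 \<in> T01 \<epsilon> (J p) \<or> Z2 \<in> T01 \<epsilon> (J p) \<or> Z3 \<in> T01 \<epsilon> (J p)"
    obtain e1 e2 e3 s1 s2 s3 B where "form_jet (g p) (J p) \<epsilon> e1 e2 e3 s1 s2 s3 (\<psi> p) (nabla_endo \<A> g J p) B"
      using form_jet_at[OF p] by metis
    then interpret form30_frame "g p" "J p" \<epsilon> e1 e2 e3 s1 s2 s3 "\<psi> p" by (rule form_jet.axioms)
    show "eps_extend3 \<epsilon> (\<Psi> p) Z1 Z2 Z3 = 0"
      by (rule eps_extend3_T01[OF _ _ _ _ _ _ Z])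
        (simp_all add: \<Psi>_def ieps_times_def form_j2 form_j3)
  qed
  \<comment> \<open>The squared length of psi^+ is \<open>4 * \<kappa>\<close>, and psi^- doubles
    it.\<close>
  moreover have "frame_sum3 (g p) (\<lambda>u v w. eps_sqmod \<epsilon> (\<Psi> p u v w)) = 8 * \<kappa>" if p: "p \<in> topspace M" for p
  proof -
    have "\<kappa> = sqnorm_nabla \<A> g J p / 4" using \<kappa>(2) p by blast
    then show ?thesis
      using frame_sum3_psi[OF p, of "\<Psi> p"] sqnorm_nabla_eq[OF p nabla[OF p]] by (simp add: \<Psi>_def)
  qed
  ultimately have "su_reduction \<epsilon> M \<A> g J \<Psi>"
    unfolding su_reduction_def using \<kappa>(1) by (intro conjI exI[of _ "8 * \<kappa>"]) auto
  moreover have "ext_deriv3 \<A> (\<lambda>q a b c. snd (\<Psi> q a b c)) p u v w z = 2 * \<kappa> * wedge22 \<omega> \<omega> p u v w z"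
    if p: "p \<in> topspace M" for p u v w z
  proof -
    have "\<kappa> = sqnorm_nabla \<A> g J p / 4" using \<kappa>(2) p by blast
    then show ?thesis
      using ext_deriv3_J_psi[OF p nabla[OF p] three_form_J_psi refl, of u v w z]
      by (simp only: \<Psi>_def snd_conv)
  qed
  moreover have "ext_deriv2 \<A> \<omega> p u v w = 3 * fst (\<Psi> p u v w)" for p u v w
    by (simp add: \<Psi>_def \<psi>_def)
  ultimately show ?thesis using \<kappa> by blast
qed

lemma nearly_kaehler_of_structure_equations:
  assumes su: "su_reduction \<epsilon> M \<A> g J \<Psi>"
    and d\<omega>: "\<And>p u v w. p \<in> topspace M \<Longrightarrow> ext_deriv2 \<A> \<omega> p u v w = 3 * fst (\<Psi> p u v w)"
    and d\<psi>: "\<And>p u v w z. p \<in> topspace M \<Longrightarrow>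
      ext_deriv3 \<A> (\<lambda>q a b c. snd (\<Psi> q a b c)) p u v w z = 2 * \<kappa> * wedge22 \<omega> \<omega> p u v w z"
  shows "strict_nearly_kaehler M \<A> g J"
proof -
  define \<psi> where "\<psi> p u v w = fst (\<Psi> p u v w)" for p u v w
  define \<beta> where "\<beta> p u v w = snd (\<Psi> p u v w)" for p u v w
  obtain l where l: "l \<noteq> 0" "\<And>p. p \<in> topspace M \<Longrightarrow> frame_sum3 (g p) (\<lambda>u v w. eps_sqmod \<epsilon> (\<Psi> p u v w)) = l"
    and forms: "three_form M \<A> \<psi>" "three_form M \<A> \<beta>"
    and T: "\<And>p Z1 Z2 Z3. p \<in> topspace M \<Longrightarrow> Z1 \<in> T01 \<epsilon> (J p) \<or> Z2 \<in> T01 \<epsilon> (J p) \<Longrightarrow>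
        eps_extend3 \<epsilon> (\<Psi> p) Z1 Z2 Z3 = 0"
    using su unfolding su_reduction_def form30_def \<psi>_def \<beta>_def by blast
  have \<Psi>_J: "\<Psi> p (J p u) v w = ieps_times \<epsilon> (\<Psi> p u v w)" "\<Psi> p u (J p v) w = ieps_times \<epsilon> (\<Psi> p u v w)"
    if p: "p \<in> topspace M" for p u v w
  proof -
    interpret eps_hermitian "g p" "J p" \<epsilon> by (rule eps_hermitian_at[OF p])
    have lin: "linear (\<lambda>u. h p u v w)" and sk: "h p u v w = - h p v u w" "h p u v w = - h p u w v"
      if "three_form M \<A> h" for h u v w using that p unfolding three_form_def by blast+
    have z1: "h p 0 v w = 0" "h p (- u) v w = - h p u v w" if "three_form M \<A> h" for h u v w
      using linear_0[OF lin[OF that]] linear_neg[OF lin[OF that]] by auto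
    have z2: "h p u 0 w = 0" "h p u (- v) w = - h p u v w" if "three_form M \<A> h" for h u v w
      using sk(1)[OF that, of u 0 w] sk(1)[OF that, of u "- v" w] sk(1)[OF that, of u v w] z1[OF that] by auto
    have z3: "h p u v 0 = 0" if "three_form M \<A> h" for h u v
      using sk(2)[OF that, of u v 0] z2[OF that] by auto
    have \<Psi>0: "\<Psi> p 0 v w = 0" "\<Psi> p u 0 w = 0" "\<Psi> p u v 0 = 0"
      "\<Psi> p (- u) v w = - \<Psi> p u v w" "\<Psi> p u (- v) w = - \<Psi> p u v w" for u v w
      using z1[OF forms(1)] z1[OF forms(2)] z2[OF forms(1)] z2[OF forms(2)] z3[OF forms(1)] z3[OF forms(2)]
      by (simp_all add: prod_eq_iff \<psi>_def \<beta>_def)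
    note t = T01_I[OF linear_j jj]
    \<comment> \<open>Testing on a (0,1)-vector in one slot and real vectors in the others recovers
      how \<open>J\<close> acts on \<open>\<Psi>\<close>.\<close>
    have "eps_extend3 \<epsilon> (\<Psi> p) (- J p u, u) (v, 0) (w, 0) = 0" using T[OF p] t by blast
    then show "\<Psi> p (J p u) v w = ieps_times \<epsilon> (\<Psi> p u v w)"
      by (simp add: eps_extend3_def eps_extend_real \<Psi>0) (simp add: eps_extend_def \<Psi>0)
    have "eps_extend3 \<epsilon> (\<Psi> p) (u, 0) (- J p v, v) (w, 0) = 0" using T[OF p] t by blast
    then show "\<Psi> p u (J p v) w = ieps_times \<epsilon> (\<Psi> p u v w)"
      by (simp add: eps_extend3_def eps_extend_real \<Psi>0) (simp add: eps_extend_def \<Psi>0)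
  qed
  have \<psi>_J: "\<psi> p (J p u) v w = \<psi> p u (J p v) w" and \<beta>_eq: "\<beta> p u v w = \<epsilon> * \<psi> p (J p u) v w"
    if p: "p \<in> topspace M" for p u v w
  proof -
    interpret eps_hermitian "g p" "J p" \<epsilon> by (rule eps_hermitian_at[OF p])
    show "\<psi> p (J p u) v w = \<psi> p u (J p v) w" "\<beta> p u v w = \<epsilon> * \<psi> p (J p u) v w"
      by (simp_all add: \<psi>_def \<beta>_def \<Psi>_J[OF p] ieps_times_def)
  qed
  interpret closed_structure_form M \<A> \<epsilon> g J \<omega> \<psi>
    by (rule closed_structure_form.intro[OF hermitian_mfd_axioms closed_structure_form_axioms.intro])
      (use forms \<psi>_J d\<omega> in \<open>auto simp: \<psi>_def\<close>)
  have main: "nabla_endo \<A> g J p a a = 0 \<and> (u \<noteq> 0 \<longrightarrow> (\<exists>v. nabla_endo \<A> g J p u v \<noteq> 0))"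
    if p: "p \<in> topspace M" for p a u
  proof -
    obtain e1 e2 e3 s1 s2 s3 B where jet: "form_jet (g p) (J p) \<epsilon> e1 e2 e3 s1 s2 s3 (\<psi> p) (nabla_endo \<A> g J p) B"
      and d: "\<And>\<beta> u v w z. three_form M \<A> \<beta> \<Longrightarrow> (\<And>p u v w. p \<in> topspace M \<Longrightarrow> \<beta> p u v w = \<epsilon> * \<psi> p (J p u) v w) \<Longrightarrow>
        ext_deriv3 \<A> \<beta> p u v w z = alt4 (form_jet.C (J p) \<epsilon> (\<psi> p) (nabla_endo \<A> g J p) B) u v w z"
      using form_jet_at[OF p] by metis
    interpret form_jet "g p" "J p" \<epsilon> e1 e2 e3 s1 s2 s3 "\<psi> p" "nabla_endo \<A> g J p" B by fact
    \<comment> \<open>Non-degeneracy is taken from the length of \<open>\<Psi>\<close>, since the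
      relation between \<open>\<psi>\<close> and nabla J is still to be proved.\<close>
    have "8 * kap = l"
      using l(2)[OF p] frame_sum3_psi[OF p, of "\<Psi> p"] \<beta>_eq[OF p]
        frame_sum3_form30[OF form30_frame_axioms]
      by (simp add: \<psi>_def \<beta>_def prod_eq_iff kap_def al_def be_def)
    then have kap: "kap \<noteq> 0" using l(1) by auto
    have cyc: "g p v (nabla_endo \<A> g J p u w) + g p w (nabla_endo \<A> g J p v u) + g p u (nabla_endo \<A> g J p w v)
        = 3 * \<psi> p u v w" for u v w
      using ext_deriv2_omega[OF p, of u v w] d_omega[OF p, of u v w] by simp
    have "alt4 C u v w z = 2 * \<kappa> * W u v w z" for u v w z
      using d[OF forms(2) \<beta>_eq, of u v w z] d\<psi>[OF p, of u v w z]
      unfolding \<beta>_def wedge22_omega[OF p] W_def by simp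
    note alternating = J'_alternating[OF cyc this kap]
    have nabla_skew: "nabla_endo \<A> g J p a b = - nabla_endo \<A> g J p b a" for a b
      using alternating[of "a + b"] alternating[of a] alternating[of b]
      by (simp add: linear_add[OF J'_linear(1)] linear_add[OF J'_linear(2)] eq_neg_iff_add_eq_0 add.commute)
    \<comment> \<open>Once nabla J is alternating, the three terms of \<open>cyc\<close> agree;
      nabla J is then the vector product of \<open>\<psi>\<close>, and strictness reduces to
      \<open>cross_eq_0\<close>.\<close>
    have "nabla_endo \<A> g J p u v = cross u v" for u v
    proof (rule g_eqI)
      fix w
      have r: "g p v (nabla_endo \<A> g J p w u) = g p w (nabla_endo \<A> g J p u v)" for u v w
        using J'_skew[of v w u] nabla_skew[of w u] J'_skew[of w u v] by simp
      have "g p w (nabla_endo \<A> g J p u v) = \<psi> p u w v"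
        using cyc[where u = u and v = w and w = v] r[where v = v and w = w and u = u] r[where v = u and w = v and u = w] by linarith
      then show "g p (nabla_endo \<A> g J p u v) w = g p (cross u v) w"
        using g_cross[of w u v] by (simp add: g_sym[of _ w])
    qed
    moreover have "u = 0" if "\<And>v. cross u v = 0"
      by (rule cross_eq_0[OF kap that])
    ultimately show ?thesis using alternating by auto
  qed
  then show ?thesis
    unfolding strict_nearly_kaehler_def nearly_kaehler_def by blast
qed

end

theorem theorem3p14:
  fixes M :: "'a topology" and \<A> :: "('a, 6) chart set" and \<epsilon> :: real
    and g :: "('a, 6) cov2" and J :: "('a, 6) endo" and \<omega> :: "('a, 6) cov2"
  assumes "\<epsilon> = 1 \<or> \<epsilon> = - 1"
    and "smooth_manifold M \<A>"
    and "connected_space M"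
    and "almost_eps_hermitian \<epsilon> M \<A> g J \<omega>"
  shows "(strict_nearly_kaehler M \<A> g J \<and> (\<forall>p\<in>topspace M. sqnorm_nabla \<A> g J p \<noteq> 0)) \<longleftrightarrow>
    (\<exists>\<Psi> \<kappa>. su_reduction \<epsilon> M \<A> g J \<Psi> \<and>
       \<kappa> \<noteq> 0 \<and> (\<forall>p\<in>topspace M. \<kappa> = sqnorm_nabla \<A> g J p / 4) \<and>
       (\<forall>p\<in>topspace M. \<forall>u v w. ext_deriv2 \<A> \<omega> p u v w = 3 * fst (\<Psi> p u v w)) \<and>
       (\<forall>p\<in>topspace M. \<forall>u v w z.
          ext_deriv3 \<A> (\<lambda>q a b c. snd (\<Psi> q a b c)) p u v w z = 2 * \<kappa> * wedge22 \<omega> \<omega> p u v w z))"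
proof -
  interpret hermitian_mfd M \<A> \<epsilon> g J \<omega>
    by (intro hermitian_mfd.intro smooth_mfd.intro hermitian_mfd_axioms.intro assms)
  show ?thesis
  proof
    assume "strict_nearly_kaehler M \<A> g J \<and> (\<forall>p\<in>topspace M. sqnorm_nabla \<A> g J p \<noteq> 0)"
    then show "\<exists>\<Psi> \<kappa>. su_reduction \<epsilon> M \<A> g J \<Psi> \<and>
       \<kappa> \<noteq> 0 \<and> (\<forall>p\<in>topspace M. \<kappa> = sqnorm_nabla \<A> g J p / 4) \<and>
       (\<forall>p\<in>topspace M. \<forall>u v w. ext_deriv2 \<A> \<omega> p u v w = 3 * fst (\<Psi> p u v w)) \<and>
       (\<forall>p\<in>topspace M. \<forall>u v w z.
          ext_deriv3 \<A> (\<lambda>q a b c. snd (\<Psi> q a b c)) p u v w z = 2 * \<kappa> * wedge22 \<omega> \<omega> p u v w z)"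
      using structure_equations_of_nearly_kaehler[OF assms(3)] by (simp add: strict_nearly_kaehler_def)
  next
    assume "\<exists>\<Psi> \<kappa>. su_reduction \<epsilon> M \<A> g J \<Psi> \<and>
       \<kappa> \<noteq> 0 \<and> (\<forall>p\<in>topspace M. \<kappa> = sqnorm_nabla \<A> g J p / 4) \<and>
       (\<forall>p\<in>topspace M. \<forall>u v w. ext_deriv2 \<A> \<omega> p u v w = 3 * fst (\<Psi> p u v w)) \<and>
       (\<forall>p\<in>topspace M. \<forall>u v w z.
          ext_deriv3 \<A> (\<lambda>q a b c. snd (\<Psi> q a b c)) p u v w z = 2 * \<kappa> * wedge22 \<omega> \<omega> p u v w z)"
    then obtain \<Psi> \<kappa> where H: "su_reduction \<epsilon> M \<A> g J \<Psi>" "\<kappa> \<noteq> 0"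
      "\<forall>p\<in>topspace M. \<kappa> = sqnorm_nabla \<A> g J p / 4"
      "\<forall>p\<in>topspace M. \<forall>u v w. ext_deriv2 \<A> \<omega> p u v w = 3 * fst (\<Psi> p u v w)"
      "\<forall>p\<in>topspace M. \<forall>u v w z.
          ext_deriv3 \<A> (\<lambda>q a b c. snd (\<Psi> q a b c)) p u v w z = 2 * \<kappa> * wedge22 \<omega> \<omega> p u v w z"
      by blast
    have "strict_nearly_kaehler M \<A> g J"
      by (rule nearly_kaehler_of_structure_equations[OF H(1)]) (use H(4,5) in blast)+
    moreover have "\<forall>p\<in>topspace M. sqnorm_nabla \<A> g J p \<noteq> 0" using H(2,3) by force
    ultimately show "strict_nearly_kaehler M \<A> g J \<and> (\<forall>p\<in>topspace M. sqnorm_nabla \<A> g J p \<noteq> 0)" by blast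
  qed
qed

end
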